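(* Consider the translation invariant network and the supply rate $S(t)$ described in the context, and suppose that $\mathsf{A}(\sigma)$ is Hurwitz for every $\sigma\in\mathbb{T}^\nu$. Define the spatio-temporal transfer function $F(s,\sigma)=\mathsf{C}(\sigma)(sI_n-\mathsf{A}(\sigma))^{-1}\mathsf{B}(\sigma)+\mathsf{D}(\sigma)\in\mathbb{C}^{r\times m}$. Then the network is passive, in the sense that for zero initial state $x(0)=0$ and every input $u$ with $\int_0^T\sum_{k\in\mathbb{Z}^\nu}|u_k(t)|^2dt<\infty$ for all $T>0$, the work satisfies $$W(T):=\int_0^TS(t)\,dt\ge 0\quad\text{for all }T>0,$$ if and only if $$E(\omega,\sigma):=F(i\omega,\sigma)^*\mathsf{G}(\sigma)^*+\mathsf{G}(\sigma)F(i\omega,\sigma)\succcurlyeq 0$$ for almost all $(\omega,\sigma)\in\mathbb{R}\times\mathbb{T}^\nu$.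
   Context: Fix integers $\nu,n,m,r\ge1$ and let $\mathbb{T}=[-\pi,\pi)$. A translation invariant network on $\mathbb{Z}^\nu$ is specified by real matrices $A_\ell\in\mathbb{R}^{n\times n}$, $B_\ell\in\mathbb{R}^{n\times m}$, $C_\ell\in\mathbb{R}^{r\times n}$, $D_\ell\in\mathbb{R}^{r\times m}$, $\ell\in\mathbb{Z}^\nu$, with $\sum_\ell\big\|\begin{bmatrix}A_\ell&B_\ell\\C_\ell&D_\ell\end{bmatrix}\big\|^2<\infty$; symbols $\mathsf{A}(\sigma)=\sum_\ell e^{-i\ell^T\sigma}A_\ell$ (as an $L^2(\mathbb{T}^\nu)$-limit) and similarly $\mathsf{B},\mathsf{C},\mathsf{D}$, each with finite essential supremum of the operator norm over $\sigma\in\mathbb{T}^\nu$, so that the block Toeplitz matrices $A=(A_{j-k})_{j,k}$, $B$, $C$, $D$ are bounded operators between $L^2(\mathbb{Z}^\nu,\mathbb{R}^m)$, $L^2(\mathbb{Z}^\nu,\mathbb{R}^n)$, $L^2(\mathbb{Z}^\nu,\mathbb{R}^r)$. State, input and output obey $\dot x_j=\sum_k(A_{j-k}x_k+B_{j-k}u_k)$, $y_j=\sum_k(C_{j-k}x_k+D_{j-k}u_k)$ for $j\in\mathbb{Z}^\nu$, i.e. $x(t)=e^{tA}x(0)+\int_0^te^{(t-\tau)A}Bu(\tau)d\tau$, $y=Cx+Du$. Supply rate: given real $G_\ell\in\mathbb{R}^{m\times r}$ with $\sum_\ell\|G_\ell\|^2<\infty$ and symbol $\mathsf{G}(\sigma)=\sum_\ell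 e^{-i\ell^T\sigma}G_\ell$ with $\operatorname{ess\,sup}_\sigma\|\mathsf{G}(\sigma)\|<\infty$, $S(t)=\sum_{j,k\in\mathbb{Z}^\nu}u_j(t)^TG_{j-k}y_k(t)$. *)

theory Defs
  imports "HOL-Analysis.Analysis"
begin

text \<open>The lattice Z^nu is int^'v, the torus T^nu = [-pi,pi)^nu is a subset of real^'v.
  State, input, net_output dimensions n, m, r are the finite types 'n, 'm, 'r.\<close>

definition torus :: "(real^'v) set" where
  "torus = {\<sigma>. \<forall>i. - pi \<le> \<sigma>$i \<and> \<sigma>$i < pi}"

definition cmat :: "real^'b^'a \<Rightarrow> complex^'b^'a" where
  "cmat M = (\<chi> i j. complex_of_real (M$i$j))"

definition fourier_term :: "(int^'v \<Rightarrow> real^'b^'a) \<Rightarrow> int^'v \<Rightarrow> real^'v \<Rightarrow> complex^'b^'a" where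
  "fourier_term K l \<sigma> =
     (\<chi> i j. cis (- (\<Sum>k\<in>UNIV. real_of_int (l$k) * \<sigma>$k)) * complex_of_real (K l $ i $ j))"

definition is_symbol_of :: "(real^'v \<Rightarrow> complex^'b^'a) \<Rightarrow> (int^'v \<Rightarrow> real^'b^'a) \<Rightarrow> bool" where
  "is_symbol_of Ks K \<longleftrightarrow> Ks \<in> borel_measurable lborel \<and>
     ((\<lambda>F. \<integral>\<^sup>+ \<sigma>\<in>torus. ennreal ((norm (Ks \<sigma> - (\<Sum>l\<in>F. fourier_term K l \<sigma>)))^2) \<partial>lborel)
        \<longlongrightarrow> 0) (finite_subsets_at_top UNIV)"

definition ess_bounded_symbol :: "(real^'v \<Rightarrow> complex^'b^'a) \<Rightarrow> bool" where
  "ess_bounded_symbol Ks \<longleftrightarrow>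
     (\<exists>M. AE \<sigma> in lborel. \<sigma> \<in> torus \<longrightarrow> onorm (\<lambda>v. Ks \<sigma> *v v) \<le> M)"

definition toep :: "(int^'v \<Rightarrow> real^'b^'a) \<Rightarrow> (int^'v \<Rightarrow> real^'b) \<Rightarrow> int^'v \<Rightarrow> real^'a" where
  "toep K x j = infsum (\<lambda>k. K (j - k) *v x k) UNIV"

text \<open>(e^{tA} x)_j = sum_p t^p/p! (A^p x)_j (A is bounded on L^2).\<close>
definition semigroup :: "(int^'v \<Rightarrow> real^'n^'n) \<Rightarrow> real \<Rightarrow> (int^'v \<Rightarrow> real^'n) \<Rightarrow> int^'v \<Rightarrow> real^'n" where
  "semigroup A t x j = (\<Sum>p. (t ^ p / fact p) *\<^sub>R ((toep A ^^ p) x j))"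

text \<open>State with zero initial net_state: x(t) = int_0^t e^{(t-tau)A} B u(tau) dtau (componentwise).\<close>
definition net_state :: "(int^'v \<Rightarrow> real^'n^'n) \<Rightarrow> (int^'v \<Rightarrow> real^'m^'n) \<Rightarrow>
    (real \<Rightarrow> int^'v \<Rightarrow> real^'m) \<Rightarrow> real \<Rightarrow> int^'v \<Rightarrow> real^'n" where
  "net_state A B u t j = set_lebesgue_integral lborel {0..t}
     (\<lambda>\<tau>. semigroup A (t - \<tau>) (toep B (u \<tau>)) j)"

definition net_output :: "(int^'v \<Rightarrow> real^'n^'n) \<Rightarrow> (int^'v \<Rightarrow> real^'m^'n) \<Rightarrow>
    (int^'v \<Rightarrow> real^'n^'r) \<Rightarrow> (int^'v \<Rightarrow> real^'m^'r) \<Rightarrow>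
    (real \<Rightarrow> int^'v \<Rightarrow> real^'m) \<Rightarrow> real \<Rightarrow> int^'v \<Rightarrow> real^'r" where
  "net_output A B C D u t j = toep C (net_state A B u t) j + toep D (u t) j"

definition supply_rate :: "(int^'v \<Rightarrow> real^'r^'m) \<Rightarrow> (int^'v \<Rightarrow> real^'n^'n) \<Rightarrow> (int^'v \<Rightarrow> real^'m^'n) \<Rightarrow>
    (int^'v \<Rightarrow> real^'n^'r) \<Rightarrow> (int^'v \<Rightarrow> real^'m^'r) \<Rightarrow>
    (real \<Rightarrow> int^'v \<Rightarrow> real^'m) \<Rightarrow> real \<Rightarrow> real" where
  "supply_rate G A B C D u t = infsum (\<lambda>j. u t j \<bullet> toep G (net_output A B C D u t) j) UNIV"

definition work :: "(int^'v \<Rightarrow> real^'r^'m) \<Rightarrow> (int^'v \<Rightarrow> real^'n^'n) \<Rightarrow> (int^'v \<Rightarrow> real^'m^'n) \<Rightarrow>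
    (int^'v \<Rightarrow> real^'n^'r) \<Rightarrow> (int^'v \<Rightarrow> real^'m^'r) \<Rightarrow>
    (real \<Rightarrow> int^'v \<Rightarrow> real^'m) \<Rightarrow> real \<Rightarrow> real" where
  "work G A B C D u T = set_lebesgue_integral lborel {0..T} (supply_rate G A B C D u)"

definition admissible_input :: "(real \<Rightarrow> int^'v \<Rightarrow> real^'m) \<Rightarrow> bool" where
  "admissible_input u \<longleftrightarrow> (\<forall>k. (\<lambda>t. u t k) \<in> borel_measurable lborel) \<and>
     (\<forall>T>0. (\<integral>\<^sup>+ t\<in>{0..T}. (\<integral>\<^sup>+ k. ennreal ((norm (u t k))^2) \<partial>count_space UNIV) \<partial>lborel) < \<infinity>)"

definition passive_net :: "(int^'v \<Rightarrow> real^'r^'m) \<Rightarrow> (int^'v \<Rightarrow> real^'n^'n) \<Rightarrow> (int^'v \<Rightarrow> real^'m^'n) \<Rightarrow>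
    (int^'v \<Rightarrow> real^'n^'r) \<Rightarrow> (int^'v \<Rightarrow> real^'m^'r) \<Rightarrow> bool" where
  "passive_net G A B C D \<longleftrightarrow>
     (\<forall>u. admissible_input u \<longrightarrow> (\<forall>T>0. work G A B C D u T \<ge> 0))"

definition cmat_adj :: "complex^'b^'a \<Rightarrow> complex^'a^'b" where
  "cmat_adj M = (\<chi> i j. cnj (M$j$i))"

definition eigenvalue :: "complex^'n^'n \<Rightarrow> complex \<Rightarrow> bool" where
  "eigenvalue M c \<longleftrightarrow> (\<exists>v. v \<noteq> 0 \<and> M *v v = c *s v)"

definition hurwitz :: "complex^'n^'n \<Rightarrow> bool" where
  "hurwitz M \<longleftrightarrow> (\<forall>c. eigenvalue M c \<longrightarrow> Re c < 0)"

definition psd :: "complex^'n^'n \<Rightarrow> bool" where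
  "psd M \<longleftrightarrow> (\<forall>v. Im (\<Sum>i\<in>UNIV. \<Sum>j\<in>UNIV. cnj (v$i) * M$i$j * v$j) = 0 \<and>
                   0 \<le> Re (\<Sum>i\<in>UNIV. \<Sum>j\<in>UNIV. cnj (v$i) * M$i$j * v$j))"

definition transfer :: "(real^'v \<Rightarrow> complex^'n^'n) \<Rightarrow> (real^'v \<Rightarrow> complex^'m^'n) \<Rightarrow>
    (real^'v \<Rightarrow> complex^'n^'r) \<Rightarrow> (real^'v \<Rightarrow> complex^'m^'r) \<Rightarrow> complex \<Rightarrow> real^'v \<Rightarrow> complex^'m^'r" where
  "transfer As Bs Cs Ds s \<sigma> = Cs \<sigma> ** matrix_inv (mat s - As \<sigma>) ** Bs \<sigma> + Ds \<sigma>"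

definition Emat :: "(real^'v \<Rightarrow> complex^'r^'m) \<Rightarrow> (real^'v \<Rightarrow> complex^'n^'n) \<Rightarrow> (real^'v \<Rightarrow> complex^'m^'n) \<Rightarrow>
    (real^'v \<Rightarrow> complex^'n^'r) \<Rightarrow> (real^'v \<Rightarrow> complex^'m^'r) \<Rightarrow> real \<Rightarrow> real^'v \<Rightarrow> complex^'m^'m" where
  "Emat Gs As Bs Cs Ds \<omega> \<sigma> =
     (let F = transfer As Bs Cs Ds (\<i> * complex_of_real \<omega>) \<sigma>
      in cmat_adj F ** cmat_adj (Gs \<sigma>) + Gs \<sigma> ** F)"

end

theory Submission
  imports "HOL-Probability.Probability" "HOL-Computational_Algebra.Fundamental_Theorem_Algebra" Defs
begin

text \<open>
  The Fourier transform in space turns the Toeplitz operators into multiplication by their symbols,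
  so that the work becomes an average over the torus of the work of the finite-dimensional systems
  with matrices \<open>As \<sigma>, Bs \<sigma>, Cs \<sigma>, Ds \<sigma>\<close>.

  If the transfer function is positive, then for each \<open>\<sigma>\<close> a Plancherel identity in time, regularised
  by a Gaussian weight in frequency, shows that the work of the \<open>\<sigma>\<close>-system is nonnegative for inputs
  that are bounded and finitely supported in space; truncation and dominated convergence extend this
  to all admissible inputs.

  Conversely, an input \<open>cis (\<omega> t) p(\<sigma>) \<eta>\<close> with a trigonometric polynomial \<open>p\<close> is admissible up to taking
  real parts. By density of the trigonometric polynomials, passivity then gives nonnegative work for
  almost every \<open>\<sigma>\<close>, and since \<open>As \<sigma>\<close> is Hurwitz the average of the work over a long time tends
  to the quadratic form of the transfer function at \<open>\<omega>\<close>.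
\<close>

section \<open>Complex matrices and the matrix exponential\<close>

text \<open>Three obstacles shape the proof. Inputs are only measurable in time, and so is the
  feedthrough part of the output; a smoothed pairing therefore cannot be sent to its limit by
  continuity alone. Only the part that passes through the state is continuous. The feedthrough part
  is compared instead of passed to the limit: the kernel is symmetrised, and the real part of the
  form of G D is nonnegative because the resolvent vanishes at infinite frequency. Next,
  \<open>hurwitz\<close> holds pointwise in \<sigma> with no common decay rate. Bounds uniform in
  \<sigma> come from the norms of the symbols on a finite time interval, while limits in time are
  taken at fixed \<sigma>; so necessity needs an almost-everywhere statement for every finite
  horizon before the horizon may grow. Finally, the network is real and the test inputs are complex.
  The real and imaginary parts of the lattice coefficients form two real inputs, whose mixed
  pairings are real after averaging over the torus and disappear from the real part once multiplied
  by \<i>.\<close>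

lemma matrix_vector_mult_nth: "(M *v x) $ i = (\<Sum>j\<in>UNIV. M $ i $ j * x $ j)"
  by (simp add: matrix_vector_mult_def)

text \<open>\<open>norm M\<close> is the Euclidean norm of the nested vector type, that is the
  Frobenius norm; Cauchy-Schwarz row by row makes it dominate the operator norm. All bounds on
  symbols are kept in this norm; the operator norm of the hypotheses is converted into it by
  \<open>norm_matrix_le_onorm\<close>.\<close>

lemma norm_matrix_vector_mult_le:
  fixes M :: "'a::real_normed_field^'n^'m"
  shows "norm (M *v x) \<le> norm M * norm x"
proof -
  have "norm ((M *v x) $ i) \<le> norm (M $ i) * norm x" for i
  proof -
    have "norm ((M *v x) $ i) \<le> (\<Sum>j\<in>UNIV. norm (M $ i $ j * x $ j))"
      unfolding matrix_vector_mult_nth by (rule norm_sum)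
    also have "\<dots> \<le> L2_set (\<lambda>j. norm (M $ i $ j)) UNIV * L2_set (\<lambda>j. norm (x $ j)) UNIV"
      using L2_set_mult_ineq[of "\<lambda>j. norm (M $ i $ j)" "\<lambda>j. norm (x $ j)" UNIV]
      by (simp add: norm_mult)
    finally show ?thesis by (simp add: norm_vec_def)
  qed
  then have "norm (M *v x) \<le> L2_set (\<lambda>i. norm (M $ i) * norm x) UNIV"
    unfolding norm_vec_def[of "M *v x"] by (intro L2_set_mono) auto
  also have "\<dots> = norm M * norm x"
    by (simp add: L2_set_left_distrib norm_vec_def)
  finally show ?thesis .
qed

text \<open>Treating the matrix action, and below the scalar action and \<open>cdot\<close>, as
  \<open>bounded_bilinear\<close> maps gives product rules, continuity, and the exchange with
  integrals and series from one source.\<close>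

lemma bounded_bilinear_matrix_vector_mult:
  "bounded_bilinear ((*v) :: 'a::real_normed_field^'n^'m \<Rightarrow> _)"
proof
  show "\<exists>K. \<forall>a b. norm ((a :: 'a^'n^'m) *v b) \<le> norm a * norm b * K"
    using norm_matrix_vector_mult_le by (auto intro!: exI[of _ 1])
qed (simp_all add: vec_eq_iff matrix_vector_mult_nth algebra_simps sum.distrib scaleR_sum_right)

lemma norm_smult_vec: "norm (c *s (v :: 'a::real_normed_field^'n)) = norm c * norm v"
  by (simp add: norm_vec_def norm_mult L2_set_right_distrib)

lemma bounded_bilinear_smult_vec:
  "bounded_bilinear ((*s) :: 'a::real_normed_field \<Rightarrow> 'a^'n \<Rightarrow> _)"
proof
  show "\<exists>K. \<forall>a b. norm ((a :: 'a) *s (b :: 'a^'n)) \<le> norm a * norm b * K"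
    by (auto intro!: exI[of _ 1] simp: norm_smult_vec)
qed (simp_all add: vec_eq_iff algebra_simps)

text \<open>Hermitian inner product, conjugate-linear in the first slot, so that
  \<open>cdot v (M *v v)\<close> is the quadratic form that occurs in \<open>psd\<close>.\<close>

definition cdot :: "complex^'n \<Rightarrow> complex^'n \<Rightarrow> complex" where
  "cdot v w = (\<Sum>i\<in>UNIV. cnj (v $ i) * w $ i)"

lemma norm_cdot_le: "norm (cdot v w) \<le> norm v * norm w"
proof -
  have "norm (cdot v w) \<le> (\<Sum>j\<in>UNIV. norm (cnj (v $ j) * w $ j))"
    unfolding cdot_def by (rule norm_sum)
  also have "\<dots> \<le> L2_set (\<lambda>j. norm (v $ j)) UNIV * L2_set (\<lambda>j. norm (w $ j)) UNIV"
    using L2_set_mult_ineq[of "\<lambda>j. norm (v $ j)" "\<lambda>j. norm (w $ j)" UNIV]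
    by (simp add: norm_mult)
  finally show ?thesis by (simp add: norm_vec_def)
qed

lemma bounded_bilinear_cdot: "bounded_bilinear cdot"
proof
  show "\<exists>K. \<forall>a b. norm (cdot (a :: complex^'n) b) \<le> norm a * norm b * K"
    using norm_cdot_le by (auto intro!: exI[of _ 1])
qed (simp_all add: cdot_def algebra_simps sum.distrib scaleR_sum_right)

lemma cdot_smult: "cdot (a *s v) w = cnj a * cdot v w" "cdot v (a *s w) = a * cdot v w"
  by (simp_all add: cdot_def sum_distrib_left mult_ac)

lemmas mv_simps =
  bounded_bilinear.add_left[OF bounded_bilinear_matrix_vector_mult]
  bounded_bilinear.add_right[OF bounded_bilinear_matrix_vector_mult]
  bounded_bilinear.diff_left[OF bounded_bilinear_matrix_vector_mult]
  bounded_bilinear.diff_right[OF bounded_bilinear_matrix_vector_mult]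
  bounded_bilinear.minus_right[OF bounded_bilinear_matrix_vector_mult]
  bounded_bilinear.scaleR_right[OF bounded_bilinear_matrix_vector_mult]

lemma matrix_vector_mult_smult: "M *v (c *s v) = c *s (M *v (v :: 'a::comm_semiring_1^'n))"
  by (simp add: vec_eq_iff matrix_vector_mult_nth sum_distrib_left mult_ac)

lemma scaleR_eq_smult_complex: "r *\<^sub>R (v :: complex^'n) = complex_of_real r *s v"
  by (simp only: vec_eq_iff vector_scaleR_component vector_smult_component)
     (simp add: scaleR_conv_of_real)

lemma cdot_commute: "cdot v w = cnj (cdot w v)"
  by (simp add: cdot_def mult.commute)

lemma cdot_matrix_adj: "cdot v (cmat_adj M *v w) = cnj (cdot w (M *v v))"
proof -
  have "cdot v (cmat_adj M *v w) = (\<Sum>i\<in>UNIV. \<Sum>j\<in>UNIV. cnj (v $ i) * (cnj (M $ j $ i) * w $ j))"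
    by (simp add: cdot_def matrix_vector_mult_nth cmat_adj_def sum_distrib_left)
  also have "\<dots> = (\<Sum>j\<in>UNIV. \<Sum>i\<in>UNIV. cnj (v $ i) * (cnj (M $ j $ i) * w $ j))"
    by (rule sum.swap)
  also have "\<dots> = cnj (cdot w (M *v v))"
    by (simp add: cdot_def matrix_vector_mult_nth sum_distrib_left mult_ac)
  finally show ?thesis .
qed

text \<open>Writing H for the product of \<open>Gs \<sigma>\<close> and the transfer matrix,
  \<open>Emat\<close> is H plus its adjoint. Its quadratic form is twice the real part of that of H,
  and the clause on imaginary parts holds by itself.\<close>

lemma psd_Emat_iff:
  "psd (Emat Gs As Bs Cs Ds \<omega> \<sigma>) \<longleftrightarrow>
     (\<forall>v. 0 \<le> Re (cdot v (Gs \<sigma> *v (transfer As Bs Cs Ds (\<i> * complex_of_real \<omega>) \<sigma> *v v))))"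
proof -
  define F where "F = transfer As Bs Cs Ds (\<i> * complex_of_real \<omega>) \<sigma>"
  have quad: "(\<Sum>i\<in>UNIV. \<Sum>j\<in>UNIV. cnj (v $ i) * M $ i $ j * v $ j) = cdot v (M *v v)"
    for M :: "complex^'a^'a" and v
    by (simp add: cdot_def matrix_vector_mult_nth sum_distrib_left mult_ac)
  have "cdot v (Emat Gs As Bs Cs Ds \<omega> \<sigma> *v v)
      = cnj (cdot v (Gs \<sigma> *v (F *v v))) + cdot v (Gs \<sigma> *v (F *v v))" for v
  proof -
    have "cdot v (cmat_adj F *v (cmat_adj (Gs \<sigma>) *v v)) = cnj (cdot v (Gs \<sigma> *v (F *v v)))"
      by (simp add: cdot_matrix_adj cdot_commute[of "cmat_adj (Gs \<sigma>) *v v"])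
    then show ?thesis
      unfolding Emat_def Let_def F_def[symmetric] mv_simps matrix_vector_mul_assoc[symmetric]
        bounded_bilinear.add_right[OF bounded_bilinear_cdot] by simp
  qed
  then show ?thesis
    unfolding psd_def quad F_def by simp
qed

section \<open>The matrix exponential as a power series acting on vectors\<close>

definition mexp :: "complex^'n^'n \<Rightarrow> real \<Rightarrow> complex^'n \<Rightarrow> complex^'n" where
  "mexp M t v = (\<Sum>p. (t ^ p / fact p) *\<^sub>R (((*v) M ^^ p) v))"

lemma norm_funpow_mult_le: "norm (((*v) M ^^ p) v) \<le> norm M ^ p * norm v"
  for M :: "complex^'n^'n"
proof (induction p)
  case (Suc p)
  have "norm (M *v ((*v) M ^^ p) v) \<le> norm M * norm (((*v) M ^^ p) v)"
    by (rule norm_matrix_vector_mult_le)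
  also have "\<dots> \<le> norm M * (norm M ^ p * norm v)"
    by (intro mult_left_mono Suc) auto
  finally show ?case by (simp add: mult_ac)
qed auto

lemma norm_mexp_term_le:
  "norm ((t ^ p / fact p) *\<^sub>R (((*v) M ^^ p) v)) \<le> (inverse (fact p) * (\<bar>t\<bar> * norm M) ^ p) * norm v"
  for M :: "complex^'n^'n"
proof -
  have "norm ((t ^ p / fact p) *\<^sub>R (((*v) M ^^ p) v)) \<le> (\<bar>t\<bar> ^ p / fact p) * (norm M ^ p * norm v)"
    using mult_left_mono[OF norm_funpow_mult_le[of p M v], of "\<bar>t\<bar> ^ p / fact p"]
    by (simp add: power_abs abs_mult)
  then show ?thesis by (simp add: power_mult_distrib field_simps)
qed

lemma summable_mexp_bound: "summable (\<lambda>p. (inverse (fact p) * (\<bar>t\<bar> * (c::real)) ^ p) * d)"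
  by (intro summable_mult2 summable_exp)

lemma summable_mexp: "summable (\<lambda>p. (t ^ p / fact p) *\<^sub>R (((*v) M ^^ p) v))"
  for M :: "complex^'n^'n"
  by (rule summable_comparison_test'[OF summable_mexp_bound[of t "norm M" "norm v"]])
     (rule norm_mexp_term_le)

lemma norm_mexp_le: "norm (mexp M t v) \<le> exp (\<bar>t\<bar> * norm M) * norm v"
proof -
  have "norm (mexp M t v) \<le> (\<Sum>p. (inverse (fact p) * (\<bar>t\<bar> * norm M) ^ p) * norm v)"
    unfolding mexp_def by (rule norm_suminf_le[OF norm_mexp_term_le summable_mexp_bound])
  also have "\<dots> = exp (\<bar>t\<bar> * norm M) * norm v"
    by (simp add: exp_def suminf_mult2[OF summable_exp, symmetric])
  finally show ?thesis .
qed

lemma funpow_mult_linear: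
  fixes M :: "complex^'n^'n"
  shows "((*v) M ^^ p) (v + w) = ((*v) M ^^ p) v + ((*v) M ^^ p) w"
  "((*v) M ^^ p) (c *s v) = c *s ((*v) M ^^ p) v"
  "((*v) M ^^ p) (M *v v) = M *v ((*v) M ^^ p) v"
  by (induction p) (simp_all add: mv_simps matrix_vector_mult_smult)

lemma mexp_add: "mexp M t (v + w) = mexp M t v + mexp M t w"
  unfolding mexp_def funpow_mult_linear
  by (simp add: scaleR_add_right suminf_add summable_mexp)

lemma mexp_smult: "mexp M t (c *s v) = c *s mexp M t v"
proof -
  have "(\<Sum>p. c *s ((t ^ p / fact p) *\<^sub>R (((*v) M ^^ p) v))) = c *s mexp M t v"
    unfolding mexp_def
    by (rule bounded_linear.suminf[OF bounded_bilinear.bounded_linear_right[OF bounded_bilinear_smult_vec]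
            summable_mexp, symmetric])
  then show ?thesis
    by (simp add: mexp_def funpow_mult_linear scaleR_eq_smult_complex vector_smult_assoc mult.commute)
qed

lemma linear_mexp: "linear (mexp M t)"
  by (rule linearI) (simp_all add: mexp_add mexp_smult scaleR_eq_smult_complex)

lemmas mexp_linear_simps =
  linear_add[OF linear_mexp] linear_diff[OF linear_mexp] linear_neg[OF linear_mexp]
  linear_scale[OF linear_mexp] linear_0[OF linear_mexp]

lemma mexp_0 [simp]: "mexp M 0 v = v"
proof -
  have "mexp M 0 v = (\<Sum>p. if p = 0 then v else 0)"
    unfolding mexp_def by (rule suminf_cong) (auto simp: power_0_left)
  then show ?thesis using suminf_finite[of "{0}" "\<lambda>p::nat. if p = 0 then v else 0"] by simp
qed

text \<open>Each component is a power series in t that converges on the whole complex plane, so it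
  may be differentiated termwise; the shifted coefficients given by \<open>diffs\<close> are those
  of the series for \<open>M *v v\<close>. The components are reassembled with the standard
  basis.\<close>

lemma mexp_has_vector_derivative:
  "((\<lambda>t. mexp M t v) has_vector_derivative mexp M t (M *v v)) (at t within S)"
proof -
  have comp: "mexp M s w $ i = (\<Sum>p. ((((*v) M ^^ p) w) $ i / fact p) * of_real s ^ p)" for s w i
    unfolding mexp_def
    by (subst bounded_linear.suminf[OF bounded_linear_vec_nth summable_mexp])
       (simp only: vector_scaleR_component, simp add: scaleR_conv_of_real mult_ac)
  have "((\<lambda>t. mexp M t v $ i) has_vector_derivative mexp M t (M *v v) $ i) (at t within S)" for i
  proof -
    let ?c = "\<lambda>p. (((*v) M ^^ p) v) $ i / fact p"
    have summ: "summable (\<lambda>n. ?c n * y ^ n)" for y :: complex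
    proof (rule summable_comparison_test'[OF summable_mexp_bound[of "norm y" "norm M" "norm v"]])
      fix n :: nat
      have "norm (?c n * y ^ n) = norm ((((*v) M ^^ n) v) $ i) * norm y ^ n / fact n"
        by (simp add: norm_mult norm_divide norm_power)
      also have "\<dots> \<le> (norm M ^ n * norm v) * norm y ^ n / fact n"
        by (intro divide_right_mono mult_right_mono order_trans[OF Finite_Cartesian_Product.norm_nth_le norm_funpow_mult_le]) auto
      finally show "norm (?c n * y ^ n) \<le> (inverse (fact n) * (\<bar>norm y\<bar> * norm M) ^ n) * norm v"
        by (simp add: power_mult_distrib field_simps)
    qed
    have "((\<lambda>x. \<Sum>n. ?c n * x ^ n) has_field_derivative (\<Sum>n. diffs ?c n * of_real t ^ n)) (at (of_real t))"
      by (rule termdiffs_strong_converges_everywhere[OF summ])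
    moreover have "diffs ?c = (\<lambda>p. (((*v) M ^^ p) (M *v v)) $ i / fact p)"
      by (rule ext) (simp add: diffs_def funpow_mult_linear fact_Suc del: of_nat_Suc)
    ultimately show ?thesis
      unfolding comp by (intro has_vector_derivative_real_field) simp
  qed
  then have "((\<lambda>t. \<Sum>i\<in>UNIV. mexp M t v $ i *s axis i 1) has_vector_derivative
      (\<Sum>i\<in>UNIV. mexp M t (M *v v) $ i *s axis i 1)) (at t within S)"
    by (intro has_vector_derivative_sum
        bounded_linear.has_vector_derivative[OF bounded_bilinear.bounded_linear_left[OF bounded_bilinear_smult_vec]])
  then show ?thesis by (simp add: basis_expansion)
qed

lemma continuous_on_mexp [continuous_intros]:
  assumes "continuous_on S f"
  shows "continuous_on S (\<lambda>x. mexp M (f x) v)"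
proof -
  have "continuous_on UNIV (\<lambda>t. mexp M t v)"
    by (rule continuous_at_imp_continuous_on)
       (use has_vector_derivative_continuous[OF mexp_has_vector_derivative] in blast)
  then show ?thesis
    by (rule continuous_on_compose2[OF _ assms]) simp
qed

section \<open>Exponential decay of Hurwitz systems by way of annihilating polynomials\<close>

definition poly_app :: "complex^'n^'n \<Rightarrow> complex poly \<Rightarrow> complex^'n \<Rightarrow> complex^'n" where
  "poly_app M p v = fold_coeffs (\<lambda>a w. a *s v + M *v w) p 0"

lemma poly_app_0 [simp]: "poly_app M 0 v = 0"
  by (simp add: poly_app_def)

lemma poly_app_pCons: "poly_app M (pCons a p) v = a *s v + M *v poly_app M p v"
proof (cases "a = 0 \<and> p = 0")
  case False
  then have "a \<noteq> 0 \<or> p \<noteq> 0" by blast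
  then show ?thesis unfolding poly_app_def by (elim disjE) simp_all
qed simp

lemma poly_app_add: "poly_app M (p + q) v = poly_app M p v + poly_app M q v"
  by (induction p q rule: poly_induct2)
     (simp_all add: poly_app_pCons mv_simps vector_sadd_rdistrib)

lemma poly_app_smult: "poly_app M (smult c p) v = c *s poly_app M p v"
  by (induction p) (simp_all add: poly_app_pCons vector_add_ldistrib matrix_vector_mult_smult)

lemma poly_app_sum: "poly_app M (sum p I) v = (\<Sum>i\<in>I. poly_app M (p i) v)"
  by (induction I rule: infinite_finite_induct) (simp_all add: poly_app_add)

lemma poly_app_monom: "poly_app M (monom c i) v = c *s ((*v) M ^^ i) v"
  for M :: "complex^'n^'n"
  by (induction i) (simp_all add: poly_app_pCons monom_Suc monom_0 matrix_vector_mult_smult)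

lemma poly_app_linear_factor:
  "poly_app M ([:-c, 1:] * q) v = M *v poly_app M q v - c *s poly_app M q v"
proof -
  have "[:-c, 1:] * q = smult (-c) q + pCons 0 q" by simp
  then show ?thesis
    by (simp only: poly_app_add poly_app_smult poly_app_pCons) (simp add: vector_smult_lneg)
qed

text \<open>A polynomial in M commutes with M - c. In the induction on the degree this shows that
  the quotient of an annihilating polynomial of v by X - c annihilates (M - c)v.\<close>

lemma poly_app_shift:
  "poly_app M q (M *v v - c *s v) = M *v poly_app M q v - c *s poly_app M q v"
  by (induction q)
     (simp_all add: poly_app_pCons mv_simps matrix_vector_mult_smult vector_ssub_ldistrib
        vector_add_ldistrib mult.commute)

text \<open>The vectors v, Mv, MMv, ... cannot stay independent in finite dimension.
  \<open>DIM(complex^'n)\<close> is the real dimension, so the coefficients found are real and the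
  degree bound is generous; only existence matters.\<close>

lemma annihilating_poly_exists: "\<exists>p. p \<noteq> 0 \<and> poly_app M p v = 0"
  for M :: "complex^'n^'n"
proof -
  define f where "f i = ((*v) M ^^ i) v" for i
  define N where "N = DIM(complex^'n)"
  show ?thesis
  proof (cases "inj_on f {..N}")
    case True
    then have "card (f ` {..N}) > DIM(complex^'n)"
      by (simp add: card_image N_def)
    then have "dependent (f ` {..N})"
      by (intro dependent_biggerset) auto
    then obtain u where u: "\<exists>x\<in>f ` {..N}. u x \<noteq> 0" "(\<Sum>x\<in>f ` {..N}. u x *\<^sub>R x) = 0"
      by (auto simp: dependent_finite)
    define p where "p = (\<Sum>i\<le>N. monom (complex_of_real (u (f i))) i)"
    have "poly_app M p v = (\<Sum>i\<le>N. u (f i) *\<^sub>R f i)"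
      by (simp add: p_def poly_app_sum poly_app_monom f_def scaleR_eq_smult_complex)
    also have "\<dots> = 0"
      using u(2) by (simp add: sum.reindex[OF True])
    finally have app: "poly_app M p v = 0" .
    from u(1) obtain k where k: "k \<le> N" "u (f k) \<noteq> 0" by auto
    have "coeff p k = of_real (u (f k))"
      using k by (simp add: p_def coeff_sum)
    then have "p \<noteq> 0" using k by auto
    with app show ?thesis by blast
  next
    case False
    \<comment> \<open>If two powers of M agree on v, the image set is too small for the dimension
      count, but the difference of the two monomials already annihilates v.\<close>
    then obtain i j where ij: "i \<noteq> j" "f i = f j" by (auto simp: inj_on_def)
    let ?p = "monom 1 i + monom (-1) j :: complex poly"
    have "coeff ?p i = 1" using ij by simp
    then have "?p \<noteq> 0" by (metis coeff_0 zero_neq_one)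
    moreover have "poly_app M ?p v = 0"
      using ij by (simp add: poly_app_add poly_app_monom f_def vector_smult_lneg)
    ultimately show ?thesis by blast
  qed
qed

definition exp_decay :: "complex^'n^'n \<Rightarrow> complex^'n \<Rightarrow> bool" where
  "exp_decay M v \<longleftrightarrow> (\<exists>C \<delta>. \<delta> > 0 \<and> (\<forall>t\<ge>0. norm (mexp M t v) \<le> C * exp (- \<delta> * t)))"

text \<open>The function \<open>exp (-\<lambda>t) mexp M t v\<close> has derivative \<open>exp (-\<lambda>t) mexp M t w\<close> with
  \<open>w = (M - \<lambda>) v\<close>, so decay passes from \<open>w\<close> to \<open>v\<close>.\<close>

lemma exp_decay_step:
  assumes w: "exp_decay M (M *v v - c *s v)" and c: "Re c < 0"
  shows "exp_decay M v"
proof -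
  define w' where "w' = M *v v - c *s v"
  obtain C \<delta>0 where C: "\<delta>0 > 0" "\<And>t. t \<ge> 0 \<Longrightarrow> norm (mexp M t w') \<le> C * exp (- \<delta>0 * t)"
    using w unfolding exp_decay_def w'_def by blast
  have "C \<ge> 0" using C(2)[of 0] by (auto intro: order_trans[OF norm_ge_zero])
  define \<rho> where "\<rho> = - Re c"
  \<comment> \<open>The rate is kept strictly below \<open>\<rho>\<close>, so that the
    antiderivative \<open>\<phi>\<close> of C exp((\<rho> - \<delta>) s) has a finite nonnegative
    factor. This also covers the resonant case \<open>\<delta>0 = \<rho>\<close>, where the exact
    solution may carry an extra factor t.\<close>
  define \<delta> where "\<delta> = min \<delta>0 (\<rho> / 2)"
  have \<delta>: "\<delta> > 0" "\<delta> \<le> \<delta>0" "\<delta> < \<rho>" using C c by (auto simp: \<delta>_def \<rho>_def)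
  define g where "g t = exp (- (of_real t * c)) *s mexp M t v" for t
  have deriv: "(g has_vector_derivative exp (- (of_real t * c)) *s mexp M t w') (at t within S)" for t S
  proof -
    have "((\<lambda>t. exp (- (complex_of_real t * c))) has_vector_derivative - c * exp (- (of_real t * c))) (at t within S)"
      by (rule has_vector_derivative_real_field) (auto intro!: derivative_eq_intros)
    from bounded_bilinear.has_vector_derivative[OF bounded_bilinear_smult_vec this mexp_has_vector_derivative[of M v t S]]
    show ?thesis
      by (simp add: g_def[abs_def] w'_def mexp_linear_simps mexp_smult vector_ssub_ldistrib
          vector_smult_lneg mult.commute)
  qed
  have cont: "continuous_on S g" for S
    unfolding continuous_on_eq_continuous_within
    using has_vector_derivative_continuous[OF deriv] by blast
  define \<phi> where "\<phi> s = C / (\<rho> - \<delta>) * exp ((\<rho> - \<delta>) * s)" for s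
  have bound: "norm (g t - g 0) \<le> \<phi> t - \<phi> 0" if "t > 0" for t
  proof (rule differentiable_bound_general[OF that cont])
    show "continuous_on {0..t} \<phi>" unfolding \<phi>_def by (intro continuous_intros)
    show "(g has_vector_derivative exp (- (of_real s * c)) *s mexp M s w') (at s)" for s
      by (rule deriv)
    show "(\<phi> has_vector_derivative C * exp ((\<rho> - \<delta>) * s)) (at s)" for s
      unfolding \<phi>_def has_real_derivative_iff_has_vector_derivative[symmetric]
      using \<delta> by (auto intro!: derivative_eq_intros)
    fix s assume s: "0 < s" "s < t"
    have "norm (exp (- (of_real s * c)) *s mexp M s w') \<le> exp (\<rho> * s) * (C * exp (- \<delta>0 * s))"
      using C(2)[of s] s by (auto simp: norm_smult_vec \<rho>_def mult.commute intro!: mult_mono)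
    also have "\<dots> \<le> exp (\<rho> * s) * (C * exp (- \<delta> * s))"
      using \<delta> s \<open>C \<ge> 0\<close> by (intro mult_left_mono) auto
    also have "\<dots> = C * exp ((\<rho> - \<delta>) * s)"
      by (simp add: exp_add[symmetric] algebra_simps)
    finally show "norm (exp (- (of_real s * c)) *s mexp M s w') \<le> C * exp ((\<rho> - \<delta>) * s)" .
  qed
  have "norm (mexp M t v) \<le> (norm v + C / (\<rho> - \<delta>)) * exp (- \<delta> * t)" if "t \<ge> 0" for t
  proof -
    have g0: "g 0 = v" by (simp add: g_def)
    have "norm (g t) \<le> norm v + \<phi> t"
    proof (cases "t = 0")
      case False
      have "norm (g t) \<le> norm (g t - g 0) + norm (g 0)" by norm
      moreover have "\<phi> 0 \<ge> 0" using \<open>C \<ge> 0\<close> \<delta> by (simp add: \<phi>_def)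
      ultimately show ?thesis using bound[of t] False that by (simp add: g0)
    qed (use \<open>C \<ge> 0\<close> \<delta> in \<open>simp add: g0 \<phi>_def\<close>)
    moreover have "norm (g t) = exp (\<rho> * t) * norm (mexp M t v)"
      by (simp add: g_def norm_smult_vec \<rho>_def mult.commute)
    ultimately have "exp (- \<rho> * t) * (exp (\<rho> * t) * norm (mexp M t v)) \<le> exp (- \<rho> * t) * (norm v + \<phi> t)"
      by (intro mult_left_mono) auto
    then have "norm (mexp M t v) \<le> exp (- \<rho> * t) * norm v + exp (- \<rho> * t) * \<phi> t"
      by (simp add: distrib_left mult.assoc[symmetric] exp_add[symmetric])
    also have "exp (- \<rho> * t) * \<phi> t = C / (\<rho> - \<delta>) * exp (- \<delta> * t)"
      by (simp add: \<phi>_def exp_add[symmetric] algebra_simps)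
    also have "exp (- \<rho> * t) * norm v \<le> exp (- \<delta> * t) * norm v"
      using \<delta> that by (intro mult_right_mono) (auto intro: mult_right_mono)
    finally show ?thesis by (simp add: algebra_simps)
  qed
  with \<delta>(1) show ?thesis unfolding exp_decay_def by blast
qed

lemma exp_decay_0 [simp]: "exp_decay M 0"
  unfolding exp_decay_def by (auto simp: mexp_linear_simps intro!: exI[of _ 0] exI[of _ 1])

text \<open>Induction on the degree of a polynomial p with p(M)v = 0 takes the place of the Jordan
  form. Split off a root c with quotient q: either q already annihilates v, or q(M)v is an
  eigenvector for c. In the second case Re c < 0, the vector (M - c)v decays because q annihilates
  it, and \<open>exp_decay_step\<close> lifts the decay to v.\<close>

lemma hurwitz_exp_decay:
  assumes "hurwitz M"
  shows "exp_decay M v"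
proof -
  have "p \<noteq> 0 \<Longrightarrow> degree p = n \<Longrightarrow> poly_app M p v = 0 \<Longrightarrow> exp_decay M v" for p n v
  proof (induction n arbitrary: p v)
    case 0
    then obtain a where "p = [:a:]" by (auto elim: degree_eq_zeroE)
    then show ?case using 0 by (auto simp: poly_app_pCons)
  next
    case (Suc n)
    then have "\<not> constant (poly p)" by (simp add: constant_degree)
    then obtain c where "poly p c = 0" using fundamental_theorem_of_algebra by blast
    then obtain q where q: "p = [:-c, 1:] * q" by (auto simp: poly_eq_0_iff_dvd elim: dvdE)
    have q0: "q \<noteq> 0" using q Suc.prems by auto
    have "degree ([:-c, 1:] * q) = degree [:-c, 1:] + degree q"
      using q0 by (intro degree_mult_eq) auto
    then have dq: "degree q = n" using q Suc.prems(2) by simp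
    define z where "z = poly_app M q v"
    have z: "M *v z = c *s z"
      using Suc.prems(3) unfolding q poly_app_linear_factor z_def by simp
    show ?case
    proof (cases "z = 0")
      case True
      then show ?thesis using Suc.IH[OF q0 dq] by (simp add: z_def)
    next
      case False
      then have "Re c < 0" using z assms unfolding hurwitz_def eigenvalue_def by blast
      moreover have "exp_decay M (M *v v - c *s v)"
        by (rule Suc.IH[OF q0 dq]) (use z in \<open>simp add: z_def poly_app_shift\<close>)
      ultimately show ?thesis by (rule exp_decay_step[rotated])
    qed
  qed
  then show ?thesis using annihilating_poly_exists[of M v] by blast
qed

text \<open>Expansion in the standard basis: the constants add up and the slowest of finitely many
  rates is kept. Both constants depend on M, hence later on \<sigma>.\<close>

lemma hurwitz_uniform_decay:
  fixes M :: "complex^'n^'n"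
  assumes "hurwitz M"
  obtains C \<delta> where "C \<ge> 0" "\<delta> > 0"
    "\<And>t v. t \<ge> 0 \<Longrightarrow> norm (mexp M t v) \<le> C * exp (- \<delta> * t) * norm v"
proof -
  have "\<exists>C \<delta>. \<delta> > 0 \<and> (\<forall>t\<ge>0. norm (mexp M t (axis i 1)) \<le> C * exp (- \<delta> * t))" for i
    using hurwitz_exp_decay[OF assms] unfolding exp_decay_def .
  then obtain C \<delta> where \<delta>: "\<And>i. \<delta> i > 0"
    and C: "\<And>i t. t \<ge> 0 \<Longrightarrow> norm (mexp M t (axis i 1)) \<le> C i * exp (- \<delta> i * t)"
    by metis
  have C0: "C i \<ge> 0" for i
    using C[of 0 i] by (auto intro: order_trans[OF norm_ge_zero])
  define d where "d = Min (range \<delta>)"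
  have d: "d > 0" "\<And>i. d \<le> \<delta> i"
    using \<delta> by (auto simp: d_def)
  have "norm (mexp M t v) \<le> (\<Sum>i\<in>UNIV. C i) * exp (- d * t) * norm v" if t: "t \<ge> 0" for t v
  proof -
    have "mexp M t v = (\<Sum>i\<in>UNIV. v $ i *s mexp M t (axis i 1))"
      using linear_sum[OF linear_mexp[of M t], of "\<lambda>i. v $ i *s axis i 1" UNIV]
      by (simp add: basis_expansion mexp_smult)
    also have "norm \<dots> \<le> (\<Sum>i\<in>UNIV. norm (v $ i) * norm (mexp M t (axis i 1)))"
      by (rule order_trans[OF norm_sum]) (simp add: norm_smult_vec)
    also have "\<dots> \<le> (\<Sum>i\<in>UNIV. norm v * (C i * exp (- d * t)))"
    proof (intro sum_mono mult_mono)
      fix i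
      have "norm (mexp M t (axis i 1)) \<le> C i * exp (- \<delta> i * t)" using C t by blast
      also have "\<dots> \<le> C i * exp (- d * t)"
        using d(2)[of i] t C0 by (intro mult_left_mono) (auto intro: mult_right_mono)
      finally show "norm (mexp M t (axis i 1)) \<le> C i * exp (- d * t)" .
    qed (auto simp: Finite_Cartesian_Product.norm_nth_le)
    finally show ?thesis
      by (simp add: sum_distrib_left sum_distrib_right mult_ac)
  qed
  moreover have "(\<Sum>i\<in>UNIV. C i) \<ge> 0" by (intro sum_nonneg C0)
  ultimately show ?thesis using that d(1) by blast
qed

section \<open>The resolvent on the imaginary axis\<close>

lemma mat_vector_mult: "mat c *v (x :: complex^'n) = c *s x"
  by (simp add: vec_eq_iff matrix_vector_mult_nth mat_def if_distrib if_distribR cong: if_cong)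

definition resolv :: "complex^'n^'n \<Rightarrow> real \<Rightarrow> complex^'n \<Rightarrow> complex^'n" where
  "resolv M \<omega> b = matrix_inv (mat (\<i> * of_real \<omega>) - M) *v b"

lemma hurwitz_not_eigenvalue:
  assumes "hurwitz M"
  shows "\<not> eigenvalue M (\<i> * of_real \<omega>)"
proof
  assume "eigenvalue M (\<i> * of_real \<omega>)"
  then have "Re (\<i> * of_real \<omega>) < 0" using assms unfolding hurwitz_def by blast
  then show False by simp
qed

text \<open>A kernel vector of i\<omega> - M would be an eigenvector with purely imaginary
  eigenvalue, so the matrix is invertible and \<open>matrix_inv\<close> is a genuine
  inverse.\<close>

lemma resolv_eq:
  assumes "hurwitz M"
  shows "(\<i> * of_real \<omega>) *s resolv M \<omega> b - M *v resolv M \<omega> b = b"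
proof -
  let ?N = "mat (\<i> * of_real \<omega>) - M"
  have "x = 0" if "?N *v x = 0" for x
  proof -
    have "M *v x = (\<i> * of_real \<omega>) *s x" using that by (simp add: mv_simps mat_vector_mult)
    then show ?thesis using hurwitz_not_eigenvalue[OF assms] unfolding eigenvalue_def by blast
  qed
  then have "\<exists>N'. N' ** ?N = mat 1"
    unfolding matrix_left_invertible_ker by blast
  then have "invertible ?N" by (simp add: invertible_left_inverse)
  then have "?N ** matrix_inv ?N = mat 1"
    unfolding invertible_def matrix_inv_def by (rule someI2_ex) blast
  then have "?N *v resolv M \<omega> b = b"
    unfolding resolv_def matrix_vector_mul_assoc by simp
  then show ?thesis by (simp add: mv_simps mat_vector_mult)
qed

lemma cis_has_vector_derivative:
  "((\<lambda>t. cis (\<omega> * t)) has_vector_derivative \<i> * of_real \<omega> * cis (\<omega> * t)) (at t within S)"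
proof -
  have "((\<lambda>t. exp (\<i> * (of_real \<omega> * of_real t))) has_vector_derivative \<i> * of_real \<omega> * exp (\<i> * (of_real \<omega> * of_real t)))
      (at t within S)"
    by (rule has_vector_derivative_real_field) (auto intro!: derivative_eq_intros)
  then show ?thesis by (simp add: cis_conv_exp)
qed

lemma integrable_exp_decay:
  assumes "\<delta> > 0"
  shows "integrable lborel (\<lambda>t. indicator {0..} t * exp (- \<delta> * t :: real))"
proof -
  have "integrable lborel (\<lambda>t. indicator {0<..} t *\<^sub>R exp (- (t * \<delta>)))"
    using integrable_I0i_exp_mscale[OF assms] by (simp add: set_integrable_def)
  then have "integrable lborel (\<lambda>t. indicator {0<..} t * exp (- \<delta> * t))"
    by (simp add: mult.commute)
  moreover have "AE t in lborel. indicator {0<..} t * exp (- \<delta> * t) = indicator {0..} t * exp (- \<delta> * t)"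
    using AE_lborel_singleton[of 0] by eventually_elim (auto simp: indicator_def)
  ultimately show ?thesis by (subst (asm) integrable_cong_AE) auto
qed

lemma borel_measurable_matrix_vector_mult [measurable]:
  fixes f :: "'a \<Rightarrow> complex^'n^'m"
  assumes "f \<in> borel_measurable N" "g \<in> borel_measurable N"
  shows "(\<lambda>x. f x *v g x) \<in> borel_measurable N"
  by (rule borel_measurable_continuous_Pair[OF assms])
     (intro bounded_bilinear.continuous_on[OF bounded_bilinear_matrix_vector_mult] continuous_intros)

lemma borel_measurable_smult_vec [measurable]:
  fixes f :: "'a \<Rightarrow> complex" and g :: "'a \<Rightarrow> complex^'n"
  assumes "f \<in> borel_measurable N" "g \<in> borel_measurable N"
  shows "(\<lambda>x. f x *s g x) \<in> borel_measurable N"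
  by (rule borel_measurable_continuous_Pair[OF assms])
     (intro bounded_bilinear.continuous_on[OF bounded_bilinear_smult_vec] continuous_intros)

lemma borel_measurable_cdot [measurable]:
  fixes f :: "'a \<Rightarrow> complex^'n"
  assumes "f \<in> borel_measurable N" "g \<in> borel_measurable N"
  shows "(\<lambda>x. cdot (f x) (g x)) \<in> borel_measurable N"
  by (rule borel_measurable_continuous_Pair[OF assms])
     (intro bounded_bilinear.continuous_on[OF bounded_bilinear_cdot] continuous_intros)

lemma borel_measurable_cis [measurable]: "cis \<in> borel_measurable borel"
  by (intro borel_measurable_continuous_onI continuous_intros)

lemma borel_measurable_mexp [measurable]:
  fixes f :: "'a \<Rightarrow> complex^'n^'n"
  assumes [measurable]: "f \<in> borel_measurable N" "g \<in> borel_measurable N" "h \<in> borel_measurable N"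
  shows "(\<lambda>x. mexp (f x) (g x) (h x)) \<in> borel_measurable N"
proof -
  have [measurable]: "(\<lambda>x. ((*v) (f x) ^^ p) (h x)) \<in> borel_measurable N" for p
    by (induction p) simp_all
  show ?thesis unfolding mexp_def by measurable
qed

text \<open>Since b = (i\<omega> - M)z for the resolvent vector z, the integrand has the
  antiderivative -exp(-i\<omega>s) exp(sM) z, which equals -z at 0 and tends to 0 at infinity by the
  decay of the exponential.\<close>

lemma laplace_mexp:
  assumes M: "hurwitz M"
  shows "has_bochner_integral lborel
     (\<lambda>s. indicator {0..} s *\<^sub>R (cis (- (\<omega> * s)) *s mexp M s b)) (resolv M \<omega> b)"
proof -
  define z where "z = resolv M \<omega> b"
  have z: "(\<i> * of_real \<omega>) *s z - M *v z = b"
    unfolding z_def by (rule resolv_eq[OF M])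
  obtain C \<delta> where C: "C \<ge> 0" "\<delta> > 0"
    "\<And>t v. t \<ge> 0 \<Longrightarrow> norm (mexp M t v) \<le> C * exp (- \<delta> * t) * norm v"
    using hurwitz_uniform_decay[OF M] by blast
  define F where "F s = - (cis (- \<omega> * s) *s mexp M s z)" for s
  have F: "(F has_vector_derivative cis (- (\<omega> * s)) *s mexp M s b) (at s)" for s
  proof -
    note bounded_bilinear.has_vector_derivative[OF bounded_bilinear_smult_vec
        cis_has_vector_derivative[of "- \<omega>" s UNIV] mexp_has_vector_derivative[of M z s UNIV]]
    from has_vector_derivative_minus[OF this] show ?thesis
      by (simp add: F_def[abs_def] z[symmetric] mexp_linear_simps mexp_smult vector_ssub_ldistrib
          vector_smult_lneg mult_ac)
  qed
  have cont: "isCont (\<lambda>s. cis (- (\<omega> * s)) *s mexp M s b) s" for s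
    using continuous_on_eq_continuous_at[of UNIV "\<lambda>s. cis (- (\<omega> * s)) *s mexp M s b"]
    by (auto intro!: bounded_bilinear.continuous_on[OF bounded_bilinear_smult_vec] continuous_intros)
  have int: "integrable lborel (\<lambda>s. indicator {0..} s *\<^sub>R (cis (- (\<omega> * s)) *s mexp M s b))"
  proof (rule Bochner_Integration.integrable_bound)
    show "integrable lborel (\<lambda>s. (C * norm b) * (indicator {0..} s * exp (- \<delta> * s)))"
      by (intro integrable_mult_right integrable_exp_decay C)
    show "AE s in lborel. norm (indicator {0..} s *\<^sub>R (cis (- (\<omega> * s)) *s mexp M s b))
        \<le> norm ((C * norm b) * (indicator {0..} s * exp (- \<delta> * s)))"
    proof (rule AE_I2)
      fix s
      show "norm (indicator {0..} s *\<^sub>R (cis (- (\<omega> * s)) *s mexp M s b))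
        \<le> norm ((C * norm b) * (indicator {0..} s * exp (- \<delta> * s)))"
        using C(1) C(3)[of s b] by (auto simp: indicator_def norm_smult_vec abs_mult mult_ac)
    qed
  qed measurable
  have lim: "(F \<longlongrightarrow> 0) at_top"
  proof (rule Lim_null_comparison)
    show "\<forall>\<^sub>F s in at_top. norm (F s) \<le> C * exp (- \<delta> * s) * norm z"
      using eventually_ge_at_top[of 0]
      by eventually_elim (use C(3)[of _ z] in \<open>simp add: F_def norm_smult_vec\<close>)
    show "((\<lambda>s. C * exp (- \<delta> * s) * norm z) \<longlongrightarrow> 0) at_top"
      using C(2) by real_asymp
  qed
  have cF: "continuous_on UNIV F"
    by (rule continuous_at_imp_continuous_on) (use has_vector_derivative_continuous[OF F] in blast)
  have int0: "set_integrable lborel {0<..} (\<lambda>s. cis (- (\<omega> * s)) *s mexp M s b)"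
    by (rule set_integrable_subset[of lborel "{0..}"]) (use int in \<open>auto simp: set_integrable_def\<close>)
  have "(LBINT s=ereal 0..\<infinity>. cis (- (\<omega> * s)) *s mexp M s b) = 0 - F 0"
  proof (rule interval_integral_FTC_integrable)
    show "set_integrable lborel (einterval (ereal 0) \<infinity>) (\<lambda>s. cis (- (\<omega> * s)) *s mexp M s b)"
      using int0 by (simp add: einterval_def greaterThan_def)
    have "(F \<longlongrightarrow> F 0) (at_right 0)"
      using cF by (simp add: continuous_on_eq_continuous_at isCont_def filterlim_at_split)
    then show "((F \<circ> real_of_ereal) \<longlongrightarrow> F 0) (at_right (ereal 0))"
      by (simp add: ereal_tendsto_simps)
    show "((F \<circ> real_of_ereal) \<longlongrightarrow> 0) (at_left \<infinity>)"
      using lim by (simp add: ereal_tendsto_simps)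
  qed (use F cont in auto)
  also have "0 - F 0 = z" by (simp add: F_def)
  also have "(LBINT s=ereal 0..\<infinity>. cis (- (\<omega> * s)) *s mexp M s b)
      = (LBINT s:{0<..}. cis (- (\<omega> * s)) *s mexp M s b)"
    by (simp add: interval_lebesgue_integral_def einterval_def greaterThan_def)
  also have "\<dots> = (LINT s|lborel. indicator {0..} s *\<^sub>R (cis (- (\<omega> * s)) *s mexp M s b))"
    unfolding set_lebesgue_integral_def
  proof (rule integral_cong_AE)
    show "AE s in lborel. indicator {0<..} s *\<^sub>R (cis (- (\<omega> * s)) *s mexp M s b)
       = indicator {0..} s *\<^sub>R (cis (- (\<omega> * s)) *s mexp M s b)"
      using AE_lborel_singleton[of 0] by eventually_elim (auto simp: indicator_def)
  qed measurable
  finally show ?thesis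
    using int by (simp add: has_bochner_integral_iff z_def)
qed

text \<open>The bound must not depend on \<omega>; the Laplace integral provides this because the
  oscillating factor has modulus one. Continuity of the resolvent and its vanishing at infinity both
  rest on this uniformity.\<close>

lemma resolv_bounded:
  assumes M: "hurwitz M"
  obtains K where "\<And>\<omega> b. norm (resolv M \<omega> b) \<le> K * norm b"
proof -
  obtain C \<delta> where C: "C \<ge> 0" "\<delta> > 0"
    "\<And>t v. t \<ge> 0 \<Longrightarrow> norm (mexp M t v) \<le> C * exp (- \<delta> * t) * norm v"
    using hurwitz_uniform_decay[OF M] by blast
  define I where "I = (LINT s|lborel. indicator {0..} s * exp (- \<delta> * s))"
  have "norm (resolv M \<omega> b) \<le> (C * I) * norm b" for \<omega> b
  proof -
    have "norm (resolv M \<omega> b) \<le> (LINT s|lborel. norm (indicator {0..} s *\<^sub>R (cis (- (\<omega> * s)) *s mexp M s b)))"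
      by (subst has_bochner_integral_integral_eq[OF laplace_mexp[OF M], symmetric])
         (rule integral_norm_bound)
    also have "\<dots> \<le> (LINT s|lborel. (C * norm b) * (indicator {0..} s * exp (- \<delta> * s)))"
    proof (rule integral_mono)
      show "integrable lborel (\<lambda>s. norm (indicator {0..} s *\<^sub>R (cis (- (\<omega> * s)) *s mexp M s b)))"
        by (rule integrable_norm)
           (use laplace_mexp[OF M, of \<omega> b] in \<open>simp only: has_bochner_integral_iff\<close>)
      show "integrable lborel (\<lambda>s. (C * norm b) * (indicator {0..} s * exp (- \<delta> * s)))"
        by (intro integrable_mult_right integrable_exp_decay C)
      show "norm (indicator {0..} s *\<^sub>R (cis (- (\<omega> * s)) *s mexp M s b))
        \<le> (C * norm b) * (indicator {0..} s * exp (- \<delta> * s))" for s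
        using C(3)[of s b] by (auto simp: indicator_def norm_smult_vec mult_ac)
    qed
    finally show ?thesis by (simp add: I_def mult_ac)
  qed
  then show ?thesis using that by blast
qed

text \<open>Resolvent identity: the difference between \<omega> and \<omega>0 is the resolvent at
  \<omega> applied to a fixed vector scaled by \<omega>0 - \<omega>, and the resolvent norms are
  uniformly bounded.\<close>

lemma resolv_continuous:
  assumes M: "hurwitz M"
  shows "continuous_on UNIV (\<lambda>\<omega>. resolv M \<omega> b)"
proof -
  obtain K where K: "\<And>\<omega> b. norm (resolv M \<omega> b) \<le> K * norm b"
    using resolv_bounded[OF M] by blast
  have diff: "resolv M \<omega> b - resolv M \<omega>0 b = resolv M \<omega> ((\<i> * of_real (\<omega>0 - \<omega>)) *s resolv M \<omega>0 b)" for \<omega> \<omega>0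
  proof -
    let ?z = "resolv M \<omega>0 b"
    have "b = (\<i> * of_real \<omega>) *s ?z - M *v ?z + (\<i> * of_real (\<omega>0 - \<omega>)) *s ?z"
      using resolv_eq[OF M, of \<omega>0 b]
      by (simp add: vec_eq_iff algebra_simps)
    then have "resolv M \<omega> b = resolv M \<omega> ((\<i> * of_real \<omega>) *s ?z - M *v ?z) + resolv M \<omega> ((\<i> * of_real (\<omega>0 - \<omega>)) *s ?z)"
      by (metis resolv_def bounded_bilinear.add_right[OF bounded_bilinear_matrix_vector_mult])
    \<comment> \<open>Both sides solve the same equation for i\<omega> - M; a nonzero difference
      would be an eigenvector for i\<omega>.\<close>
    moreover have "resolv M \<omega> ((\<i> * of_real \<omega>) *s ?z - M *v ?z) = ?z"
    proof -
      define y where "y = resolv M \<omega> ((\<i> * of_real \<omega>) *s ?z - M *v ?z) - ?z"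
      have "M *v y = (\<i> * of_real \<omega>) *s y"
        using resolv_eq[OF M, of \<omega> "(\<i> * of_real \<omega>) *s ?z - M *v ?z"]
        by (simp add: y_def mv_simps vector_ssub_ldistrib) (simp add: algebra_simps)
      then have "y = 0"
        using hurwitz_not_eigenvalue[OF M] unfolding eigenvalue_def by blast
      then show ?thesis by (simp add: y_def)
    qed
    ultimately show ?thesis by simp
  qed
  have "((\<lambda>\<omega>. resolv M \<omega> b) \<longlongrightarrow> resolv M \<omega>0 b) (at \<omega>0)" for \<omega>0
  proof (rule LIM_zero_cancel, rule Lim_null_comparison)
    show "\<forall>\<^sub>F \<omega> in at \<omega>0. norm (resolv M \<omega> b - resolv M \<omega>0 b) \<le> K * (\<bar>\<omega>0 - \<omega>\<bar> * norm (resolv M \<omega>0 b))"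
      unfolding diff by (intro always_eventually allI order_trans[OF K])
        (simp add: norm_smult_vec norm_mult flip: of_real_diff)
    show "((\<lambda>\<omega>. K * (\<bar>\<omega>0 - \<omega>\<bar> * norm (resolv M \<omega>0 b))) \<longlongrightarrow> 0) (at \<omega>0)"
      by (auto intro!: tendsto_eq_intros)
  qed
  then show ?thesis by (simp add: continuous_on_def)
qed

text \<open>The resolvent equation reads i\<omega>z = b + Mz, whose right-hand side is bounded in
  \<omega>; dividing by \<omega> gives the decay. A sequence of frequencies suffices for the
  limiting inequality in \<open>feedthrough_nonneg\<close>.\<close>

lemma resolv_tendsto_0:
  assumes M: "hurwitz M"
  shows "(\<lambda>n. resolv M (real n) b) \<longlonglongrightarrow> 0"
proof -
  obtain K where K: "\<And>\<omega> b. norm (resolv M \<omega> b) \<le> K * norm b"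
    using resolv_bounded[OF M] by blast
  show ?thesis
  proof (rule Lim_null_comparison)
    show "\<forall>\<^sub>F n in sequentially. norm (resolv M (real n) b) \<le> (norm b + norm M * (K * norm b)) / real n"
      using eventually_gt_at_top[of 0]
    proof eventually_elim
      case (elim n)
      let ?z = "resolv M (real n) b"
      have "(\<i> * of_real (real n)) *s ?z = b + M *v ?z"
        using resolv_eq[OF M, of "real n" b] by (simp add: algebra_simps)
      then have "norm ((\<i> * of_real (real n)) *s ?z) \<le> norm b + norm (M *v ?z)"
        by (metis norm_triangle_ineq)
      also have "\<dots> \<le> norm b + norm M * (K * norm b)"
        using norm_matrix_vector_mult_le[of M ?z] mult_left_mono[OF K[of "real n" b], of "norm M"] by simp
      finally show ?case using elim by (simp add: norm_smult_vec norm_mult field_simps)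
    qed
    show "(\<lambda>n. (norm b + norm M * (K * norm b)) / real n) \<longlonglongrightarrow> 0" by real_asymp
  qed
qed

section \<open>Zero-state response of a finite-dimensional system\<close>

definition resp :: "complex^'n^'n \<Rightarrow> complex^'m^'n \<Rightarrow> (real \<Rightarrow> complex^'m) \<Rightarrow> real \<Rightarrow> complex^'n" where
  "resp A B v t = (LINT \<tau>:{0..t}|lborel. mexp A (t - \<tau>) (B *v v \<tau>))"

text \<open>Measurability is stated jointly in the time, the system matrices and the input. At
  frequency \<sigma> the matrices are symbols and the input is a spatial Fourier sum, so this makes
  the response measurable in \<sigma>.\<close>

lemma borel_measurable_resp:
  fixes a :: "'x \<Rightarrow> complex^'n^'n" and b :: "'x \<Rightarrow> complex^'m^'n"
  assumes [measurable]: "a \<in> borel_measurable N" "b \<in> borel_measurable N" "t \<in> borel_measurable N"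
    and u: "(\<lambda>p. u (fst p) (snd p)) \<in> borel_measurable (N \<Otimes>\<^sub>M borel)"
  shows "(\<lambda>x. resp (a x) (b x) (u x) (t x)) \<in> borel_measurable N"
proof -
  have [measurable]: "(\<lambda>p. u (fst p) (snd p)) \<in> borel_measurable (N \<Otimes>\<^sub>M lborel)"
    using u by (simp cong: measurable_cong_sets)
  have "(\<lambda>p. indicator {0..t (fst p)} (snd p) *\<^sub>R
      mexp (a (fst p)) (t (fst p) - snd p) (b (fst p) *v u (fst p) (snd p))) \<in> borel_measurable (N \<Otimes>\<^sub>M lborel)"
    unfolding indicator_def atLeastAtMost_iff by measurable
  then show ?thesis
    unfolding resp_def set_lebesgue_integral_def
    by (intro lborel.borel_measurable_lebesgue_integral) (simp add: split_beta')
qed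

lemma resp_integrable:
  fixes v :: "real \<Rightarrow> complex^'m"
  assumes [measurable]: "v \<in> borel_measurable borel" and v: "\<And>t. norm (v t) \<le> c"
  shows "set_integrable lborel {0..t} (\<lambda>\<tau>. mexp A (t - \<tau>) (B *v v \<tau>))"
  unfolding set_integrable_def
proof (rule integrableI_bounded_set_indicator)
  have c: "c \<ge> 0" using v[of 0] norm_ge_zero order_trans by blast
  show "AE \<tau> in lborel. \<tau> \<in> {0..t} \<longrightarrow> norm (mexp A (t - \<tau>) (B *v v \<tau>)) \<le> exp (t * norm A) * (norm B * c)"
  proof (intro AE_I2 impI)
    fix \<tau> assume \<tau>: "\<tau> \<in> {0..t}"
    have "norm (mexp A (t - \<tau>) (B *v v \<tau>)) \<le> exp (\<bar>t - \<tau>\<bar> * norm A) * norm (B *v v \<tau>)"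
      by (rule norm_mexp_le)
    also have "\<dots> \<le> exp (t * norm A) * (norm B * c)"
      using \<tau> c v[of \<tau>] norm_matrix_vector_mult_le[of B "v \<tau>"] mult_left_mono[OF v[of \<tau>], of "norm B"]
      by (intro mult_mono) (auto intro!: mult_right_mono)
    finally show "norm (mexp A (t - \<tau>) (B *v v \<tau>)) \<le> exp (t * norm A) * (norm B * c)" .
  qed
qed (simp_all add: emeasure_lborel_Icc_eq)

lemma mexp_rev_has_vector_derivative:
  "((\<lambda>\<tau>. mexp M (t - \<tau>) v) has_vector_derivative - mexp M (t - \<tau>) (M *v v)) (at \<tau> within S)"
proof -
  have 1: "((\<lambda>\<tau>. t - \<tau>) has_vector_derivative - 1) (at \<tau> within S)"
    by (auto intro!: derivative_eq_intros)
  show ?thesis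
    using vector_diff_chain_within[OF 1 mexp_has_vector_derivative[of M v "t - \<tau>"]] by (simp add: o_def)
qed

text \<open>The response to a pure oscillation is a steady oscillation minus a transient: by the
  equation for z, the integrand is the \<tau>-derivative of
  \<open>cis (\<omega> * \<tau>) *s mexp A (t - \<tau>) z\<close>.\<close>

lemma resp_exponential:
  assumes z: "(\<i> * of_real \<omega>) *s z - A *v z = B *v \<eta>" and t: "t \<ge> 0"
  shows "resp A B (\<lambda>\<tau>. cis (\<omega> * \<tau>) *s \<eta>) t = cis (\<omega> * t) *s z - mexp A t z"
proof -
  have "resp A B (\<lambda>\<tau>. cis (\<omega> * \<tau>) *s \<eta>) t
     = (LINT \<tau>|lborel. indicator {0..t} \<tau> *\<^sub>R (cis (\<omega> * \<tau>) *s mexp A (t - \<tau>) (B *v \<eta>)))"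
    by (simp add: resp_def set_lebesgue_integral_def matrix_vector_mult_smult mexp_smult)
  also have "\<dots> = cis (\<omega> * t) *s mexp A (t - t) z - cis (\<omega> * 0) *s mexp A (t - 0) z"
  proof (rule integral_FTC_Icc[OF t])
    fix \<tau>
    from bounded_bilinear.has_vector_derivative[OF bounded_bilinear_smult_vec
        cis_has_vector_derivative[of \<omega> \<tau> "{0..t}"] mexp_rev_has_vector_derivative[of A t z \<tau> "{0..t}"]]
    show "((\<lambda>\<tau>. cis (\<omega> * \<tau>) *s mexp A (t - \<tau>) z) has_vector_derivative
        cis (\<omega> * \<tau>) *s mexp A (t - \<tau>) (B *v \<eta>)) (at \<tau> within {0..t})"
      by (simp add: z[symmetric] mexp_linear_simps mexp_smult vector_ssub_ldistrib
          vector_smult_rneg mult_ac)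
  qed (intro bounded_bilinear.continuous_on[OF bounded_bilinear_smult_vec] continuous_intros)
  finally show ?thesis by simp
qed

lemma nonneg_if_linear_lower_bound:
  fixes a K :: real
  assumes "\<And>n::nat. n > 0 \<Longrightarrow> 0 \<le> real n * a + K"
  shows "0 \<le> a"
proof (rule LIMSEQ_le_const)
  show "(\<lambda>n. a + K / real (Suc n)) \<longlonglongrightarrow> a" by real_asymp
  show "\<exists>N. \<forall>n\<ge>N. 0 \<le> a + K / real (Suc n)"
    using assms by (intro exI[of _ 0] allI impI) (simp add: field_simps del: of_nat_Suc)
qed

text \<open>On [0, n] the work of the oscillation is n times the form \<open>\<Lambda>\<close> minus
  the contribution of the transient. The latter stays bounded in n because the transient is
  integrable on the half line, so dividing by n leaves the real part of
  \<open>\<Lambda>\<close>.\<close>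

lemma passive_imp_transfer_nonneg:
  fixes A :: "complex^'n^'n" and B :: "complex^'m^'n"
  defines "e \<equiv> \<lambda>\<omega> \<eta> t. cis (\<omega> * t) *s \<eta>"
  assumes A: "hurwitz A"
    and pas: "\<And>n::nat. n > 0 \<Longrightarrow>
       0 \<le> Re (LINT t:{0..real n}|lborel. cdot (e \<omega> \<eta> t) (G *v (C *v resp A B (e \<omega> \<eta>) t + D *v e \<omega> \<eta> t)))"
  shows "0 \<le> Re (cdot \<eta> (G *v (C *v resolv A \<omega> (B *v \<eta>) + D *v \<eta>)))"
proof -
  define z where "z = resolv A \<omega> (B *v \<eta>)"
  have z: "(\<i> * of_real \<omega>) *s z - A *v z = B *v \<eta>"
    unfolding z_def by (rule resolv_eq[OF A])
  define \<Lambda> where "\<Lambda> = cdot \<eta> (G *v (C *v z + D *v \<eta>))"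
  define \<epsilon> where "\<epsilon> t = cdot (e \<omega> \<eta> t) (G *v (C *v mexp A t z))" for t
  obtain K \<delta> where K: "K \<ge> 0" "\<delta> > 0"
    "\<And>t v. t \<ge> 0 \<Longrightarrow> norm (mexp A t v) \<le> K * exp (- \<delta> * t) * norm v"
    using hurwitz_uniform_decay[OF A] by blast
  define L where "L = norm \<eta> * (norm G * (norm C * (K * norm z)))"
  have "L \<ge> 0" using K(1) by (simp add: L_def)
  have \<epsilon>: "norm (\<epsilon> t) \<le> L * exp (- \<delta> * t)" if "t \<ge> 0" for t
  proof -
    have "norm (G *v (C *v mexp A t z)) \<le> norm G * (norm C * (K * exp (- \<delta> * t) * norm z))"
      using K(3)[OF that, of z]
      by (intro order_trans[OF norm_matrix_vector_mult_le] mult_left_mono) auto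
    then have "norm (\<epsilon> t) \<le> norm \<eta> * (norm G * (norm C * (K * exp (- \<delta> * t) * norm z)))"
      unfolding \<epsilon>_def
      by (intro order_trans[OF norm_cdot_le]) (simp add: e_def norm_smult_vec mult_left_mono)
    then show ?thesis by (simp add: L_def mult_ac)
  qed
  have cont: "continuous_on S \<epsilon>" for S
    unfolding \<epsilon>_def e_def
    by (intro bounded_bilinear.continuous_on[OF bounded_bilinear_smult_vec]
        bounded_bilinear.continuous_on[OF bounded_bilinear_cdot]
        bounded_bilinear.continuous_on[OF bounded_bilinear_matrix_vector_mult] continuous_intros)
  define I where "I = (LINT t|lborel. indicator {0..} t * exp (- \<delta> * t))"
  have "0 \<le> real n * Re \<Lambda> + L * I" if n: "n > 0" for n :: nat
  proof -
    have eq: "cdot (e \<omega> \<eta> t) (G *v (C *v resp A B (e \<omega> \<eta>) t + D *v e \<omega> \<eta> t)) = \<Lambda> - \<epsilon> t" if "t \<ge> 0" for t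
    proof -
      have "resp A B (e \<omega> \<eta>) t = cis (\<omega> * t) *s z - mexp A t z"
        unfolding e_def by (rule resp_exponential[OF z that])
      then have "cdot (e \<omega> \<eta> t) (G *v (C *v resp A B (e \<omega> \<eta>) t + D *v e \<omega> \<eta> t))
         = cdot (e \<omega> \<eta> t) (cis (\<omega> * t) *s (G *v (C *v z + D *v \<eta>))) - \<epsilon> t"
        unfolding \<epsilon>_def bounded_bilinear.diff_right[OF bounded_bilinear_cdot, symmetric]
        by (simp add: e_def mv_simps matrix_vector_mult_smult vector_add_ldistrib diff_add_eq)
      also have "cdot (e \<omega> \<eta> t) (cis (\<omega> * t) *s (G *v (C *v z + D *v \<eta>))) = \<Lambda>"
        by (simp add: e_def cdot_smult \<Lambda>_def cis_cnj cis_mult mult.assoc[symmetric])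
      finally show ?thesis .
    qed
    have int: "set_integrable lborel {0..real n} \<epsilon>"
      by (intro borel_integrable_atLeastAtMost' cont)
    have "(LINT t:{0..real n}|lborel. cdot (e \<omega> \<eta> t) (G *v (C *v resp A B (e \<omega> \<eta>) t + D *v e \<omega> \<eta> t)))
        = (LINT t:{0..real n}|lborel. \<Lambda> - \<epsilon> t)"
      by (rule set_lebesgue_integral_cong) (auto simp: eq)
    also have "\<dots> = real n *\<^sub>R \<Lambda> - (LINT t:{0..real n}|lborel. \<epsilon> t)"
      by (subst set_integral_diff[OF _ int]) (auto simp: set_integral_const borel_integrable_atLeastAtMost')
    finally have "0 \<le> real n * Re \<Lambda> - Re (LINT t:{0..real n}|lborel. \<epsilon> t)"
      using pas[OF n] by simp
    moreover have "norm (LINT t:{0..real n}|lborel. \<epsilon> t) \<le> L * I"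
    proof -
      have "norm (LINT t:{0..real n}|lborel. \<epsilon> t) \<le> (LINT t|lborel. norm (indicator {0..real n} t *\<^sub>R \<epsilon> t))"
        unfolding set_lebesgue_integral_def by (rule integral_norm_bound)
      also have "\<dots> \<le> (LINT t|lborel. L * (indicator {0..} t * exp (- \<delta> * t)))"
      proof (rule integral_mono)
        show "integrable lborel (\<lambda>t. norm (indicator {0..real n} t *\<^sub>R \<epsilon> t))"
          using int unfolding set_integrable_def by (rule integrable_norm)
        show "integrable lborel (\<lambda>t. L * (indicator {0..} t * exp (- \<delta> * t)))"
          by (intro integrable_mult_right integrable_exp_decay K)
        show "norm (indicator {0..real n} t *\<^sub>R \<epsilon> t) \<le> L * (indicator {0..} t * exp (- \<delta> * t))" for t
          using \<epsilon>[of t] \<open>L \<ge> 0\<close> by (auto simp: indicator_def)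
      qed
      finally show ?thesis by (simp add: I_def)
    qed
    ultimately show ?thesis using abs_Re_le_cmod[of "LINT t:{0..real n}|lborel. \<epsilon> t"] by linarith
  qed
  from nonneg_if_linear_lower_bound[OF this] show ?thesis by (simp add: \<Lambda>_def z_def)
qed

section \<open>The Fourier transform in time of integrable functions\<close>

definition fourier_vec :: "(real \<Rightarrow> complex^'m) \<Rightarrow> real \<Rightarrow> complex^'m" where
  "fourier_vec f \<omega> = (LINT t|lborel. cis (- (\<omega> * t)) *s f t)"

lemma integrable_fourier_vec:
  assumes "integrable lborel f"
  shows "integrable lborel (\<lambda>t. cis (- (\<omega> * t)) *s f t)"
proof (rule Bochner_Integration.integrable_bound[OF assms])
  have [measurable]: "f \<in> borel_measurable borel" using assms by simp
  show "(\<lambda>t. cis (- (\<omega> * t)) *s f t) \<in> borel_measurable lborel" by simp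
qed (simp add: norm_smult_vec)

lemma fourier_vec_mult:
  assumes "integrable lborel f"
  shows "fourier_vec (\<lambda>t. M *v f t) \<omega> = M *v fourier_vec f \<omega>"
  unfolding fourier_vec_def matrix_vector_mult_smult[symmetric]
  by (rule integral_bounded_linear[OF bounded_bilinear.bounded_linear_right[OF bounded_bilinear_matrix_vector_mult]
        integrable_fourier_vec[OF assms]])

lemma fourier_vec_add:
  assumes "integrable lborel f" "integrable lborel g"
  shows "fourier_vec (\<lambda>t. f t + g t) \<omega> = fourier_vec f \<omega> + fourier_vec g \<omega>"
  unfolding fourier_vec_def vector_add_ldistrib
  by (rule Bochner_Integration.integral_add[OF assms[THEN integrable_fourier_vec]])

lemma integrable_pair_mult:
  fixes f g :: "real \<Rightarrow> real"
  assumes f: "integrable lborel f" and g: "integrable lborel g"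
  shows "integrable (lborel \<Otimes>\<^sub>M lborel) (\<lambda>p. f (fst p) * g (snd p))"
proof (rule lborel_pair.Fubini_integrable)
  have [measurable]: "f \<in> borel_measurable borel" "g \<in> borel_measurable borel" using f g by simp_all
  show "(\<lambda>p. f (fst p) * g (snd p)) \<in> borel_measurable (lborel \<Otimes>\<^sub>M lborel)" by measurable
  show "integrable lborel (\<lambda>x. LINT y|lborel. norm (f (fst (x, y)) * g (snd (x, y))))"
    using f by (simp add: abs_mult)
qed (use g in simp)

lemma integrable_pair_cdot:
  fixes f g :: "real \<Rightarrow> complex^'m"
  assumes f: "integrable lborel f" and g: "integrable lborel g"
  shows "integrable (lborel \<Otimes>\<^sub>M lborel) (\<lambda>p. cdot (f (fst p)) (g (snd p)))"
proof (rule Bochner_Integration.integrable_bound)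
  have [measurable]: "f \<in> borel_measurable borel" "g \<in> borel_measurable borel" using f g by simp_all
  show "integrable (lborel \<Otimes>\<^sub>M lborel) (\<lambda>p. norm (f (fst p)) * norm (g (snd p)))"
    using f g by (intro integrable_pair_mult) auto
  show "(\<lambda>p. cdot (f (fst p)) (g (snd p))) \<in> borel_measurable (lborel \<Otimes>\<^sub>M lborel)" by measurable
qed (auto intro: order_trans[OF norm_cdot_le])

text \<open>The frequency is R times a standard normal variable. Averaging over a probability
  measure makes Fubini applicable to functions that are merely integrable, and the inner integral is
  the characteristic function of the normal law. Multiplied by R / sqrt(2 pi), the kernel on the
  time side becomes an approximate identity as R grows.\<close>

lemma gaussian_parseval:
  fixes f g :: "real \<Rightarrow> complex^'m"
  assumes f: "integrable lborel f" and g: "integrable lborel g"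
  shows "(LINT \<xi>|std_normal_distribution. cdot (fourier_vec f (R * \<xi>)) (fourier_vec g (R * \<xi>)))
    = (LINT p|(lborel \<Otimes>\<^sub>M lborel). exp (- (R * (fst p - snd p))\<^sup>2 / 2) *\<^sub>R cdot (f (fst p)) (g (snd p)))" (is "?L = ?R")
    and "integrable std_normal_distribution (\<lambda>\<xi>. cdot (fourier_vec f (R * \<xi>)) (fourier_vec g (R * \<xi>)))"
proof -
  have [measurable]: "f \<in> borel_measurable borel" "g \<in> borel_measurable borel" using f g by simp_all
  let ?P = "lborel \<Otimes>\<^sub>M lborel :: (real \<times> real) measure"
  let ?N = "std_normal_distribution"
  define h where "h p = cdot (f (fst p)) (g (snd p))" for p
  have h: "integrable ?P h" unfolding h_def[abs_def] by (rule integrable_pair_cdot[OF f g])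
  have [measurable]: "h \<in> borel_measurable ?P" using h by simp
  interpret N: prob_space ?N by (rule prob_space_normal_density) simp
  interpret P: sigma_finite_measure ?P by (rule lborel_pair.sigma_finite_measure_axioms) 
  interpret NP: pair_sigma_finite ?N ?P ..
  have prod: "cdot (fourier_vec f \<omega>) (fourier_vec g \<omega>) = (LINT p|?P. cis (\<omega> * (fst p - snd p)) * h p)" for \<omega>
  proof -
    have int: "integrable ?P (\<lambda>p. cis (\<omega> * (fst p - snd p)) * h p)"
      by (rule Bochner_Integration.integrable_bound[OF h]) (auto simp: norm_mult)
    have 1: "cdot (fourier_vec f \<omega>) w = (LINT t|lborel. cdot (cis (- (\<omega> * t)) *s f t) w)" for w
      unfolding fourier_vec_def
      by (rule integral_bounded_linear[OF bounded_bilinear.bounded_linear_left[OF bounded_bilinear_cdot]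
            integrable_fourier_vec[OF f], symmetric])
    have 2: "cdot a (fourier_vec g \<omega>) = (LINT s|lborel. cdot a (cis (- (\<omega> * s)) *s g s))" for a
      unfolding fourier_vec_def
      by (rule integral_bounded_linear[OF bounded_bilinear.bounded_linear_right[OF bounded_bilinear_cdot]
            integrable_fourier_vec[OF g], symmetric])
    have "cdot (fourier_vec f \<omega>) (fourier_vec g \<omega>)
      = (LINT t|lborel. LINT s|lborel. cdot (cis (- (\<omega> * t)) *s f t) (cis (- (\<omega> * s)) *s g s))"
      unfolding 1 by (simp only: 2)
    also have "\<dots> = (LINT t|lborel. LINT s|lborel. cis (\<omega> * (t - s)) * h (t, s))"
      by (simp add: cdot_smult h_def cis_cnj cis_mult mult.assoc[symmetric] algebra_simps)
    also have "\<dots> = (LINT p|?P. cis (\<omega> * (fst p - snd p)) * h p)"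
      using lborel_pair.integral_fst'[OF int] by simp
    finally show ?thesis .
  qed
  have intNP: "integrable (?N \<Otimes>\<^sub>M ?P) (\<lambda>q. cis (R * fst q * (fst (snd q) - snd (snd q))) * h (snd q))"
  proof (rule NP.Fubini_integrable)
    show "(\<lambda>q. cis (R * fst q * (fst (snd q) - snd (snd q))) * h (snd q)) \<in> borel_measurable (?N \<Otimes>\<^sub>M ?P)"
      by measurable
    show "integrable ?N (\<lambda>x. LINT y|?P. norm (cis (R * fst (x, y) * (fst (snd (x, y)) - snd (snd (x, y)))) * h (snd (x, y))))"
      by (simp add: norm_mult)
    show "AE x in ?N. integrable ?P (\<lambda>y. cis (R * fst (x, y) * (fst (snd (x, y)) - snd (snd (x, y)))) * h (snd (x, y)))"
      by (intro AE_I2 Bochner_Integration.integrable_bound[OF h]) (auto simp: norm_mult)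
  qed
  have char: "(LINT \<xi>|?N. cis (R * \<xi> * u)) = exp (- (R * u)\<^sup>2 / 2)" for u
  proof -
    have "(LINT \<xi>|?N. cis (R * \<xi> * u)) = char ?N (R * u)"
      by (simp add: char_def cis_conv_exp mult_ac)
    then show ?thesis by (simp add: char_std_normal_distribution)
  qed
  have "?L = (LINT \<xi>|?N. LINT p|?P. cis (R * \<xi> * (fst p - snd p)) * h p)"
    by (simp add: prod)
  also have "\<dots> = (LINT p|?P. LINT \<xi>|?N. cis (R * \<xi> * (fst p - snd p)) * h p)"
    by (rule NP.Fubini_integral[symmetric]) (use intNP in \<open>simp add: split_beta'\<close>)
  also have "\<dots> = ?R"
    by (rule Bochner_Integration.integral_cong) (simp_all add: char h_def scaleR_conv_of_real)
  finally show "?L = ?R" .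
  show "integrable ?N (\<lambda>\<xi>. cdot (fourier_vec f (R * \<xi>)) (fourier_vec g (R * \<xi>)))"
    unfolding prod using NP.integrable_fst'[OF intNP] by simp
qed

lemma integrable_indicator_Icc: "integrable lborel (\<lambda>\<tau>. K * indicator {a..b::real} \<tau> :: real)"
  by (intro integrable_mult_right integrable_real_indicator) (auto simp: emeasure_lborel_Icc_eq)

section \<open>Response to a bounded input supported in a finite time interval\<close>

context
  fixes A :: "complex^'n^'n" and B :: "complex^'m^'n" and v :: "real \<Rightarrow> complex^'m" and c T :: real
  assumes A: "hurwitz A"
    and v_meas [measurable]: "v \<in> borel_measurable borel"
    and v_bound: "\<And>t. norm (v t) \<le> c"
    and v_supp: "\<And>t. t \<notin> {0..T} \<Longrightarrow> v t = 0"
begin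

text \<open>The majorant does not involve t, so it dominates the response integrals for all times at
  once.\<close>

lemma resp_integrand_bound:
  obtains K where "K \<ge> 0"
    "\<And>t \<tau>. \<tau> \<le> t \<Longrightarrow> norm (mexp A (t - \<tau>) (B *v v \<tau>)) \<le> K * indicator {0..T} \<tau>"
    "\<And>t \<tau>. norm (indicator {0..t} \<tau> *\<^sub>R mexp A (t - \<tau>) (B *v v \<tau>)) \<le> K * indicator {0..T} \<tau>"
proof -
  obtain C \<delta> where C: "C \<ge> 0" "\<delta> > 0"
    "\<And>t v. t \<ge> 0 \<Longrightarrow> norm (mexp A t v) \<le> C * exp (- \<delta> * t) * norm v"
    using hurwitz_uniform_decay[OF A] by blast
  have c: "c \<ge> 0" using v_bound[of 0] norm_ge_zero order_trans by blast
  have *: "norm (mexp A (t - \<tau>) (B *v v \<tau>)) \<le> C * (norm B * c) * indicator {0..T} \<tau>" if "\<tau> \<le> t" for t \<tau>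
  proof (cases "\<tau> \<in> {0..T}")
    case True
    have "norm (mexp A (t - \<tau>) (B *v v \<tau>)) \<le> C * exp (- \<delta> * (t - \<tau>)) * norm (B *v v \<tau>)"
      using that by (intro C) auto
    also have "\<dots> \<le> C * 1 * (norm B * c)"
      using that C(1,2) c norm_matrix_vector_mult_le[of B "v \<tau>"] mult_left_mono[OF v_bound[of \<tau>], of "norm B"]
      by (intro mult_mono) auto
    finally show ?thesis using True by simp
  qed (simp add: v_supp mexp_linear_simps)
  show ?thesis
  proof (rule that[OF _ *])
    show "0 \<le> C * (norm B * c)" using C c by simp
    then show "norm (indicator {0..t} \<tau> *\<^sub>R mexp A (t - \<tau>) (B *v v \<tau>))
        \<le> C * (norm B * c) * indicator {0..T} \<tau>" for t \<tau>
      using *[of \<tau> t] by (auto simp: indicator_def)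
  qed
qed

lemma resp_bounded: obtains K where "\<And>t. norm (resp A B v t) \<le> K"
proof -
  obtain K where K: "K \<ge> 0"
    "\<And>t \<tau>. \<tau> \<le> t \<Longrightarrow> norm (mexp A (t - \<tau>) (B *v v \<tau>)) \<le> K * indicator {0..T} \<tau>"
    "\<And>t \<tau>. norm (indicator {0..t} \<tau> *\<^sub>R mexp A (t - \<tau>) (B *v v \<tau>)) \<le> K * indicator {0..T} \<tau>"
    by (rule resp_integrand_bound) blast
  have "norm (resp A B v t) \<le> (LINT \<tau>|lborel. K * indicator {0..T} \<tau>)" for t
  proof -
    have "norm (resp A B v t) \<le> (LINT \<tau>|lborel. norm (indicator {0..t} \<tau> *\<^sub>R mexp A (t - \<tau>) (B *v v \<tau>)))"
      unfolding resp_def set_lebesgue_integral_def by (rule integral_norm_bound)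
    also have "\<dots> \<le> (LINT \<tau>|lborel. K * indicator {0..T} \<tau>)"
      using resp_integrable[OF v_meas v_bound, of t A B] unfolding set_integrable_def
      by (intro integral_mono integrable_norm integrable_indicator_Icc K(3))
    finally show ?thesis .
  qed
  then show ?thesis using that by blast
qed

text \<open>The input is only measurable; integration supplies the continuity. In the dominated
  convergence the moving endpoint spoils pointwise convergence at most at \<tau> = t, which is a
  null set.\<close>

lemma continuous_on_resp: "continuous_on UNIV (resp A B v)"
proof (rule continuous_at_imp_continuous_on, rule ballI, rule continuous_at_sequentiallyI)
  fix t and s :: "nat \<Rightarrow> real" assume s: "s \<longlonglongrightarrow> t"
  obtain K where K: "K \<ge> 0"
    "\<And>t \<tau>. \<tau> \<le> t \<Longrightarrow> norm (mexp A (t - \<tau>) (B *v v \<tau>)) \<le> K * indicator {0..T} \<tau>"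
    "\<And>t \<tau>. norm (indicator {0..t} \<tau> *\<^sub>R mexp A (t - \<tau>) (B *v v \<tau>)) \<le> K * indicator {0..T} \<tau>"
    by (rule resp_integrand_bound) blast
  show "(\<lambda>n. resp A B v (s n)) \<longlonglongrightarrow> resp A B v t"
    unfolding resp_def set_lebesgue_integral_def
  proof (rule integral_dominated_convergence[OF _ _ integrable_indicator_Icc[of K 0 T]])
    show "AE \<tau> in lborel. (\<lambda>n. indicator {0..s n} \<tau> *\<^sub>R mexp A (s n - \<tau>) (B *v v \<tau>))
        \<longlonglongrightarrow> indicator {0..t} \<tau> *\<^sub>R mexp A (t - \<tau>) (B *v v \<tau>)"
      using AE_lborel_singleton[of t]
    proof eventually_elim
      case (elim \<tau>)
      have ind: "(\<lambda>n. indicator {0..s n} \<tau> :: real) \<longlonglongrightarrow> indicator {0..t} \<tau>"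
      proof (rule tendsto_eventually)
        consider "\<tau> < t" | "t < \<tau>" using elim by linarith
        then show "\<forall>\<^sub>F n in sequentially. (indicator {0..s n} \<tau> :: real) = indicator {0..t} \<tau>"
        proof cases
          case 1
          with order_tendstoD(1)[OF s] have "\<forall>\<^sub>F n in sequentially. \<tau> < s n" by blast
          then show ?thesis by eventually_elim (use 1 in \<open>auto simp: indicator_def\<close>)
        next
          case 2
          with order_tendstoD(2)[OF s] have "\<forall>\<^sub>F n in sequentially. s n < \<tau>" by blast
          then show ?thesis by eventually_elim (use 2 in \<open>auto simp: indicator_def\<close>)
        qed
      qed
      have "isCont (\<lambda>t. mexp A (t - \<tau>) (B *v v \<tau>)) t"
        using continuous_on_eq_continuous_at[of UNIV "\<lambda>t. mexp A (t - \<tau>) (B *v v \<tau>)"]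
        by (auto intro!: continuous_intros)
      then have "(\<lambda>n. mexp A (s n - \<tau>) (B *v v \<tau>)) \<longlonglongrightarrow> mexp A (t - \<tau>) (B *v v \<tau>)"
        by (rule isCont_tendsto_compose[OF _ s])
      with ind show ?case by (rule tendsto_scaleR)
    qed
    show "AE \<tau> in lborel. norm (indicator {0..s n} \<tau> *\<^sub>R mexp A (s n - \<tau>) (B *v v \<tau>)) \<le> K * indicator {0..T} \<tau>" for n
      by (rule AE_I2) (rule K(3))
  qed measurable
qed

lemma integrable_v: "integrable lborel v"
proof (rule Bochner_Integration.integrable_bound[OF integrable_indicator_Icc[of c 0 T]])
  show "AE t in lborel. norm (v t) \<le> norm (c * indicator {0..T} t)"
  proof (rule AE_I2)
    fix t show "norm (v t) \<le> norm (c * indicator {0..T} t)"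
      using v_bound[of t] v_supp[of t] by (auto simp: indicator_def)
  qed
qed simp

text \<open>Convolution theorem in time: the response is the input convolved with exp(sA)B on s
  \<ge> 0. Exchanging the two integrals turns the kernel into the Laplace integral of
  \<open>laplace_mexp\<close>.\<close>

lemma resp_fourier:
  "integrable lborel (resp A B v)"
  "fourier_vec (resp A B v) \<omega> = resolv A \<omega> (B *v fourier_vec v \<omega>)"
proof -
  obtain C \<delta> where C: "C \<ge> 0" "\<delta> > 0"
    "\<And>t v. t \<ge> 0 \<Longrightarrow> norm (mexp A t v) \<le> C * exp (- \<delta> * t) * norm v"
    using hurwitz_uniform_decay[OF A] by blast
  have c: "c \<ge> 0" using v_bound[of 0] norm_ge_zero order_trans by blast
  define h where "h \<omega> \<tau> t = indicator {0..} (t - \<tau>) *\<^sub>R (cis (- (\<omega> * t)) *s mexp A (t - \<tau>) (B *v v \<tau>))" for \<omega> \<tau> t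
  \<comment> \<open>The factor exp(\<delta>T) pays for replacing exp(-\<delta>(t - \<tau>)) by
    exp(-\<delta>t) when \<tau> \<le> T. The majorant is then a product of a function of \<tau> and
    a function of t.\<close>
  define K where "K = C * (norm B * c) * exp (\<delta> * T)"
  have hb: "norm (h \<omega> \<tau> t) \<le> (K * indicator {0..T} \<tau>) * (indicator {0..} t * exp (- \<delta> * t))" for \<omega> \<tau> t
  proof (cases "\<tau> \<in> {0..T} \<and> \<tau> \<le> t")
    case True
    have "norm (h \<omega> \<tau> t) = norm (mexp A (t - \<tau>) (B *v v \<tau>))"
      using True by (simp add: h_def norm_smult_vec)
    also have "\<dots> \<le> C * exp (- \<delta> * (t - \<tau>)) * norm (B *v v \<tau>)"
      using True by (intro C) auto
    also have "\<dots> \<le> C * exp (- \<delta> * (t - T)) * (norm B * c)"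
      using True C(1,2) c norm_matrix_vector_mult_le[of B "v \<tau>"] mult_left_mono[OF v_bound[of \<tau>], of "norm B"]
      by (intro mult_mono) auto
    also have "\<dots> = (K * indicator {0..T} \<tau>) * (indicator {0..} t * exp (- \<delta> * t))"
      using True by (simp add: K_def exp_add[symmetric] algebra_simps)
    finally show ?thesis .
  next
    case False
    then show ?thesis
      using C(1) c v_supp[of \<tau>] by (auto simp: h_def indicator_def K_def mexp_linear_simps)
  qed
  have int: "integrable (lborel \<Otimes>\<^sub>M lborel) (\<lambda>(\<tau>, t). h \<omega> \<tau> t)" for \<omega>
  proof (rule Bochner_Integration.integrable_bound)
    show "integrable (lborel \<Otimes>\<^sub>M lborel)
       (\<lambda>p. (K * indicator {0..T} (fst p)) * (indicator {0..} (snd p) * exp (- \<delta> * snd p)))"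
      by (intro integrable_pair_mult integrable_indicator_Icc integrable_exp_decay C)
    show "(\<lambda>(\<tau>, t). h \<omega> \<tau> t) \<in> borel_measurable (lborel \<Otimes>\<^sub>M lborel)"
      unfolding h_def by measurable
    show "AE p in lborel \<Otimes>\<^sub>M lborel. norm (case p of (\<tau>, t) \<Rightarrow> h \<omega> \<tau> t)
       \<le> norm ((K * indicator {0..T} (fst p)) * (indicator {0..} (snd p) * exp (- \<delta> * snd p)))"
    proof (rule AE_I2)
      fix p :: "real \<times> real"
      show "norm (case p of (\<tau>, t) \<Rightarrow> h \<omega> \<tau> t)
       \<le> norm ((K * indicator {0..T} (fst p)) * (indicator {0..} (snd p) * exp (- \<delta> * snd p)))"
        using order_trans[OF hb[of \<omega> "fst p" "snd p"] abs_ge_self] by (simp add: split_beta')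
    qed
  qed
  have inner: "(LINT \<tau>|lborel. h \<omega> \<tau> t) = cis (- (\<omega> * t)) *s resp A B v t" for \<omega> t
  proof -
    \<comment> \<open>\<open>h\<close> lives on all \<tau> \<le> t; since \<open>v\<close> vanishes
      for negative times, only [0, t] contributes.\<close>
    have "(LINT \<tau>|lborel. h \<omega> \<tau> t)
       = (LINT \<tau>|lborel. cis (- (\<omega> * t)) *s (indicator {0..t} \<tau> *\<^sub>R mexp A (t - \<tau>) (B *v v \<tau>)))"
      by (rule Bochner_Integration.integral_cong)
         (auto simp: h_def indicator_def v_supp mexp_linear_simps)
    also have "\<dots> = cis (- (\<omega> * t)) *s resp A B v t"
      using resp_integrable[OF v_meas v_bound, of t A B]
      unfolding resp_def set_lebesgue_integral_def set_integrable_def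
      by (rule integral_bounded_linear[OF bounded_bilinear.bounded_linear_right[OF bounded_bilinear_smult_vec]])
    finally show ?thesis .
  qed
  show int_x: "integrable lborel (resp A B v)"
    using lborel_pair.integrable_snd[OF int[of 0]] by (simp add: inner)
  have outer: "(LINT t|lborel. h \<omega> \<tau> t) = cis (- (\<omega> * \<tau>)) *s resolv A \<omega> (B *v v \<tau>)" for \<tau>
  proof -
    have "(LINT t|lborel. h \<omega> \<tau> t) = (LINT s|lborel. h \<omega> \<tau> (\<tau> + s))"
      using lborel_integral_real_affine[of 1 "h \<omega> \<tau>" \<tau>] by simp
    also have "\<dots> = (LINT s|lborel. cis (- (\<omega> * \<tau>)) *s (indicator {0..} s *\<^sub>R (cis (- (\<omega> * s)) *s mexp A s (B *v v \<tau>))))"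
      by (rule Bochner_Integration.integral_cong)
         (auto simp: h_def indicator_def cis_mult algebra_simps)
    also have "\<dots> = cis (- (\<omega> * \<tau>)) *s resolv A \<omega> (B *v v \<tau>)"
      using laplace_mexp[OF A, of \<omega> "B *v v \<tau>"]
      by (subst integral_bounded_linear[OF bounded_bilinear.bounded_linear_right[OF bounded_bilinear_smult_vec]])
         (simp_all add: has_bochner_integral_iff)
    finally show ?thesis .
  qed
  have "fourier_vec (resp A B v) \<omega> = (LINT t|lborel. LINT \<tau>|lborel. h \<omega> \<tau> t)"
    by (simp add: fourier_vec_def inner)
  also have "\<dots> = (LINT \<tau>|lborel. LINT t|lborel. h \<omega> \<tau> t)"
    by (rule lborel_pair.Fubini_integral[OF int])
  also have "\<dots> = (LINT \<tau>|lborel. matrix_inv (mat (\<i> * of_real \<omega>) - A) *v (B *v (cis (- (\<omega> * \<tau>)) *s v \<tau>)))"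
    by (simp add: outer resolv_def matrix_vector_mult_smult)
  also have "\<dots> = (LINT \<tau>|lborel. (matrix_inv (mat (\<i> * of_real \<omega>) - A) ** B) *v (cis (- (\<omega> * \<tau>)) *s v \<tau>))"
    unfolding matrix_vector_mul_assoc ..
  also have "\<dots> = (matrix_inv (mat (\<i> * of_real \<omega>) - A) ** B) *v fourier_vec v \<omega>"
    unfolding fourier_vec_def
    by (rule integral_bounded_linear[OF bounded_bilinear.bounded_linear_right[OF bounded_bilinear_matrix_vector_mult]
          integrable_fourier_vec[OF integrable_v]])
  finally show "fourier_vec (resp A B v) \<omega> = resolv A \<omega> (B *v fourier_vec v \<omega>)"
    by (simp add: resolv_def matrix_vector_mul_assoc)
qed

end

section \<open>Plancherel with a Gaussian weight\<close>

text \<open>Density of the centred normal law with standard deviation 1/R, in the time variable: the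
  kernel of \<open>gaussian_parseval\<close> rescaled to mass one.\<close>

definition gauss_ker :: "real \<Rightarrow> real \<Rightarrow> real" where
  "gauss_ker R u = R / sqrt (2 * pi) * exp (- (R * u)\<^sup>2 / 2)"

lemma gauss_ker_integral:
  fixes F :: "real \<Rightarrow> 'a::{banach, second_countable_topology}"
  assumes "R > 0"
  shows "(LINT s|lborel. gauss_ker R (t - s) *\<^sub>R F s) = (LINT r|lborel. std_normal_density r *\<^sub>R F (t - r / R))"
proof -
  have "(LINT s|lborel. gauss_ker R (t - s) *\<^sub>R F s)
     = \<bar>- (1 / R)\<bar> *\<^sub>R (LINT r|lborel. gauss_ker R (t - (t + - (1 / R) * r)) *\<^sub>R F (t + - (1 / R) * r))"
    by (rule lborel_integral_real_affine) (use assms in simp)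
  also have "\<dots> = (LINT r|lborel. (1 / R) *\<^sub>R (gauss_ker R (r / R) *\<^sub>R F (t - r / R)))"
    unfolding integral_scaleR_right using assms by simp
  also have "\<dots> = (LINT r|lborel. std_normal_density r *\<^sub>R F (t - r / R))"
    using assms by (simp add: gauss_ker_def std_normal_density_def)
  finally show ?thesis .
qed

lemma gauss_ker_has_integral:
  assumes "R > 0"
  shows "has_bochner_integral lborel (\<lambda>s. gauss_ker R (t - s)) 1"
proof -
  have 1: "(LINT s|lborel. gauss_ker R (t - s)) = 1"
    using gauss_ker_integral[OF assms, of t "\<lambda>_. 1::real"] integral_std_normal_moment_even[of 0] by simp
  \<comment> \<open>A function that is not integrable has Bochner integral 0, so the value 1 forces
    integrability.\<close>
  then have "integrable lborel (\<lambda>s. gauss_ker R (t - s))"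
    using not_integrable_integral_eq by fastforce
  with 1 show ?thesis by (simp add: has_bochner_integral_iff)
qed

text \<open>Adding the integral to its copy with t and s exchanged leaves the even kernel times
  a(t,s) + a(s,t), which is at most Q(t) + Q(s); unit mass in each variable then integrates the
  kernel away. No limit and no continuity of a enters, which suits the feedthrough part.\<close>

lemma even_kernel_quadratic_le:
  fixes a :: "real \<Rightarrow> real \<Rightarrow> real" and g Q :: "real \<Rightarrow> real"
  assumes [measurable]: "g \<in> borel_measurable borel"
    and g: "\<And>u. g u \<ge> 0" "\<And>u. g (- u) = g u" "\<And>t. has_bochner_integral lborel (\<lambda>s. g (t - s)) 1"
    and a: "integrable (lborel \<Otimes>\<^sub>M lborel) (\<lambda>p. g (fst p - snd p) * a (fst p) (snd p))"
    and Q: "integrable lborel Q"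
    and le: "\<And>s t. a t s + a s t \<le> Q t + Q s"
  shows "(LINT p|(lborel \<Otimes>\<^sub>M lborel). g (fst p - snd p) * a (fst p) (snd p)) \<le> (LINT t|lborel. Q t)"
proof -
  let ?P = "lborel \<Otimes>\<^sub>M lborel :: (real \<times> real) measure"
  define f where "f p = g (fst p - snd p) * a (fst p) (snd p)" for p
  define q where "q p = g (fst p - snd p) * Q (fst p)" for p
  have [measurable]: "Q \<in> borel_measurable borel" using Q by simp
  have [simp]: "(LINT s|lborel. g (t - s)) = 1" "integrable lborel (\<lambda>s. g (t - s))" for t
    using g(3)[of t] by (auto simp: has_bochner_integral_iff)
  have f: "integrable ?P f" using a by (simp add: f_def[abs_def])
  have q: "integrable ?P q"
    unfolding q_def[abs_def]
  proof (rule lborel_pair.Fubini_integrable)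
    show "integrable lborel (\<lambda>x. LINT y|lborel. norm (g (fst (x, y) - snd (x, y)) * Q (fst (x, y))))"
      using Q g(1) by (simp add: abs_mult)
    show "(\<lambda>p. g (fst p - snd p) * Q (fst p)) \<in> borel_measurable (lborel \<Otimes>\<^sub>M lborel)" by measurable
  qed simp
  have qval: "integral\<^sup>L ?P q = (LINT t|lborel. Q t)"
    using lborel_pair.integral_fst'[OF q] by (simp add: q_def)
  have swap: "integrable ?P (\<lambda>(x, y). w (y, x))" "(LINT p|?P. w p) = (LINT (x, y)|?P. w (y, x))"
    if "integrable ?P w" for w :: "real \<times> real \<Rightarrow> real"
    using lborel_pair.integrable_product_swap[OF that] lborel_pair.integral_product_swap[of w] that by simp_all
  have "2 * integral\<^sup>L ?P f = (LINT p|?P. f p + (case p of (x, y) \<Rightarrow> f (y, x)))"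
    using f swap[OF f] by (subst Bochner_Integration.integral_add) auto
  also have "\<dots> \<le> (LINT p|?P. q p + (case p of (x, y) \<Rightarrow> q (y, x)))"
  proof (rule integral_mono)
    fix p :: "real \<times> real"
    obtain t s where p: "p = (t, s)" by (cases p)
    have "g (s - t) = g (t - s)" using g(2)[of "t - s"] by simp
    then show "f p + (case p of (x, y) \<Rightarrow> f (y, x)) \<le> q p + (case p of (x, y) \<Rightarrow> q (y, x))"
      using mult_left_mono[OF le[of t s] g(1)[of "t - s"]] by (simp add: p f_def q_def distrib_left)
  qed (use f q swap in auto)
  also have "\<dots> = 2 * integral\<^sup>L ?P q"
    using q swap[OF q] by (subst Bochner_Integration.integral_add) auto
  finally show ?thesis by (simp add: qval f_def[abs_def])
qed

lemma borel_measurable_gauss_ker [measurable]: "gauss_ker R \<in> borel_measurable borel"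
  unfolding gauss_ker_def[abs_def] by measurable

lemma gauss_ker_bounds: "R > 0 \<Longrightarrow> 0 \<le> gauss_ker R u" "R > 0 \<Longrightarrow> gauss_ker R u \<le> R / sqrt (2 * pi)"
  unfolding gauss_ker_def by (simp, intro mult_left_le) auto

lemma integrable_gauss_ker_cdot:
  fixes f g :: "real \<Rightarrow> complex^'m"
  assumes R: "R > 0" and f: "integrable lborel f" and g: "integrable lborel g"
  shows "integrable (lborel \<Otimes>\<^sub>M lborel) (\<lambda>p. gauss_ker R (fst p - snd p) *\<^sub>R cdot (f (fst p)) (g (snd p)))"
proof (rule Bochner_Integration.integrable_bound)
  have [measurable]: "f \<in> borel_measurable borel" "g \<in> borel_measurable borel" using f g by simp_all
  show "integrable (lborel \<Otimes>\<^sub>M lborel) (\<lambda>p. (R / sqrt (2 * pi)) *\<^sub>R cdot (f (fst p)) (g (snd p)))"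
    by (intro integrable_scaleR_right integrable_pair_cdot f g)
  show "(\<lambda>p. gauss_ker R (fst p - snd p) *\<^sub>R cdot (f (fst p)) (g (snd p))) \<in> borel_measurable (lborel \<Otimes>\<^sub>M lborel)"
    by measurable
  show "AE p in lborel \<Otimes>\<^sub>M lborel. norm (gauss_ker R (fst p - snd p) *\<^sub>R cdot (f (fst p)) (g (snd p)))
      \<le> norm ((R / sqrt (2 * pi)) *\<^sub>R cdot (f (fst p)) (g (snd p)))"
  proof (rule AE_I2)
    fix p :: "real \<times> real"
    have "\<bar>gauss_ker R (fst p - snd p)\<bar> \<le> \<bar>R / sqrt (2 * pi)\<bar>"
      using gauss_ker_bounds[OF R, of "fst p - snd p"] by linarith
    then show "norm (gauss_ker R (fst p - snd p) *\<^sub>R cdot (f (fst p)) (g (snd p)))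
      \<le> norm ((R / sqrt (2 * pi)) *\<^sub>R cdot (f (fst p)) (g (snd p)))"
      unfolding norm_scaleR by (intro mult_right_mono) auto
  qed
qed

text \<open>Approximate identity for a continuous bounded q, by two dominated convergences: in the
  smoothing variable r for fixed t, then in t with majorant K |v(t)|.\<close>

lemma gauss_smoothing_limit:
  fixes v q :: "real \<Rightarrow> complex^'m"
  assumes v: "integrable lborel v" and q: "continuous_on UNIV q" and K: "\<And>t. norm (q t) \<le> K"
  shows "(\<lambda>n. LINT t|lborel. LINT r|lborel. std_normal_density r *\<^sub>R cdot (v t) (q (t - r / real (Suc n))))
     \<longlonglongrightarrow> (LINT t|lborel. cdot (v t) (q t))"
proof -
  have [measurable]: "v \<in> borel_measurable borel" "q \<in> borel_measurable borel"
    using v q by (simp_all add: borel_measurable_continuous_onI)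
  have nrm: "integrable lborel std_normal_density" "(LINT r|lborel. std_normal_density r) = 1"
    using integral_std_normal_moment_even[of 0] integrable_std_normal_moment[of 0] by simp_all
  have bd: "norm (std_normal_density r *\<^sub>R cdot (v t) w) \<le> std_normal_density r * (norm (v t) * K)"
    if "norm w \<le> K" for r t w
    using order_trans[OF norm_cdot_le mult_left_mono[OF that norm_ge_zero[of "v t"]]]
    by (simp add: mult_left_mono)
  show ?thesis
  proof (rule integral_dominated_convergence[where w = "\<lambda>t. norm (v t) * K"])
    show "integrable lborel (\<lambda>t. norm (v t) * K)" using v by simp
    show "AE t in lborel. (\<lambda>n. LINT r|lborel. std_normal_density r *\<^sub>R cdot (v t) (q (t - r / real (Suc n))))
        \<longlonglongrightarrow> cdot (v t) (q t)"
    proof (rule AE_I2)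
      fix t
      have "(\<lambda>n. LINT r|lborel. std_normal_density r *\<^sub>R cdot (v t) (q (t - r / real (Suc n))))
        \<longlonglongrightarrow> (LINT r|lborel. std_normal_density r *\<^sub>R cdot (v t) (q t))"
      proof (rule integral_dominated_convergence[where w = "\<lambda>r. std_normal_density r * (norm (v t) * K)"])
        show "AE r in lborel. (\<lambda>n. std_normal_density r *\<^sub>R cdot (v t) (q (t - r / real (Suc n))))
            \<longlonglongrightarrow> std_normal_density r *\<^sub>R cdot (v t) (q t)"
        proof (rule AE_I2)
          fix r
          have "isCont q t" using q by (simp add: continuous_on_eq_continuous_at)
          moreover have "(\<lambda>n. t - r / real (Suc n)) \<longlonglongrightarrow> t" by real_asymp
          ultimately have "(\<lambda>n. q (t - r / real (Suc n))) \<longlonglongrightarrow> q t"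
            by (rule isCont_tendsto_compose)
          then show "(\<lambda>n. std_normal_density r *\<^sub>R cdot (v t) (q (t - r / real (Suc n))))
            \<longlonglongrightarrow> std_normal_density r *\<^sub>R cdot (v t) (q t)"
            by (intro tendsto_scaleR tendsto_const bounded_bilinear.tendsto[OF bounded_bilinear_cdot])
        qed
        show "AE r in lborel. norm (std_normal_density r *\<^sub>R cdot (v t) (q (t - r / real (Suc n))))
            \<le> std_normal_density r * (norm (v t) * K)" for n
          by (intro AE_I2 bd K)
        show "integrable lborel (\<lambda>r. std_normal_density r * (norm (v t) * K))"
          using nrm by simp
      qed measurable
      also have "(LINT r|lborel. std_normal_density r *\<^sub>R cdot (v t) (q t)) = cdot (v t) (q t)"
        using nrm by simp
      finally show "(\<lambda>n. LINT r|lborel. std_normal_density r *\<^sub>R cdot (v t) (q (t - r / real (Suc n))))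
        \<longlonglongrightarrow> cdot (v t) (q t)" .
    qed
    fix n
    show "AE t in lborel. norm (LINT r|lborel. std_normal_density r *\<^sub>R cdot (v t) (q (t - r / real (Suc n))))
         \<le> norm (v t) * K"
    proof (rule AE_I2)
      fix t
      have int: "integrable lborel (\<lambda>r. std_normal_density r *\<^sub>R cdot (v t) (q (t - r / real (Suc n))))"
      proof (rule Bochner_Integration.integrable_bound)
        show "integrable lborel (\<lambda>r. std_normal_density r * (norm (v t) * K))" using nrm by simp
        show "AE r in lborel. norm (std_normal_density r *\<^sub>R cdot (v t) (q (t - r / real (Suc n))))
            \<le> norm (std_normal_density r * (norm (v t) * K))"
          unfolding real_norm_def by (intro AE_I2 order_trans[OF bd abs_ge_self] K)
      qed measurable
      have "norm (LINT r|lborel. std_normal_density r *\<^sub>R cdot (v t) (q (t - r / real (Suc n))))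
         \<le> (LINT r|lborel. norm (std_normal_density r *\<^sub>R cdot (v t) (q (t - r / real (Suc n)))))"
        by (rule integral_norm_bound)
      also have "\<dots> \<le> (LINT r|lborel. std_normal_density r * (norm (v t) * K))"
        using nrm by (intro integral_mono integrable_norm int bd K) simp
      finally show "norm (LINT r|lborel. std_normal_density r *\<^sub>R cdot (v t) (q (t - r / real (Suc n))))
         \<le> norm (v t) * K"
        using nrm by simp
    qed
  qed measurable
qed

section \<open>From a positive transfer function to nonnegative work of one finite-dimensional
  system\<close>

context
  fixes A :: "complex^'n^'n" and B :: "complex^'m^'n" and C :: "complex^'n^'r" and D :: "complex^'m^'r"
    and G :: "complex^'r^'m"
  assumes A: "hurwitz A"
    and pos: "\<And>\<omega> w. 0 \<le> Re (cdot w (G *v (C *v resolv A \<omega> (B *v w) + D *v w)))"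
begin

text \<open>At infinite frequency the resolvent vanishes, so the positivity assumption survives for
  the product of G and D alone.\<close>

lemma feedthrough_nonneg: "0 \<le> Re (cdot w (G *v (D *v w)))"
proof (rule LIMSEQ_le_const)
  have "(\<lambda>n. Re (cdot w (G *v (C *v resolv A (real n) (B *v w) + D *v w))))
      \<longlonglongrightarrow> Re (cdot w (G *v (C *v 0 + D *v w)))"
    by (intro tendsto_intros bounded_bilinear.tendsto[OF bounded_bilinear_cdot]
        bounded_bilinear.tendsto[OF bounded_bilinear_matrix_vector_mult] resolv_tendsto_0[OF A])
  then show "(\<lambda>n. Re (cdot w (G *v (C *v resolv A (real n) (B *v w) + D *v w))))
      \<longlonglongrightarrow> Re (cdot w (G *v (D *v w)))" by simp
qed (use pos in blast)

text \<open>The weighted output splits into \<open>q\<close>, driven by the continuous state, and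
  the feedthrough \<open>d\<close>. Positivity is available for the smoothed pairing of
  \<open>v\<close> with \<open>q + d\<close>. The limit of vanishing smoothing is taken for
  \<open>q\<close> only; the smoothed \<open>d\<close>-term is dominated, for each n, by its
  unsmoothed value.\<close>

lemma transfer_nonneg_imp_passive_supp:
  fixes v :: "real \<Rightarrow> complex^'m"
  assumes v: "v \<in> borel_measurable borel" "\<And>t. norm (v t) \<le> c" "\<And>t. t \<notin> {0..T} \<Longrightarrow> v t = 0"
  shows "0 \<le> Re (LINT t|lborel. cdot (v t) (G *v (C *v resp A B v t + D *v v t)))"
proof -
  let ?P = "lborel \<Otimes>\<^sub>M lborel :: (real \<times> real) measure"
  note [measurable] = v(1)
  note bl = bounded_bilinear.bounded_linear_right[OF bounded_bilinear_matrix_vector_mult]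
  define x where "x = resp A B v"
  define q where "q t = G *v (C *v x t)" for t
  define d where "d t = G *v (D *v v t)" for t
  have intv: "integrable lborel v" by (rule integrable_v[OF A v])
  have intx: "integrable lborel x" unfolding x_def by (rule resp_fourier(1)[OF A v])
  have intq: "integrable lborel q" unfolding q_def by (intro integrable_bounded_linear[OF bl] intx)
  have intd: "integrable lborel d" unfolding d_def by (intro integrable_bounded_linear[OF bl] intv)
  have [measurable]: "q \<in> borel_measurable borel" "d \<in> borel_measurable borel" using intq intd by simp_all
  obtain Kx where Kx: "\<And>t. norm (x t) \<le> Kx" unfolding x_def using resp_bounded[OF A v] by metis
  have Kq: "norm (q t) \<le> norm G * (norm C * Kx)" for t
    unfolding q_def using Kx[of t]
    by (intro order_trans[OF norm_matrix_vector_mult_le] mult_left_mono) auto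
  have contq: "continuous_on UNIV q"
    unfolding q_def x_def
    by (intro bounded_bilinear.continuous_on[OF bounded_bilinear_matrix_vector_mult] continuous_intros
        continuous_on_resp[OF A v])
  have intc: "integrable lborel (\<lambda>t. cdot (v t) (f t))" if f: "integrable lborel f" for f
  proof (rule Bochner_Integration.integrable_bound)
    have [measurable]: "f \<in> borel_measurable borel" using f by simp
    show "(\<lambda>t. cdot (v t) (f t)) \<in> borel_measurable lborel" by simp
    show "integrable lborel (\<lambda>t. c *\<^sub>R f t)" using f by simp
    show "AE t in lborel. norm (cdot (v t) (f t)) \<le> norm (c *\<^sub>R f t)"
      by (intro AE_I2 order_trans[OF norm_cdot_le])
        (auto intro!: mult_right_mono order_trans[OF v(2) abs_ge_self])
  qed
  define Q where "Q t = Re (cdot (v t) (d t))" for t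
  have intQ: "integrable lborel Q" unfolding Q_def by (intro integrable_Re intc intd)
  define Z where "Z n = (LINT t|lborel. LINT r|lborel. std_normal_density r *\<^sub>R cdot (v t) (q (t - r / real (Suc n))))" for n
  have "0 \<le> Re (Z n) + (LINT t|lborel. Q t)" for n
  proof -
    define R where "R = real (Suc n)"
    have R: "R > 0" by (simp add: R_def)
    define Y where "Y t = q t + d t" for t
    have intY: "integrable lborel Y" unfolding Y_def using intq intd by simp
    have FY: "fourier_vec Y \<omega> = G *v (C *v resolv A \<omega> (B *v fourier_vec v \<omega>) + D *v fourier_vec v \<omega>)" for \<omega>
      unfolding Y_def q_def d_def x_def
      using resp_fourier[OF A v, where B = B] intv
      by (subst fourier_vec_add)
         (simp_all add: fourier_vec_mult integrable_bounded_linear[OF bl] mv_simps)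
    let ?h = "\<lambda>f p. gauss_ker R (fst p - snd p) *\<^sub>R cdot (v (fst p)) (f (snd p))"
    have ih: "integrable ?P (?h f)" if "integrable lborel f" for f
      by (rule integrable_gauss_ker_cdot[OF R intv that])
    \<comment> \<open>On the frequency side the integrand is the quadratic form of the transfer
      function at the vector \<open>fourier_vec v (R * \<xi>)\<close>, hence has nonnegative real
      part at each frequency.\<close>
    have "0 \<le> Re (LINT \<xi>|std_normal_distribution. cdot (fourier_vec v (R * \<xi>)) (fourier_vec Y (R * \<xi>)))"
      unfolding integral_Re[OF gaussian_parseval(2)[OF intv intY], symmetric]
      by (rule Bochner_Integration.integral_nonneg) (simp add: FY pos)
    then have "0 \<le> R / sqrt (2 * pi) * Re (LINT p|?P. exp (- (R * (fst p - snd p))\<^sup>2 / 2) *\<^sub>R cdot (v (fst p)) (Y (snd p)))"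
      unfolding gaussian_parseval(1)[OF intv intY] using R by (intro mult_nonneg_nonneg) auto
    also have "\<dots> = Re (LINT p|?P. ?h Y p)"
    proof -
      have "(LINT p|?P. ?h Y p) = (LINT p|?P. (R / sqrt (2 * pi)) *\<^sub>R (exp (- (R * (fst p - snd p))\<^sup>2 / 2) *\<^sub>R cdot (v (fst p)) (Y (snd p))))"
        by (simp add: gauss_ker_def)
      then show ?thesis unfolding integral_scaleR_right by simp
    qed
    also have "(LINT p|?P. ?h Y p) = (LINT p|?P. ?h q p) + (LINT p|?P. ?h d p)"
      unfolding Y_def bounded_bilinear.add_right[OF bounded_bilinear_cdot] scaleR_add_right
      by (rule Bochner_Integration.integral_add[OF ih[OF intq] ih[OF intd]])
    also have "(LINT p|?P. ?h q p) = Z n"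
      using lborel_pair.integral_fst'[OF ih[OF intq]]
      by (simp only: fst_conv snd_conv gauss_ker_integral[OF R]) (simp add: Z_def R_def)
    also have "Re (Z n + (LINT p|?P. ?h d p)) = Re (Z n) + (LINT p|?P. gauss_ker R (fst p - snd p) * Re (cdot (v (fst p)) (d (snd p))))"
      by (simp add: integral_Re[OF ih[OF intd], symmetric])
    also have "\<dots> \<le> Re (Z n) + (LINT t|lborel. Q t)"
    proof (intro add_left_mono even_kernel_quadratic_le[where g = "gauss_ker R" and a = "\<lambda>t s. Re (cdot (v t) (d s))"] intQ)
      show "gauss_ker R (- u) = gauss_ker R u" for u by (simp add: gauss_ker_def)
      show "integrable ?P (\<lambda>p. gauss_ker R (fst p - snd p) * Re (cdot (v (fst p)) (d (snd p))))"
        using integrable_Re[OF ih[OF intd]] by simp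
      \<comment> \<open>This is the expansion of the nonnegative feedthrough form at the vector
        \<open>v t - v s\<close>.\<close>
      show "Re (cdot (v t) (d s)) + Re (cdot (v s) (d t)) \<le> Q t + Q s" for s t
        using feedthrough_nonneg[of "v t - v s"]
        by (simp add: Q_def d_def mv_simps bounded_bilinear.diff_left[OF bounded_bilinear_cdot]
            bounded_bilinear.diff_right[OF bounded_bilinear_cdot])
    qed (simp_all add: gauss_ker_bounds[OF R] gauss_ker_has_integral[OF R])
    finally show ?thesis .
  qed
  moreover have "Z \<longlonglongrightarrow> (LINT t|lborel. cdot (v t) (q t))"
    unfolding Z_def by (rule gauss_smoothing_limit[OF intv contq Kq])
  ultimately have "0 \<le> Re (LINT t|lborel. cdot (v t) (q t)) + (LINT t|lborel. Q t)"
    by (intro LIMSEQ_le_const[of "\<lambda>n. Re (Z n) + (LINT t|lborel. Q t)"]) (auto intro!: tendsto_intros)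
  also have "(LINT t|lborel. Q t) = Re (LINT t|lborel. cdot (v t) (d t))"
    unfolding Q_def by (rule integral_Re[OF intc[OF intd]])
  also have "Re (LINT t|lborel. cdot (v t) (q t)) + Re (LINT t|lborel. cdot (v t) (d t))
      = Re (LINT t|lborel. cdot (v t) (q t) + cdot (v t) (d t))"
    by (subst Bochner_Integration.integral_add[OF intc[OF intq] intc[OF intd]]) simp
  finally show ?thesis
    by (simp add: q_def d_def x_def mv_simps bounded_bilinear.add_right[OF bounded_bilinear_cdot])
qed

text \<open>Causality: cutting the input off outside [0, T] changes neither the response nor the
  integrand of the work on [0, T].\<close>

lemma transfer_nonneg_imp_passive:
  fixes v :: "real \<Rightarrow> complex^'m"
  assumes [measurable]: "v \<in> borel_measurable borel" and c: "\<And>t. norm (v t) \<le> c"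
  shows "0 \<le> Re (LINT t:{0..T}|lborel. cdot (v t) (G *v (C *v resp A B v t + D *v v t)))"
proof -
  define v' where "v' t = indicator {0..T} t *\<^sub>R v t" for t
  have "c \<ge> 0" using c[of 0] norm_ge_zero order_trans by blast
  have "0 \<le> Re (LINT t|lborel. cdot (v' t) (G *v (C *v resp A B v' t + D *v v' t)))"
  proof (rule transfer_nonneg_imp_passive_supp)
    show "v' \<in> borel_measurable borel" unfolding v'_def by measurable
    show "norm (v' t) \<le> c" for t using c[of t] \<open>c \<ge> 0\<close> by (simp add: v'_def indicator_def)
    show "v' t = 0" if "t \<notin> {0..T}" for t using that by (simp add: v'_def)
  qed
  also have "(LINT t|lborel. cdot (v' t) (G *v (C *v resp A B v' t + D *v v' t)))
      = (LINT t:{0..T}|lborel. cdot (v t) (G *v (C *v resp A B v t + D *v v t)))"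
    unfolding set_lebesgue_integral_def
  proof (rule Bochner_Integration.integral_cong)
    fix t
    have "resp A B v' t = resp A B v t" if "t \<in> {0..T}"
      unfolding resp_def by (rule set_lebesgue_integral_cong) (use that in \<open>auto simp: v'_def\<close>)
    then show "cdot (v' t) (G *v (C *v resp A B v' t + D *v v' t))
       = indicator {0..T} t *\<^sub>R cdot (v t) (G *v (C *v resp A B v t + D *v v t))"
      by (auto simp: v'_def indicator_def bounded_bilinear.zero_left[OF bounded_bilinear_cdot])
  qed simp
  finally show ?thesis .
qed

end

section \<open>Fourier series on the torus\<close>

lemma torus_measurable [measurable]: "torus \<in> sets borel"
proof -
  have "torus = (\<Inter>i\<in>UNIV. {\<sigma>. - pi \<le> \<sigma> $ i} \<inter> {\<sigma>. \<sigma> $ i < pi})"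
    by (auto simp: torus_def)
  also have "\<dots> \<in> sets borel"
    by (intro sets.finite_INT sets.Int borel_closed borel_open closed_halfspace_component_ge_cart open_halfspace_component_lt_cart) auto
  finally show ?thesis .
qed

text \<open>Positivity and finiteness of the volume are what normalisation requires; its value, a
  power of 2\<pi>, never enters.\<close>

lemma emeasure_torus:
  obtains c :: real where "c > 0" "emeasure lborel (torus :: (real^'v) set) = ennreal c"
proof -
  let ?a = "\<chi> i. - pi :: real^'v" and ?b = "\<chi> i. pi :: real^'v"
  have "torus \<subseteq> cbox ?a ?b" by (auto simp: torus_def mem_box_cart less_imp_le)
  then have "emeasure lborel (torus :: (real^'v) set) \<le> emeasure lborel (cbox ?a ?b)"
    by (intro emeasure_mono) auto
  also have "\<dots> < \<infinity>" by (rule emeasure_bounded_finite[OF bounded_cbox])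
  finally have fin: "emeasure lborel (torus :: (real^'v) set) < \<infinity>" .
  have "box ?a ?b \<noteq> {}" unfolding interval_ne_empty_cart by simp
  then have "emeasure lborel (box ?a ?b) \<noteq> 0"
    using open_not_negligible[OF open_box] by (auto simp: negligible_iff_null_sets null_sets_def)
  moreover have "box ?a ?b \<subseteq> torus" by (auto simp: torus_def mem_box_cart less_imp_le)
  then have "emeasure lborel (box ?a ?b) \<le> emeasure lborel (torus :: (real^'v) set)"
    by (intro emeasure_mono) auto
  ultimately have "emeasure lborel (torus :: (real^'v) set) \<noteq> 0" by auto
  with fin show ?thesis
    by (intro that[of "enn2real (emeasure lborel torus)"]) (auto simp: enn2real_positive_iff less_top zero_less_iff_neq_zero)
qed

text \<open>Normalised Lebesgue measure of the torus, viewed as a measure on the whole space. As a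
  probability measure it makes bounded measurable functions integrable and the characters
  orthonormal.\<close>

definition tmeas :: "(real^'v) measure" where
  "tmeas = uniform_measure lborel torus"

lemma sets_tmeas [measurable_cong, simp]: "sets tmeas = sets borel"
  by (simp add: tmeas_def)

lemma space_tmeas [simp]: "space tmeas = UNIV"
  by (simp add: tmeas_def)

interpretation tm: prob_space "tmeas :: (real^'v) measure"
proof -
  obtain c :: real where "c > 0" "emeasure lborel (torus :: (real^'v) set) = ennreal c"
    by (rule emeasure_torus)
  then show "prob_space (tmeas :: (real^'v) measure)"
    unfolding tmeas_def by (intro prob_space_uniform_measure) auto
qed

lemma AE_tmeas: "(AE \<sigma> in tmeas. P \<sigma>) \<longleftrightarrow> (AE \<sigma> in lborel. \<sigma> \<in> (torus :: (real^'v) set) \<longrightarrow> P \<sigma>)"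
proof -
  obtain c :: real where "c > 0" "emeasure lborel (torus :: (real^'v) set) = ennreal c"
    by (rule emeasure_torus)
  then show ?thesis unfolding tmeas_def by (subst AE_uniform_measure) auto
qed

lemma nn_integral_tmeas:
  obtains c :: real where "c > 0"
    "\<And>f. f \<in> borel_measurable borel \<Longrightarrow> (\<integral>\<^sup>+\<sigma>\<in>torus. f (\<sigma> :: real^'v) \<partial>lborel) = ennreal c * (\<integral>\<^sup>+\<sigma>. f \<sigma> \<partial>tmeas)"
proof -
  obtain c :: real where c: "c > 0" "emeasure lborel (torus :: (real^'v) set) = ennreal c"
    by (rule emeasure_torus)
  show ?thesis
  proof (rule that[OF c(1)])
    fix f :: "real^'v \<Rightarrow> ennreal" assume "f \<in> borel_measurable borel"
    then have "(\<integral>\<^sup>+\<sigma>. f \<sigma> \<partial>tmeas) = (\<integral>\<^sup>+\<sigma>\<in>torus. f \<sigma> \<partial>lborel) / ennreal c"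
      unfolding tmeas_def by (subst nn_integral_uniform_measure) (auto simp: c)
    then show "(\<integral>\<^sup>+\<sigma>\<in>torus. f \<sigma> \<partial>lborel) = ennreal c * (\<integral>\<^sup>+\<sigma>. f \<sigma> \<partial>tmeas)"
      using c by (simp add: ennreal_times_divide mult.commute[of "ennreal c"] mult_divide_eq_ennreal)
  qed
qed

lemma lebesgue_integral_tmeas:
  obtains c :: real where "c > 0"
    "\<And>f :: real^'v \<Rightarrow> complex. f \<in> borel_measurable borel \<Longrightarrow>
       (LINT \<sigma>|tmeas. f \<sigma>) = c *\<^sub>R (LINT \<sigma>|lborel. indicator torus \<sigma> *\<^sub>R f \<sigma>)"
proof -
  obtain c :: real where c: "c > 0" "emeasure lborel (torus :: (real^'v) set) = ennreal c"
    by (rule emeasure_torus)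
  have eq: "indicator torus \<sigma> / ennreal c = ennreal (indicator torus \<sigma> / c)" for \<sigma> :: "real^'v"
    using c(1) by (cases "\<sigma> \<in> torus") (auto simp: divide_ennreal[symmetric])
  show ?thesis
  proof (rule that[of "1 / c"])
    fix f :: "real^'v \<Rightarrow> complex" assume [measurable]: "f \<in> borel_measurable borel"
    have "(LINT \<sigma>|tmeas. f \<sigma>) = (LINT \<sigma>|lborel. (indicator torus \<sigma> / c) *\<^sub>R f \<sigma>)"
      unfolding tmeas_def uniform_measure_def c(2) eq
      by (rule integral_density) (use c in auto)
    also have "\<dots> = (LINT \<sigma>|lborel. (1 / c) *\<^sub>R (indicator torus \<sigma> *\<^sub>R f \<sigma>))" by simp
    finally show "(LINT \<sigma>|tmeas. f \<sigma>) = (1 / c) *\<^sub>R (LINT \<sigma>|lborel. indicator torus \<sigma> *\<^sub>R f \<sigma>)"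
      unfolding integral_scaleR_right .
  qed (use c in simp)
qed

section \<open>Orthogonality of the characters of the torus\<close>

definition fdot :: "int^'v \<Rightarrow> real^'v \<Rightarrow> real" where
  "fdot l \<sigma> = (\<Sum>k\<in>UNIV. real_of_int (l $ k) * \<sigma> $ k)"

lemma fdot_simps:
  "fdot (l + m) \<sigma> = fdot l \<sigma> + fdot m \<sigma>" "fdot (l - m) \<sigma> = fdot l \<sigma> - fdot m \<sigma>"
  "fdot (- l) \<sigma> = - fdot l \<sigma>" "fdot 0 \<sigma> = 0" "fdot l (\<sigma> + \<rho>) = fdot l \<sigma> + fdot l \<rho>"
  by (simp_all add: fdot_def algebra_simps sum.distrib sum_subtractf sum_negf)

lemma fdot_axis: "fdot l (axis i h) = real_of_int (l $ i) * h"
proof -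
  have "fdot l (axis i h) = (\<Sum>k\<in>UNIV. if k = i then real_of_int (l $ i) * h else 0)"
    unfolding fdot_def by (intro sum.cong) (auto simp: axis_def)
  then show ?thesis by simp
qed

lemma borel_measurable_fdot [measurable]: "fdot l \<in> borel_measurable borel"
  unfolding fdot_def[abs_def] by (intro borel_measurable_continuous_onI continuous_intros)

lemma lborel_integral_translation:
  fixes f :: "real^'v \<Rightarrow> complex"
  assumes "f \<in> borel_measurable borel"
  shows "(LINT x|lborel. f (a + x)) = (LINT x|lborel. f x)"
proof -
  have "(LINT x|lborel. f x) = (LINT x|distr lborel borel ((+) a). f x)"
    by (simp add: lborel_distr_plus)
  also have "\<dots> = (LINT x|lborel. f (a + x))"
    by (rule integral_distr) (use assms in auto)
  finally show ?thesis by simp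
qed

text \<open>Shifting the torus in one coordinate wraps the slab \<open>S2\<close> around by a full period.\<close>

lemma torus_integral_shift:
  fixes f :: "real^'v \<Rightarrow> complex"
  assumes [measurable]: "f \<in> borel_measurable borel" and b: "\<And>\<sigma>. norm (f \<sigma>) \<le> c"
    and per: "\<And>\<sigma>. f (\<sigma> + axis i (2 * pi)) = f \<sigma>" and h: "0 < h" "h \<le> 2 * pi"
  shows "(LINT \<sigma>|lborel. indicator torus \<sigma> *\<^sub>R f (\<sigma> + axis i h)) = (LINT \<sigma>|lborel. indicator torus \<sigma> *\<^sub>R f \<sigma>)"
proof -
  define S1 where "S1 = torus \<inter> {\<sigma> :: real^'v. - pi + h \<le> \<sigma> $ i}"
  define S2 where "S2 = torus \<inter> {\<sigma> :: real^'v. \<sigma> $ i < - pi + h}"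
  have [measurable]: "S1 \<in> sets borel" "S2 \<in> sets borel"
    unfolding S1_def S2_def
    by (intro sets.Int torus_measurable borel_closed borel_open closed_halfspace_component_ge_cart open_halfspace_component_lt_cart)+
  have fin: "emeasure lborel S < \<infinity>" if "S \<subseteq> torus" for S :: "(real^'v) set"
  proof -
    obtain c :: real where c: "c > 0" "emeasure lborel (torus :: (real^'v) set) = ennreal c"
      by (rule emeasure_torus)
    then have "emeasure lborel S \<le> ennreal c" using emeasure_mono[OF that, of lborel] by simp
    then show ?thesis by (rule order_le_less_trans) simp
  qed
  have int: "integrable lborel (\<lambda>\<sigma>. indicator S \<sigma> *\<^sub>R f \<sigma>)" if "S \<in> sets borel" "emeasure lborel S < \<infinity>" for S
    by (rule integrableI_bounded_set_indicator) (use that b in auto)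
  let ?p = "axis i (2 * pi) :: real^'v" and ?h = "axis i h :: real^'v"
  have split: "indicator torus \<sigma> = (indicator S1 \<sigma> + indicator S2 \<sigma> :: real)" for \<sigma>
    by (auto simp: S1_def S2_def indicator_def)
  have wrap: "indicator torus (\<sigma> - ?h) = (indicator S1 \<sigma> + indicator S2 (\<sigma> - ?p) :: real)" for \<sigma>
  proof -
    have A: "(\<sigma> - axis i a) $ k = (if k = i then \<sigma> $ k - a else \<sigma> $ k)" for k and a :: real
      by (simp add: axis_def)
    have B: "\<sigma>' \<in> torus \<longleftrightarrow> (\<forall>k. k \<noteq> i \<longrightarrow> - pi \<le> \<sigma>' $ k \<and> \<sigma>' $ k < pi) \<and> - pi \<le> \<sigma>' $ i \<and> \<sigma>' $ i < pi" for \<sigma>' :: "real^'v"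
      unfolding torus_def by auto
    show ?thesis
      unfolding indicator_def S1_def S2_def Int_iff B mem_Collect_eq A using h
      by auto
  qed
  \<comment> \<open>The translate of \<open>S2\<close> lies outside the torus, so its integrability
    is read off from \<open>wrap\<close> as a difference of two integrable functions.\<close>
  have i2: "integrable lborel (\<lambda>\<sigma>. indicator S2 (\<sigma> - ?p) *\<^sub>R f \<sigma>)"
  proof -
    have "(\<lambda>\<sigma>. indicator S2 (\<sigma> - ?p) *\<^sub>R f \<sigma>) = (\<lambda>\<sigma>. indicator torus (\<sigma> - ?h) *\<^sub>R f \<sigma> - indicator S1 \<sigma> *\<^sub>R f \<sigma>)"
      by (simp add: wrap algebra_simps)
    moreover have "integrable lborel (\<lambda>\<sigma>. indicator ((\<lambda>\<sigma>. \<sigma> - ?h) -` torus) \<sigma> *\<^sub>R f \<sigma>)"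
    proof (rule int)
      show m: "(\<lambda>\<sigma>. \<sigma> - ?h) -` torus \<in> sets borel"
        using measurable_sets[of "\<lambda>\<sigma>. \<sigma> - ?h" borel borel torus] by simp
      have "emeasure lborel ((\<lambda>\<sigma>. \<sigma> - ?h) -` torus) = emeasure (distr lborel borel ((+) (- ?h))) torus"
        by (subst emeasure_distr) (auto simp: vimage_def)
      then show "emeasure lborel ((\<lambda>\<sigma>. \<sigma> - ?h) -` torus) < \<infinity>"
        using fin[of torus] by (simp add: lborel_distr_plus)
    qed
    ultimately show ?thesis
      using int[of S1] fin[of S1] by (simp add: S1_def indicator_def[of "_ -` _"] indicator_def[of torus])
  qed
  have "(LINT \<sigma>|lborel. indicator torus \<sigma> *\<^sub>R f (\<sigma> + ?h))
      = (LINT \<sigma>|lborel. indicator torus (- ?h + (?h + \<sigma>)) *\<^sub>R f (?h + \<sigma>))"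
    by (simp add: add.commute)
  also have "\<dots> = (LINT \<sigma>|lborel. indicator torus (\<sigma> - ?h) *\<^sub>R f \<sigma>)"
    using lborel_integral_translation[of "\<lambda>\<sigma>. indicator torus (- ?h + \<sigma>) *\<^sub>R f \<sigma>" ?h] by simp
  also have "\<dots> = (LINT \<sigma>|lborel. indicator S1 \<sigma> *\<^sub>R f \<sigma> + indicator S2 (\<sigma> - ?p) *\<^sub>R f \<sigma>)"
    by (simp add: wrap scaleR_add_left)
  also have "\<dots> = (LINT \<sigma>|lborel. indicator S1 \<sigma> *\<^sub>R f \<sigma>) + (LINT \<sigma>|lborel. indicator S2 (\<sigma> - ?p) *\<^sub>R f \<sigma>)"
    by (rule Bochner_Integration.integral_add) (use int[of S1] fin[of S1] i2 in \<open>auto simp: S1_def\<close>)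
  also have "(LINT \<sigma>|lborel. indicator S2 (\<sigma> - ?p) *\<^sub>R f \<sigma>) = (LINT \<sigma>|lborel. indicator S2 \<sigma> *\<^sub>R f (\<sigma> + ?p))"
    using lborel_integral_translation[of "\<lambda>\<sigma>. indicator S2 (\<sigma> - ?p) *\<^sub>R f \<sigma>" ?p] by (simp add: add.commute)
  also have "\<dots> = (LINT \<sigma>|lborel. indicator S2 \<sigma> *\<^sub>R f \<sigma>)" by (simp add: per)
  also have "(LINT \<sigma>|lborel. indicator S1 \<sigma> *\<^sub>R f \<sigma>) + \<dots> = (LINT \<sigma>|lborel. indicator S1 \<sigma> *\<^sub>R f \<sigma> + indicator S2 \<sigma> *\<^sub>R f \<sigma>)"
    by (rule Bochner_Integration.integral_add[symmetric])
       (use int[of S1] fin[of S1] int[of S2] fin[of S2] in \<open>auto simp: S1_def S2_def\<close>)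
  also have "\<dots> = (LINT \<sigma>|lborel. indicator torus \<sigma> *\<^sub>R f \<sigma>)"
    by (simp add: split scaleR_add_left)
  finally show ?thesis .
qed

text \<open>For l nonzero there is a translation that multiplies the character by -1 but leaves its
  integral over a full period unchanged, so the integral vanishes. No factorisation over the
  coordinates is involved.\<close>

lemma integral_character: "(LINT \<sigma>|tmeas. cis (fdot l \<sigma>)) = (if l = 0 then 1 else 0)"
proof (cases "l = 0")
  case True
  then show ?thesis by (simp add: fdot_simps tm.prob_space[simplified])
next
  case False
  then obtain i where i: "l $ i \<noteq> 0" by (auto simp: vec_eq_iff)
  \<comment> \<open>A half period of the character in a direction i in which l does not vanish:
    \<open>l $ i\<close> times h is plus or minus \<pi>. As \<open>l $ i\<close> is a nonzero
    integer, h is at most \<pi>, within the range allowed by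
    \<open>torus_integral_shift\<close>.\<close>
  define h where "h = pi / \<bar>real_of_int (l $ i)\<bar>"
  have h: "0 < h" "h \<le> 2 * pi" "real_of_int (l $ i) * h = pi \<or> real_of_int (l $ i) * h = - pi"
  proof -
    have "1 \<le> \<bar>real_of_int (l $ i)\<bar>" using i by linarith
    then have "h \<le> pi / 1" unfolding h_def by (intro divide_left_mono) auto
    then show "h \<le> 2 * pi" using pi_gt_zero by linarith
    show "0 < h" using i by (simp add: h_def)
    show "real_of_int (l $ i) * h = pi \<or> real_of_int (l $ i) * h = - pi"
      using i by (auto simp: h_def abs_if)
  qed
  define f where "f \<sigma> = cis (fdot l \<sigma>)" for \<sigma>
  have [measurable]: "f \<in> borel_measurable borel" unfolding f_def by measurable
  have "f (\<sigma> + axis i (2 * pi)) = f \<sigma>" for \<sigma>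
    by (simp add: f_def fdot_simps fdot_axis cis_mult[symmetric])
       (metis Ints_of_int cis_multiple_2pi mult.commute mult.left_neutral mult.right_neutral)
  then have "(LINT \<sigma>|lborel. indicator torus \<sigma> *\<^sub>R f (\<sigma> + axis i h)) = (LINT \<sigma>|lborel. indicator torus \<sigma> *\<^sub>R f \<sigma>)"
    by (intro torus_integral_shift[where c = 1] h) (auto simp: f_def)
  moreover have "f (\<sigma> + axis i h) = - f \<sigma>" for \<sigma>
    using h(3) by (auto simp: f_def fdot_simps fdot_axis cis_mult[symmetric] cis_cnj[symmetric])
  ultimately have "(LINT \<sigma>|lborel. indicator torus \<sigma> *\<^sub>R f \<sigma>) = 0"
    by simp
  moreover obtain c where "(LINT \<sigma>|tmeas. f \<sigma>) = c *\<^sub>R (LINT \<sigma>|lborel. indicator torus \<sigma> *\<^sub>R f \<sigma>)"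
    using lebesgue_integral_tmeas[where 'v='a] \<open>f \<in> borel_measurable borel\<close> by metis
  ultimately show ?thesis using False by (simp add: f_def)
qed

lemma tm_integrable:
  fixes f :: "real^'v \<Rightarrow> 'a::{banach, second_countable_topology}"
  assumes "f \<in> borel_measurable borel" "\<And>\<sigma>. norm (f \<sigma>) \<le> c"
  shows "integrable tmeas f"
  by (rule tm.integrable_const_bound[of _ c]) (use assms in \<open>auto cong: measurable_cong_sets\<close>)

lemma norm_vec_power2: "(norm (v :: 'a::real_normed_vector^'n))\<^sup>2 = (\<Sum>i\<in>UNIV. (norm (v $ i))\<^sup>2)"
  by (simp add: norm_vec_def L2_set_def sum_nonneg)

lemma borel_measurable_vec_nth [measurable]: "(\<lambda>v :: complex^'n. v $ i) \<in> borel_measurable borel"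
  by (intro borel_measurable_continuous_onI continuous_intros)

lemma borel_measurable_vec_nth_real [measurable]: "(\<lambda>v :: real^'n. v $ i) \<in> borel_measurable borel"
  by (intro borel_measurable_continuous_onI continuous_intros)

lemma borel_measurable_cnj [measurable]: "cnj \<in> borel_measurable borel"
  by (intro borel_measurable_continuous_onI continuous_intros)

lemma cmod_power2_cnj: "(cmod z)\<^sup>2 = Re (cnj z * z)"
  unfolding cmod_power2 by (simp add: power2_eq_square)

lemma cmod_diff_power2: "(cmod (z - w))\<^sup>2 = (cmod z)\<^sup>2 - 2 * Re (cnj w * z) + (cmod w)\<^sup>2"
  unfolding cmod_power2 by (simp add: power2_eq_square algebra_simps)

definition cvec :: "real^'n \<Rightarrow> complex^'n" where
  "cvec x = (\<chi> i. complex_of_real (x $ i))"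

lemma cvec_nth [simp]: "cvec x $ i = complex_of_real (x $ i)"
  by (simp add: cvec_def)

lemma norm_cvec [simp]: "norm (cvec x) = norm x"
  by (simp add: norm_vec_def)

section \<open>Trigonometric sums: coefficients, Parseval identity, Bessel inequality\<close>

definition trig :: "(int^'v) set \<Rightarrow> (int^'v \<Rightarrow> complex^'n) \<Rightarrow> real^'v \<Rightarrow> complex^'n" where
  "trig F a \<sigma> = (\<Sum>l\<in>F. cis (- fdot l \<sigma>) *s a l)"

lemma norm_trig_le: "norm (trig F a \<sigma>) \<le> (\<Sum>l\<in>F. norm (a l))"
  unfolding trig_def by (rule order_trans[OF norm_sum]) (simp add: norm_smult_vec)

lemma trig_scalar_coeff:
  assumes "finite F"
  shows "(LINT \<sigma>|tmeas. cis (fdot j \<sigma>) * (\<Sum>l\<in>F. cis (- fdot l \<sigma>) * a l)) = (if j \<in> F then a j else 0)"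
proof -
  have "(LINT \<sigma>|tmeas. cis (fdot j \<sigma>) * (\<Sum>l\<in>F. cis (- fdot l \<sigma>) * a l))
      = (LINT \<sigma>|tmeas. (\<Sum>l\<in>F. cis (fdot (j - l) \<sigma>) * a l))"
    by (simp add: sum_distrib_left mult.assoc[symmetric] cis_mult fdot_simps)
  also have "\<dots> = (\<Sum>l\<in>F. LINT \<sigma>|tmeas. cis (fdot (j - l) \<sigma>) * a l)"
  proof (rule Bochner_Integration.integral_sum)
    show "integrable tmeas (\<lambda>\<sigma>. cis (fdot (j - l) \<sigma>) * a l)" for l
      by (rule tm_integrable[of _ "norm (a l)"]) (simp_all add: norm_mult)
  qed
  also have "\<dots> = (\<Sum>l\<in>F. if l = j then a j else 0)"
    by (intro sum.cong) (auto simp: integral_character)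
  finally show ?thesis using assms by simp
qed

lemma trig_coeff:
  assumes "finite F"
  shows "(LINT \<sigma>|tmeas. cis (fdot j \<sigma>) * trig F a \<sigma> $ i) = (if j \<in> F then a j $ i else 0)"
  using trig_scalar_coeff[OF assms, of j "\<lambda>l. a l $ i"] by (simp add: trig_def)

lemma trig_scalar_pairing:
  fixes g :: "real^'v \<Rightarrow> complex"
  assumes g: "g \<in> borel_measurable borel" "\<And>\<sigma>. norm (g \<sigma>) \<le> c"
  shows "(LINT \<sigma>|tmeas. cnj (\<Sum>l\<in>F. cis (- fdot l \<sigma>) * a l) * g \<sigma>)
       = (\<Sum>l\<in>F. cnj (a l) * (LINT \<sigma>|tmeas. cis (fdot l \<sigma>) * g \<sigma>))"
proof -
  have "(LINT \<sigma>|tmeas. cnj (\<Sum>l\<in>F. cis (- fdot l \<sigma>) * a l) * g \<sigma>)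
      = (LINT \<sigma>|tmeas. (\<Sum>l\<in>F. cnj (a l) * (cis (fdot l \<sigma>) * g \<sigma>)))"
    by (simp add: sum_distrib_right sum_distrib_left cis_cnj mult_ac)
  also have "\<dots> = (\<Sum>l\<in>F. LINT \<sigma>|tmeas. cnj (a l) * (cis (fdot l \<sigma>) * g \<sigma>))"
    by (rule Bochner_Integration.integral_sum, rule integrable_mult_right, rule tm_integrable[of _ c])
       (use g in \<open>auto simp: norm_mult\<close>)
  finally show ?thesis by simp
qed

lemma trig_scalar_measurable [measurable]:
  "(\<lambda>\<sigma>. \<Sum>l\<in>F. cis (- fdot l \<sigma>) * a l) \<in> borel_measurable borel"
  by measurable

lemma trig_scalar_bound: "norm (\<Sum>l\<in>F. cis (- fdot l \<sigma>) * a l) \<le> (\<Sum>l\<in>F. norm (a l))"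
  by (rule order_trans[OF norm_sum]) (simp add: norm_mult)

lemma trig_scalar_parseval:
  assumes "finite F"
  shows "(LINT \<sigma>|tmeas. (norm (\<Sum>l\<in>F. cis (- fdot l \<sigma>) * a l))\<^sup>2) = (\<Sum>l\<in>F. (norm (a l))\<^sup>2)"
proof -
  let ?s = "\<lambda>\<sigma>. \<Sum>l\<in>F. cis (- fdot l \<sigma>) * a l"
  have int: "integrable tmeas (\<lambda>\<sigma>. cnj (?s \<sigma>) * ?s \<sigma>)"
    by (rule tm_integrable[of _ "(\<Sum>l\<in>F. norm (a l)) * (\<Sum>l\<in>F. norm (a l))"])
       (auto simp: norm_mult simp del: cnj_sum intro!: mult_mono trig_scalar_bound sum_nonneg)
  have "(LINT \<sigma>|tmeas. (norm (?s \<sigma>))\<^sup>2) = (LINT \<sigma>|tmeas. Re (cnj (?s \<sigma>) * ?s \<sigma>))"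
    by (intro Bochner_Integration.integral_cong refl) (simp only: cmod_power2_cnj)
  also have "\<dots> = Re (LINT \<sigma>|tmeas. cnj (?s \<sigma>) * ?s \<sigma>)"
    by (rule integral_Re[OF int])
  also have "\<dots> = Re (\<Sum>l\<in>F. cnj (a l) * (LINT \<sigma>|tmeas. cis (fdot l \<sigma>) * ?s \<sigma>))"
    by (subst trig_scalar_pairing[OF trig_scalar_measurable trig_scalar_bound]) simp
  also have "\<dots> = (\<Sum>l\<in>F. (norm (a l))\<^sup>2)"
    by (simp add: trig_scalar_coeff[OF assms] cmod_power2_cnj)
  finally show ?thesis .
qed

lemma trig_parseval:
  assumes "finite F"
  shows "(LINT \<sigma>|tmeas. (norm (trig F a \<sigma>))\<^sup>2) = (\<Sum>l\<in>F. (norm (a l))\<^sup>2)"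
proof -
  have "(LINT \<sigma>|tmeas. (norm (trig F a \<sigma>))\<^sup>2)
      = (LINT \<sigma>|tmeas. (\<Sum>i\<in>UNIV. (norm (\<Sum>l\<in>F. cis (- fdot l \<sigma>) * a l $ i))\<^sup>2))"
    by (simp add: norm_vec_power2 trig_def)
  also have "\<dots> = (\<Sum>i\<in>UNIV. LINT \<sigma>|tmeas. (norm (\<Sum>l\<in>F. cis (- fdot l \<sigma>) * a l $ i))\<^sup>2)"
  proof (rule Bochner_Integration.integral_sum)
    show "integrable tmeas (\<lambda>\<sigma>. (norm (\<Sum>l\<in>F. cis (- fdot l \<sigma>) * a l $ i))\<^sup>2)" for i
      by (rule tm_integrable[of _ "(\<Sum>l\<in>F. norm (a l $ i))\<^sup>2"]) (auto intro!: power_mono trig_scalar_bound)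
  qed
  also have "\<dots> = (\<Sum>i\<in>UNIV. \<Sum>l\<in>F. (norm (a l $ i))\<^sup>2)"
    by (simp add: trig_scalar_parseval[OF assms])
  also have "\<dots> = (\<Sum>l\<in>F. (norm (a l))\<^sup>2)"
    by (subst sum.swap) (simp add: norm_vec_power2)
  finally show ?thesis .
qed

text \<open>\<open>s\<close> is the orthogonal projection of g onto the conjugate characters with
  index in J; expanding the nonnegative squared distance between g and \<open>s\<close> gives the
  inequality.\<close>

lemma bessel_scalar:
  fixes g :: "real^'v \<Rightarrow> complex"
  assumes J: "finite J" and g [measurable]: "g \<in> borel_measurable borel" and c: "\<And>\<sigma>. norm (g \<sigma>) \<le> c"
  shows "(\<Sum>j\<in>J. (norm (LINT \<sigma>|tmeas. cis (fdot j \<sigma>) * g \<sigma>))\<^sup>2) \<le> (LINT \<sigma>|tmeas. (norm (g \<sigma>))\<^sup>2)"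
proof -
  define a where "a j = (LINT \<sigma>|tmeas. cis (fdot j \<sigma>) * g \<sigma>)" for j
  define s where "s \<sigma> = (\<Sum>l\<in>J. cis (- fdot l \<sigma>) * a l)" for \<sigma>
  have sm [measurable]: "s \<in> borel_measurable borel" unfolding s_def[abs_def] by measurable
  define d where "d = (\<Sum>l\<in>J. norm (a l))"
  have sb: "norm (s \<sigma>) \<le> d" for \<sigma> unfolding s_def d_def by (rule trig_scalar_bound)
  have "c \<ge> 0" "d \<ge> 0" using c[of 0] sb[of 0] norm_ge_zero order_trans by blast+
  have i1: "integrable tmeas (\<lambda>\<sigma>. (norm (g \<sigma>))\<^sup>2)"
    by (rule tm_integrable[of _ "c\<^sup>2"]) (use c in \<open>auto intro: power_mono\<close>)
  have i2: "integrable tmeas (\<lambda>\<sigma>. cnj (s \<sigma>) * g \<sigma>)"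
    by (rule tm_integrable[of _ "d * c"]) (use c sb \<open>d \<ge> 0\<close> in \<open>auto simp: norm_mult intro!: mult_mono\<close>)
  have i3: "integrable tmeas (\<lambda>\<sigma>. (norm (s \<sigma>))\<^sup>2)"
    by (rule tm_integrable[of _ "d\<^sup>2"]) (use sb in \<open>auto intro: power_mono\<close>)
  have "0 \<le> (LINT \<sigma>|tmeas. (norm (g \<sigma> - s \<sigma>))\<^sup>2)" by simp
  also have "\<dots> = (LINT \<sigma>|tmeas. (norm (g \<sigma>))\<^sup>2 - 2 * Re (cnj (s \<sigma>) * g \<sigma>) + (norm (s \<sigma>))\<^sup>2)"
    by (intro Bochner_Integration.integral_cong refl) (simp only: cmod_diff_power2)
  also have "\<dots> = (LINT \<sigma>|tmeas. (norm (g \<sigma>))\<^sup>2) - 2 * Re (LINT \<sigma>|tmeas. cnj (s \<sigma>) * g \<sigma>) + (LINT \<sigma>|tmeas. (norm (s \<sigma>))\<^sup>2)"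
  proof -
    define r where "r \<sigma> = Re (cnj (s \<sigma>) * g \<sigma>)" for \<sigma>
    have "integrable tmeas r" "(LINT \<sigma>|tmeas. r \<sigma>) = Re (LINT \<sigma>|tmeas. cnj (s \<sigma>) * g \<sigma>)"
      unfolding r_def by (rule integrable_Re[OF i2], rule integral_Re[OF i2])
    with i1 i3 show ?thesis unfolding r_def[symmetric] by simp
  qed
  also have "(LINT \<sigma>|tmeas. cnj (s \<sigma>) * g \<sigma>) = (\<Sum>l\<in>J. cnj (a l) * a l)"
    unfolding s_def a_def by (rule trig_scalar_pairing[OF g c])
  also have "Re (\<Sum>l\<in>J. cnj (a l) * a l) = (\<Sum>l\<in>J. (norm (a l))\<^sup>2)"
    by (simp add: cmod_power2_cnj)
  also have "(LINT \<sigma>|tmeas. (norm (s \<sigma>))\<^sup>2) = (\<Sum>l\<in>J. (norm (a l))\<^sup>2)"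
    unfolding s_def by (rule trig_scalar_parseval[OF J])
  finally show ?thesis by (simp add: a_def)
qed

text \<open>The sequence is tied to f by being its Fourier coefficients, rather than by f being the
  limit of a series. In this form Toeplitz operators, the semigroup and time integrals are handled
  by exchanging an integral with a limit. Realness of x is built in, so no reflection symmetry of f
  has to be tracked.\<close>

definition fourier_rep :: "(int^'v \<Rightarrow> real^'n) \<Rightarrow> (real^'v \<Rightarrow> complex^'n) \<Rightarrow> bool" where
  "fourier_rep x f \<longleftrightarrow> (\<forall>j i. complex_of_real (x j $ i) = (LINT \<sigma>|tmeas. cis (fdot j \<sigma>) * f \<sigma> $ i))"

lemma fourier_rep_trig:
  assumes "finite F" "\<And>l. l \<notin> F \<Longrightarrow> x l = 0"
  shows "fourier_rep x (trig F (\<lambda>l. cvec (x l)))"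
  unfolding fourier_rep_def trig_coeff[OF assms(1)] using assms(2) by auto

lemma bessel:
  fixes f :: "real^'v \<Rightarrow> complex^'n"
  assumes J: "finite J" and rep: "fourier_rep x f"
    and f [measurable]: "f \<in> borel_measurable borel" and c: "\<And>\<sigma>. norm (f \<sigma>) \<le> c"
  shows "(\<Sum>j\<in>J. (norm (x j))\<^sup>2) \<le> (LINT \<sigma>|tmeas. (norm (f \<sigma>))\<^sup>2)"
proof -
  have ci: "norm (f \<sigma> $ i) \<le> c" for \<sigma> i
    using c order_trans[OF Finite_Cartesian_Product.norm_nth_le] by blast
  have "(\<Sum>j\<in>J. (norm (x j))\<^sup>2) = (\<Sum>j\<in>J. \<Sum>i\<in>UNIV. (norm (LINT \<sigma>|tmeas. cis (fdot j \<sigma>) * f \<sigma> $ i))\<^sup>2)"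
  proof -
    have "norm (x j $ i) = norm (LINT \<sigma>|tmeas. cis (fdot j \<sigma>) * f \<sigma> $ i)" for j i
      using rep unfolding fourier_rep_def by (metis norm_of_real real_norm_def)
    then show ?thesis by (simp only: norm_vec_power2)
  qed
  also have "\<dots> = (\<Sum>i\<in>UNIV. \<Sum>j\<in>J. (norm (LINT \<sigma>|tmeas. cis (fdot j \<sigma>) * f \<sigma> $ i))\<^sup>2)"
    by (rule sum.swap)
  also have "\<dots> \<le> (\<Sum>i\<in>UNIV. LINT \<sigma>|tmeas. (norm (f \<sigma> $ i))\<^sup>2)"
    by (intro sum_mono bessel_scalar[OF J _ ci]) measurable
  also have "\<dots> = (LINT \<sigma>|tmeas. (\<Sum>i\<in>UNIV. (norm (f \<sigma> $ i))\<^sup>2))"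
    by (rule Bochner_Integration.integral_sum[symmetric], rule tm_integrable[of _ "c\<^sup>2"])
       (use ci in \<open>auto intro: power_mono\<close>)
  finally show ?thesis by (simp add: norm_vec_power2)
qed

section \<open>Toeplitz operators and the semigroup on Fourier coefficients\<close>

lemma fourier_term_eq: "fourier_term K l \<sigma> = (\<chi> i j. cis (- fdot l \<sigma>) * complex_of_real (K l $ i $ j))"
  by (simp add: fourier_term_def fdot_def)

lemma norm_fourier_term: "norm (fourier_term K l \<sigma>) = norm (K l)"
  by (simp add: fourier_term_eq norm_vec_def norm_mult)

text \<open>A matrix-valued function is the finite sum of its entries placed into elementary
  matrices, and each placement is linear, hence continuous.\<close>

lemma borel_measurable_matrixI:
  fixes f :: "'a \<Rightarrow> complex^'b^'c"
  assumes "\<And>i j. (\<lambda>x. f x $ i $ j) \<in> borel_measurable M"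
  shows "f \<in> borel_measurable M"
proof -
  have eq: "f = (\<lambda>x. \<Sum>i\<in>UNIV. \<Sum>j\<in>UNIV. (\<chi> i' j'. if i' = i \<and> j' = j then f x $ i $ j else 0))"
  proof -
    have "(\<Sum>j\<in>UNIV. if i' = i \<and> j' = j then f x $ i $ j else 0) = (if i' = i then f x $ i $ j' else 0)" for x i i' j'
      by (cases "i' = i") simp_all
    then show ?thesis by (simp add: fun_eq_iff vec_eq_iff)
  qed
  have m: "(\<lambda>x. (\<chi> i' j'. if i' = i \<and> j' = j then f x $ i $ j else 0) :: complex^'b^'c) \<in> borel_measurable M" for i j
  proof -
    have "bounded_linear (\<lambda>z. (\<chi> i' j'. if i' = i \<and> j' = j then z else 0) :: complex^'b^'c)"
      unfolding linear_conv_bounded_linear[symmetric] by (rule linearI) (simp_all add: vec_eq_iff)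
    then have "(\<lambda>z. (\<chi> i' j'. if i' = i \<and> j' = j then z else 0) :: complex^'b^'c) \<in> borel_measurable borel"
      by (intro borel_measurable_continuous_onI linear_continuous_on)
    from measurable_compose[OF assms this] show ?thesis .
  qed
  show ?thesis by (subst eq) (intro borel_measurable_sum m)
qed

lemma borel_measurable_fourier_term [measurable]: "fourier_term K l \<in> borel_measurable borel"
  by (rule borel_measurable_matrixI) (simp add: fourier_term_eq)

text \<open>Carries the limit in \<open>is_symbol_of\<close>, which concerns extended nonnegative
  integrals over the torus, over to real integrals for \<open>tmeas\<close>. The bound on
  \<open>Ks\<close> at every point makes these integrals finite.\<close>

lemma symbol_L2_limit:
  assumes sym: "is_symbol_of Ks K" and M: "\<And>\<sigma>. norm (Ks \<sigma>) \<le> M"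
  shows "((\<lambda>F. LINT \<sigma>|tmeas. (norm (Ks \<sigma> - (\<Sum>l\<in>F. fourier_term K l \<sigma>)))\<^sup>2) \<longlongrightarrow> 0) (finite_subsets_at_top UNIV)"
proof -
  have [measurable]: "Ks \<in> borel_measurable borel" using sym by (simp add: is_symbol_of_def)
  obtain c :: real where c: "c > 0"
    "\<And>f. f \<in> borel_measurable borel \<Longrightarrow> (\<integral>\<^sup>+\<sigma>\<in>torus. f (\<sigma> :: real^'a) \<partial>lborel) = ennreal c * (\<integral>\<^sup>+\<sigma>. f \<sigma> \<partial>tmeas)"
    using nn_integral_tmeas[where 'v='a] by blast
  let ?I = "\<lambda>F. LINT \<sigma>|tmeas. (norm (Ks \<sigma> - (\<Sum>l\<in>F. fourier_term K l \<sigma>)))\<^sup>2"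
  have "(\<integral>\<^sup>+ \<sigma>\<in>torus. ennreal ((norm (Ks \<sigma> - (\<Sum>l\<in>F. fourier_term K l \<sigma>)))\<^sup>2) \<partial>lborel) = ennreal (c * ?I F)" for F
  proof -
    have b: "norm (Ks \<sigma> - (\<Sum>l\<in>F. fourier_term K l \<sigma>)) \<le> M + (\<Sum>l\<in>F. norm (K l))" for \<sigma>
      by (rule order_trans[OF norm_triangle_ineq4])
         (intro add_mono M order_trans[OF norm_sum], simp add: norm_fourier_term)
    have "integrable tmeas (\<lambda>\<sigma>. (norm (Ks \<sigma> - (\<Sum>l\<in>F. fourier_term K l \<sigma>)))\<^sup>2)"
      by (rule tm_integrable[of _ "(M + (\<Sum>l\<in>F. norm (K l)))\<^sup>2"]) (use b in \<open>auto intro: power_mono\<close>)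
    then have "(\<integral>\<^sup>+ \<sigma>. ennreal ((norm (Ks \<sigma> - (\<Sum>l\<in>F. fourier_term K l \<sigma>)))\<^sup>2) \<partial>tmeas) = ennreal (?I F)"
      by (rule nn_integral_eq_integral) simp
    then show ?thesis using c(1) by (subst c(2)) (auto simp: ennreal_mult)
  qed
  then have "((\<lambda>F. ennreal (c * ?I F)) \<longlongrightarrow> ennreal 0) (finite_subsets_at_top UNIV)"
    using sym by (simp add: is_symbol_of_def)
  then have "((\<lambda>F. c * ?I F) \<longlongrightarrow> 0) (finite_subsets_at_top UNIV)"
    by (rule tendsto_ennrealD) (use c in auto)
  then have "((\<lambda>F. (1 / c) * (c * ?I F)) \<longlongrightarrow> (1 / c) * 0) (finite_subsets_at_top UNIV)"
    by (intro tendsto_mult tendsto_const)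
  then show ?thesis using c by simp
qed

text \<open>Convolution theorem in space. Partial sums of the Toeplitz sum are Fourier coefficients
  of partial symbol sums applied to f. Their distance from the limit is at most c times the mean
  distance of the symbols, hence at most c times the quadratic mean distance, which tends to 0. This
  estimate also proves that the Toeplitz sum converges.\<close>

lemma fourier_rep_toep:
  fixes f :: "real^'v \<Rightarrow> complex^'b" and K :: "int^'v \<Rightarrow> real^'b^'a"
  assumes sym: "is_symbol_of Ks K" and M: "\<And>\<sigma>. norm (Ks \<sigma>) \<le> M"
    and f [measurable]: "f \<in> borel_measurable borel" and c: "\<And>\<sigma>. norm (f \<sigma>) \<le> c"
    and rep: "fourier_rep x f"
  shows "fourier_rep (toep K x) (\<lambda>\<sigma>. Ks \<sigma> *v f \<sigma>)"
proof -
  have [measurable]: "Ks \<in> borel_measurable borel" using sym by (simp add: is_symbol_of_def)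
  have "c \<ge> 0" using c[of 0] norm_ge_zero order_trans by blast
  let ?E = "finite_subsets_at_top (UNIV :: (int^'v) set)"
  define I where "I j i = (LINT \<sigma>|tmeas. cis (fdot j \<sigma>) * (Ks \<sigma> *v f \<sigma>) $ i)" for j i
  have lim: "((\<lambda>F. \<Sum>k\<in>F. complex_of_real ((K (j - k) *v x k) $ i)) \<longlongrightarrow> I j i) ?E" for j i
  proof -
    \<comment> \<open>The term k of the Toeplitz sum belongs to the symbol term j - k. Reflection is
      a bijection of the lattice, so it preserves the filter of finite subsets along which both sums
      converge.\<close>
    define r where "r k = j - k" for k :: "int^'v"
    have bij: "bij r" unfolding r_def by (rule bij_betw_byWitness[where f' = "\<lambda>k. j - k"]) auto
    let ?P = "\<lambda>F \<sigma>. \<Sum>l\<in>F. fourier_term K l \<sigma>"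
    define e where "e F = (LINT \<sigma>|tmeas. (norm (Ks \<sigma> - ?P F \<sigma>))\<^sup>2)" for F
    have fl: "filterlim ((`) r) ?E ?E"
      using filtermap_image_finite_subsets_at_top[of r UNIV] bij
      by (simp add: filterlim_def bij_is_inj bij_is_surj)
    have e0: "((\<lambda>F. e (r ` F)) \<longlongrightarrow> 0) ?E"
      using filterlim_compose[OF symbol_L2_limit[OF sym M] fl] unfolding e_def .
    have trm: "complex_of_real ((K (j - k) *v x k) $ i)
        = (LINT \<sigma>|tmeas. cis (fdot j \<sigma>) * (fourier_term K (r k) \<sigma> *v f \<sigma>) $ i)" for k
    proof -
      have "complex_of_real ((K (j - k) *v x k) $ i)
         = (\<Sum>b\<in>UNIV. complex_of_real (K (j - k) $ i $ b) * (LINT \<sigma>|tmeas. cis (fdot k \<sigma>) * f \<sigma> $ b))"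
        using rep unfolding fourier_rep_def by (simp add: matrix_vector_mult_nth)
      also have "\<dots> = (\<Sum>b\<in>UNIV. LINT \<sigma>|tmeas. complex_of_real (K (j - k) $ i $ b) * (cis (fdot k \<sigma>) * f \<sigma> $ b))"
        by simp
      also have "\<dots> = (LINT \<sigma>|tmeas. (\<Sum>b\<in>UNIV. complex_of_real (K (j - k) $ i $ b) * (cis (fdot k \<sigma>) * f \<sigma> $ b)))"
        by (rule Bochner_Integration.integral_sum[symmetric], rule integrable_mult_right, rule tm_integrable[of _ c])
           (use order_trans[OF Finite_Cartesian_Product.norm_nth_le c] in \<open>auto simp: norm_mult\<close>)
      also have "\<dots> = (LINT \<sigma>|tmeas. cis (fdot j \<sigma>) * (fourier_term K (r k) \<sigma> *v f \<sigma>) $ i)"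
      proof (intro Bochner_Integration.integral_cong refl)
        fix \<sigma>
        \<comment> \<open>Multiplying by the character of j - k shifts the index of the Fourier
          coefficient from j to k.\<close>
        have e: "cis (fdot j \<sigma>) * cis (- fdot (j - k) \<sigma>) = cis (fdot k \<sigma>)"
          by (simp add: cis_mult fdot_simps)
        show "(\<Sum>b\<in>UNIV. complex_of_real (K (j - k) $ i $ b) * (cis (fdot k \<sigma>) * f \<sigma> $ b))
           = cis (fdot j \<sigma>) * (fourier_term K (r k) \<sigma> *v f \<sigma>) $ i"
          unfolding matrix_vector_mult_nth fourier_term_eq vec_lambda_beta sum_distrib_left r_def
          by (intro sum.cong refl) (simp only: mult.assoc[symmetric] e, simp add: mult_ac)
      qed
      finally show ?thesis .
    qed
    have int: "integrable tmeas (\<lambda>\<sigma>. cis (fdot j \<sigma>) * (N \<sigma> *v f \<sigma>) $ i)"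
      if [measurable]: "N \<in> borel_measurable borel" and N: "\<And>\<sigma>. norm (N \<sigma>) \<le> d" for N :: "real^'v \<Rightarrow> complex^'b^'a" and d
    proof (rule tm_integrable[of _ "d * c"])
      fix \<sigma>
      have "norm ((N \<sigma> *v f \<sigma>) $ i) \<le> norm (N \<sigma>) * norm (f \<sigma>)"
        by (rule order_trans[OF Finite_Cartesian_Product.norm_nth_le norm_matrix_vector_mult_le])
      also have "\<dots> \<le> d * c" using N[of \<sigma>] c[of \<sigma>] by (intro mult_mono) (auto intro: order_trans[OF norm_ge_zero])
      finally show "norm (cis (fdot j \<sigma>) * (N \<sigma> *v f \<sigma>) $ i) \<le> d * c" by (simp add: norm_mult)
    qed simp
    have Pb: "norm (?P F \<sigma>) \<le> (\<Sum>l\<in>F. norm (K l))" for F \<sigma>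
      by (intro order_trans[OF norm_sum]) (simp add: norm_fourier_term)
    have bound: "norm ((\<Sum>k\<in>F. complex_of_real ((K (j - k) *v x k) $ i)) - I j i) \<le> c * sqrt (e (r ` F))" for F
    proof -
      have "(\<Sum>k\<in>F. complex_of_real ((K (j - k) *v x k) $ i))
         = (\<Sum>l\<in>r ` F. LINT \<sigma>|tmeas. cis (fdot j \<sigma>) * (fourier_term K l \<sigma> *v f \<sigma>) $ i)"
        using bij by (subst sum.reindex) (auto simp: trm intro: inj_on_subset[OF bij_is_inj])
      also have "\<dots> = (LINT \<sigma>|tmeas. (\<Sum>l\<in>r ` F. cis (fdot j \<sigma>) * (fourier_term K l \<sigma> *v f \<sigma>) $ i))"
        by (rule Bochner_Integration.integral_sum[symmetric], rule int) (auto simp: norm_fourier_term)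
      also have "\<dots> = (LINT \<sigma>|tmeas. cis (fdot j \<sigma>) * (?P (r ` F) \<sigma> *v f \<sigma>) $ i)"
        by (simp add: bounded_bilinear.sum_left[OF bounded_bilinear_matrix_vector_mult] sum_distrib_left)
      finally have "(\<Sum>k\<in>F. complex_of_real ((K (j - k) *v x k) $ i)) - I j i
          = (LINT \<sigma>|tmeas. cis (fdot j \<sigma>) * (?P (r ` F) \<sigma> *v f \<sigma>) $ i) - I j i" by simp
      also have "\<dots> = (LINT \<sigma>|tmeas. cis (fdot j \<sigma>) * (?P (r ` F) \<sigma> *v f \<sigma>) $ i - cis (fdot j \<sigma>) * (Ks \<sigma> *v f \<sigma>) $ i)"
        unfolding I_def
        by (rule Bochner_Integration.integral_diff[symmetric]; rule int) (use M Pb in auto)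
      finally have eq: "(\<Sum>k\<in>F. complex_of_real ((K (j - k) *v x k) $ i)) - I j i
          = (LINT \<sigma>|tmeas. cis (fdot j \<sigma>) * (?P (r ` F) \<sigma> *v f \<sigma>) $ i - cis (fdot j \<sigma>) * (Ks \<sigma> *v f \<sigma>) $ i)" .
      define X where "X \<sigma> = norm (Ks \<sigma> - ?P (r ` F) \<sigma>)" for \<sigma>
      have [measurable]: "X \<in> borel_measurable borel" unfolding X_def[abs_def] by measurable
      have Xb: "norm (X \<sigma>) \<le> M + (\<Sum>l\<in>r ` F. norm (K l))" for \<sigma>
        unfolding X_def using norm_triangle_ineq4[of "Ks \<sigma>" "?P (r ` F) \<sigma>"] M[of \<sigma>] Pb[of \<sigma> "r ` F"] by simp
      have iX: "integrable tmeas X" by (rule tm_integrable[OF _ Xb]) simp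
      have iX2: "integrable tmeas (\<lambda>\<sigma>. (X \<sigma>)\<^sup>2)"
      proof (rule tm_integrable)
        show "norm ((X \<sigma>)\<^sup>2) \<le> (M + (\<Sum>l\<in>r ` F. norm (K l)))\<^sup>2" for \<sigma>
          unfolding norm_power by (intro power_mono Xb) simp
      qed simp
      have "norm ((\<Sum>k\<in>F. complex_of_real ((K (j - k) *v x k) $ i)) - I j i)
          \<le> (LINT \<sigma>|tmeas. norm (cis (fdot j \<sigma>) * (?P (r ` F) \<sigma> *v f \<sigma>) $ i - cis (fdot j \<sigma>) * (Ks \<sigma> *v f \<sigma>) $ i))"
        unfolding eq by (rule integral_norm_bound)
      also have "\<dots> \<le> (LINT \<sigma>|tmeas. c * X \<sigma>)"
      proof (rule integral_mono)
        show "integrable tmeas (\<lambda>\<sigma>. norm (cis (fdot j \<sigma>) * (?P (r ` F) \<sigma> *v f \<sigma>) $ i - cis (fdot j \<sigma>) * (Ks \<sigma> *v f \<sigma>) $ i))"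
          by (rule integrable_norm, rule Bochner_Integration.integrable_diff; rule int) (use M Pb in auto)
        show "integrable tmeas (\<lambda>\<sigma>. c * X \<sigma>)" using iX by simp
        fix \<sigma>
        have "norm (cis (fdot j \<sigma>) * (?P (r ` F) \<sigma> *v f \<sigma>) $ i - cis (fdot j \<sigma>) * (Ks \<sigma> *v f \<sigma>) $ i)
           = norm (((?P (r ` F) \<sigma> - Ks \<sigma>) *v f \<sigma>) $ i)"
          by (simp add: right_diff_distrib[symmetric] norm_mult mv_simps)
        also have "\<dots> \<le> norm (?P (r ` F) \<sigma> - Ks \<sigma>) * norm (f \<sigma>)"
          by (rule order_trans[OF Finite_Cartesian_Product.norm_nth_le norm_matrix_vector_mult_le])
        also have "\<dots> \<le> X \<sigma> * c"
          unfolding X_def using c[of \<sigma>] by (subst norm_minus_commute) (intro mult_left_mono, auto)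
        finally show "norm (cis (fdot j \<sigma>) * (?P (r ` F) \<sigma> *v f \<sigma>) $ i - cis (fdot j \<sigma>) * (Ks \<sigma> *v f \<sigma>) $ i) \<le> c * X \<sigma>"
          by (simp add: mult.commute)
      qed
      also have "\<dots> = c * (LINT \<sigma>|tmeas. X \<sigma>)" by simp
      also have "\<dots> \<le> c * sqrt (e (r ` F))"
      proof (intro mult_left_mono \<open>c \<ge> 0\<close> real_le_rsqrt)
        \<comment> \<open>Cauchy-Schwarz for a probability measure, in the form that a variance is
          nonnegative.\<close>
        have "0 \<le> tm.variance X" by simp
        moreover have "e (r ` F) = (LINT \<sigma>|tmeas. (X \<sigma>)\<^sup>2)" by (simp add: e_def X_def)
        ultimately show "(LINT \<sigma>|tmeas. X \<sigma>)\<^sup>2 \<le> e (r ` F)"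
          using tm.variance_eq[OF iX iX2] by linarith
      qed
      finally show ?thesis .
    qed
    have "((\<lambda>F. c * sqrt (e (r ` F))) \<longlongrightarrow> c * sqrt 0) ?E"
      by (intro tendsto_intros e0)
    then have "((\<lambda>F. c * sqrt (e (r ` F))) \<longlongrightarrow> 0) ?E" by simp
    from Lim_null_comparison[OF always_eventually this, OF allI, OF bound]
    show ?thesis by (rule LIM_zero_cancel)
  qed
  \<comment> \<open>Realness is inherited from the partial sums, which involve only the real
    matrices and the real sequence.\<close>
  have real: "complex_of_real (Re (I j i)) = I j i" for j i
  proof -
    have "((\<lambda>F. Im (\<Sum>k\<in>F. complex_of_real ((K (j - k) *v x k) $ i))) \<longlongrightarrow> Im (I j i)) ?E"
      by (intro tendsto_Im lim)
    then have "((\<lambda>F. 0) \<longlongrightarrow> Im (I j i)) ?E" by simp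
    then have "Im (I j i) = 0" by (simp add: tendsto_const_iff)
    then show ?thesis by (simp add: complex_eq_iff)
  qed
  have "toep K x j = (\<chi> i. Re (I j i))" for j
    unfolding toep_def
  proof (rule infsumI, unfold has_sum_def, rule vec_tendstoI)
    fix i
    have "((\<lambda>F. Re (\<Sum>k\<in>F. complex_of_real ((K (j - k) *v x k) $ i))) \<longlongrightarrow> Re (I j i)) ?E"
      by (intro tendsto_Re lim)
    then show "((\<lambda>F. (\<Sum>k\<in>F. K (j - k) *v x k) $ i) \<longlongrightarrow> (\<chi> i. Re (I j i)) $ i) ?E"
      by simp
  qed
  then show ?thesis unfolding fourier_rep_def by (simp add: real I_def[symmetric])
qed

text \<open>\<open>semigroup\<close> and \<open>mexp\<close> are the same power series, one in
  \<open>toep A\<close> and one in the symbol. Each power is transferred by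
  \<open>fourier_rep_toep\<close>, and the exponential majorant allows the series to be integrated
  term by term.\<close>

lemma fourier_rep_semigroup:
  fixes f :: "real^'v \<Rightarrow> complex^'n" and A :: "int^'v \<Rightarrow> real^'n^'n"
  assumes sym: "is_symbol_of As A" and M: "\<And>\<sigma>. norm (As \<sigma>) \<le> M"
    and f [measurable]: "f \<in> borel_measurable borel" and c: "\<And>\<sigma>. norm (f \<sigma>) \<le> c"
    and rep: "fourier_rep x f"
  shows "fourier_rep (semigroup A s x) (\<lambda>\<sigma>. mexp (As \<sigma>) s (f \<sigma>))"
proof -
  have [measurable]: "As \<in> borel_measurable borel" using sym by (simp add: is_symbol_of_def)
  have "c \<ge> 0" "M \<ge> 0" using c[of 0] M[of 0] norm_ge_zero order_trans by blast+
  define g where "g p \<sigma> = ((*v) (As \<sigma>) ^^ p) (f \<sigma>)" for p \<sigma>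
  have gm [measurable]: "g p \<in> borel_measurable borel" for p
    unfolding g_def by (induction p) simp_all
  have gb: "norm (g p \<sigma>) \<le> M ^ p * c" for p \<sigma>
    unfolding g_def using M[of \<sigma>] c[of \<sigma>] \<open>M \<ge> 0\<close>
    by (intro order_trans[OF norm_funpow_mult_le] mult_mono power_mono) auto
  have grep: "fourier_rep ((toep A ^^ p) x) (g p)" for p
  proof (induction p)
    case 0
    then show ?case using rep by (simp add: g_def[abs_def])
  next
    case (Suc p)
    from fourier_rep_toep[OF sym M gm gb Suc] show ?case by (simp add: g_def[abs_def])
  qed
  define I where "I j i = (LINT \<sigma>|tmeas. cis (fdot j \<sigma>) * mexp (As \<sigma>) s (f \<sigma>) $ i)" for j i
  have sums: "(\<lambda>p. complex_of_real ((s ^ p / fact p) * ((toep A ^^ p) x j $ i))) sums I j i" for j i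
  proof -
    define h where "h p \<sigma> = (s ^ p / fact p) *\<^sub>R (cis (fdot j \<sigma>) * g p \<sigma> $ i)" for p \<sigma>
    define b where "b p = (inverse (fact p) * (\<bar>s\<bar> * M) ^ p) * c" for p
    have sb: "summable b" unfolding b_def by (rule summable_mexp_bound)
    have hb: "norm (h p \<sigma>) \<le> b p" for p \<sigma>
    proof -
      have "norm (h p \<sigma>) = (\<bar>s\<bar> ^ p / fact p) * norm (g p \<sigma> $ i)"
        by (simp add: h_def norm_mult power_abs)
      also have "\<dots> \<le> (\<bar>s\<bar> ^ p / fact p) * (M ^ p * c)"
        by (intro mult_left_mono order_trans[OF Finite_Cartesian_Product.norm_nth_le gb]) auto
      finally show ?thesis by (simp add: b_def power_mult_distrib field_simps)
    qed
    have [measurable]: "h p \<in> borel_measurable borel" for p unfolding h_def by measurable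
    have hi: "integrable tmeas (h p)" for p by (rule tm_integrable[OF _ hb]) simp
    have "(\<lambda>p. LINT \<sigma>|tmeas. h p \<sigma>) sums (LINT \<sigma>|tmeas. (\<Sum>p. h p \<sigma>))"
    proof (rule sums_integral[OF hi])
      show "AE \<sigma> in tmeas. summable (\<lambda>p. norm (h p \<sigma>))"
        by (intro AE_I2 summable_comparison_test'[OF sb]) (simp add: hb)
      show "summable (\<lambda>p. LINT \<sigma>|tmeas. norm (h p \<sigma>))"
      proof (rule summable_comparison_test'[OF sb])
        fix p :: nat
        have "(LINT \<sigma>|tmeas. norm (h p \<sigma>)) \<le> (LINT \<sigma>|(tmeas :: (real^'v) measure). b p)"
          by (rule integral_mono[OF integrable_norm[OF hi] _ hb]) simp
        then show "norm (LINT \<sigma>|tmeas. norm (h p \<sigma>)) \<le> b p"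
          by (simp add: tm.prob_space[simplified])
      qed
    qed
    moreover have "(\<Sum>p. h p \<sigma>) = cis (fdot j \<sigma>) * mexp (As \<sigma>) s (f \<sigma>) $ i" for \<sigma>
    proof -
      have sm: "summable (\<lambda>p. ((s ^ p / fact p) *\<^sub>R g p \<sigma>) $ i)"
        unfolding g_def by (rule bounded_linear.summable[OF bounded_linear_vec_nth summable_mexp])
      have "mexp (As \<sigma>) s (f \<sigma>) $ i = (\<Sum>p. ((s ^ p / fact p) *\<^sub>R g p \<sigma>) $ i)"
        unfolding mexp_def g_def by (rule bounded_linear.suminf[OF bounded_linear_vec_nth summable_mexp])
      then have "cis (fdot j \<sigma>) * mexp (As \<sigma>) s (f \<sigma>) $ i = (\<Sum>p. cis (fdot j \<sigma>) * ((s ^ p / fact p) *\<^sub>R g p \<sigma>) $ i)"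
        using suminf_mult[OF sm] by simp
      then show ?thesis by (simp add: h_def vector_scaleR_component)
    qed
    moreover have "(LINT \<sigma>|tmeas. h p \<sigma>) = complex_of_real ((s ^ p / fact p) * ((toep A ^^ p) x j $ i))" for p
    proof -
      have "(LINT \<sigma>|tmeas. h p \<sigma>) = (s ^ p / fact p) *\<^sub>R (LINT \<sigma>|tmeas. cis (fdot j \<sigma>) * g p \<sigma> $ i)"
        unfolding h_def by (rule integral_scaleR_right)
      also have "(LINT \<sigma>|tmeas. cis (fdot j \<sigma>) * g p \<sigma> $ i) = complex_of_real ((toep A ^^ p) x j $ i)"
        using grep[of p] by (simp add: fourier_rep_def)
      finally show ?thesis by (simp add: scaleR_conv_of_real)
    qed
    ultimately show ?thesis by (simp add: I_def)
  qed
  have real: "complex_of_real (Re (I j i)) = I j i" for j i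
  proof -
    have "(\<lambda>p::nat. 0::real) sums Im (I j i)"
      using sums_Im[OF sums[of j i]] by (simp only: Im_complex_of_real)
    then have "Im (I j i) = 0" using sums_unique2 sums_zero by blast
    then show ?thesis by (simp add: complex_eq_iff)
  qed
  have "semigroup A s x j = (\<chi> i. Re (I j i))" for j
    unfolding semigroup_def
  proof (rule sums_unique[symmetric], unfold sums_def, rule vec_tendstoI)
    fix i
    have "(\<lambda>p. (s ^ p / fact p) * ((toep A ^^ p) x j $ i)) sums Re (I j i)"
      using sums_Re[OF sums[of j i]] by (simp only: Re_complex_of_real)
    then show "(\<lambda>n. (\<Sum>p<n. (s ^ p / fact p) *\<^sub>R (toep A ^^ p) x j) $ i) \<longlonglongrightarrow> (\<chi> i. Re (I j i)) $ i"
      by (simp add: sums_def)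
  qed
  then show ?thesis unfolding fourier_rep_def by (simp add: real I_def[symmetric])
qed

lemma fourier_rep_add:
  fixes f g :: "real^'v \<Rightarrow> complex^'n"
  assumes "fourier_rep x f" "fourier_rep y g"
    and [measurable]: "f \<in> borel_measurable borel" "g \<in> borel_measurable borel"
    and f: "\<And>\<sigma>. norm (f \<sigma>) \<le> c" and g: "\<And>\<sigma>. norm (g \<sigma>) \<le> d"
  shows "fourier_rep (\<lambda>j. x j + y j) (\<lambda>\<sigma>. f \<sigma> + g \<sigma>)"
proof -
  have "integrable tmeas (\<lambda>\<sigma>. cis (fdot j \<sigma>) * f \<sigma> $ i)" "integrable tmeas (\<lambda>\<sigma>. cis (fdot j \<sigma>) * g \<sigma> $ i)" for i j
    by (rule tm_integrable[of _ c], simp, simp add: norm_mult, rule order_trans[OF Finite_Cartesian_Product.norm_nth_le f])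
       (rule tm_integrable[of _ d], simp, simp add: norm_mult, rule order_trans[OF Finite_Cartesian_Product.norm_nth_le g])
  then show ?thesis using assms(1,2) by (simp add: fourier_rep_def distrib_left)
qed

section \<open>Inputs that are bounded and finitely supported in space\<close>

definition simple_input :: "(int^'v) set \<Rightarrow> real \<Rightarrow> (real \<Rightarrow> int^'v \<Rightarrow> real^'m) \<Rightarrow> bool" where
  "simple_input F c u \<longleftrightarrow> finite F \<and> (\<forall>t. \<forall>l. l \<notin> F \<longrightarrow> u t l = 0) \<and>
     (\<forall>l. (\<lambda>t. u t l) \<in> borel_measurable borel) \<and> (\<forall>t l. norm (u t l) \<le> c)"

definition uhat :: "(int^'v) set \<Rightarrow> (real \<Rightarrow> int^'v \<Rightarrow> real^'m) \<Rightarrow> real \<Rightarrow> real^'v \<Rightarrow> complex^'m" where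
  "uhat F u t = trig F (\<lambda>l. cvec (u t l))"

lemma borel_measurable_cvec [measurable]: "cvec \<in> borel_measurable borel"
proof -
  have "bounded_linear cvec"
    unfolding linear_conv_bounded_linear[symmetric]
    by (rule linearI) (simp_all add: vec_eq_iff vector_scaleR_component, simp add: scaleR_conv_of_real)
  then show ?thesis by (intro borel_measurable_continuous_onI linear_continuous_on)
qed

lemma norm_uhat_le: "simple_input F c u \<Longrightarrow> norm (uhat F u t \<sigma>) \<le> real (card F) * c"
  unfolding uhat_def
  by (rule order_trans[OF norm_trig_le sum_bounded_above]) (simp add: simple_input_def)

lemma borel_measurable_uhat [measurable (raw)]:
  assumes u: "simple_input F c u" and [measurable]: "f \<in> borel_measurable N" "g \<in> borel_measurable N"
  shows "(\<lambda>x. uhat F u (f x) (g x)) \<in> borel_measurable N"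
proof -
  have [measurable]: "(\<lambda>t. u t l) \<in> borel_measurable borel" for l using u by (simp add: simple_input_def)
  have "(\<lambda>x. u (f x) l) \<in> borel_measurable N" for l
    by (rule measurable_compose[OF _ \<open>(\<lambda>t. u t l) \<in> _\<close>]) simp
  then show ?thesis unfolding uhat_def trig_def by measurable
qed

lemma fourier_rep_uhat: "simple_input F c u \<Longrightarrow> fourier_rep (u t) (uhat F u t)"
  unfolding uhat_def by (rule fourier_rep_trig) (auto simp: simple_input_def)

lemma integral_vec_nth:
  fixes f :: "'a \<Rightarrow> 'b::euclidean_space^'n"
  assumes "integrable M f" shows "(LINT x|M. f x) $ i = (LINT x|M. f x $ i)"
  using integral_bounded_linear[OF bounded_linear_vec_nth assms] by simp

lemma integrable_vecI:
  fixes f :: "'a \<Rightarrow> real^'n"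
  assumes "\<And>i. integrable M (\<lambda>x. f x $ i)"
  shows "integrable M f"
proof -
  have eq: "f = (\<lambda>x. \<Sum>i\<in>UNIV. (f x $ i) *\<^sub>R axis i 1)"
    by (rule ext) (simp only: scalar_mult_eq_scaleR[symmetric] basis_expansion)
  show ?thesis
    by (subst eq) (intro Bochner_Integration.integrable_sum integrable_scaleR_left assms)
qed

text \<open>The bound is asked for on the time interval only, because the available bounds on the
  response grow exponentially with time.\<close>

lemma integrable_time_torus:
  fixes h :: "real \<Rightarrow> real^'v \<Rightarrow> complex"
  assumes m: "(\<lambda>p. h (fst p) (snd p)) \<in> borel_measurable (borel \<Otimes>\<^sub>M borel)"
    and k: "\<And>\<tau> \<sigma>. \<tau> \<in> {a..b} \<Longrightarrow> norm (h \<tau> \<sigma>) \<le> k"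
  shows "integrable (lborel \<Otimes>\<^sub>M tmeas) (\<lambda>(\<tau>, \<sigma>). indicator {a..b} \<tau> *\<^sub>R h \<tau> \<sigma>)"
proof (rule integrableI_bounded_set[where A = "{a..b} \<times> UNIV" and B = k])
  have m' [measurable]: "(\<lambda>p. h (fst p) (snd p)) \<in> borel_measurable (lborel \<Otimes>\<^sub>M tmeas)"
    using m by (simp cong: measurable_cong_sets)
  show "(\<lambda>(\<tau>, \<sigma>). indicator {a..b} \<tau> *\<^sub>R h \<tau> \<sigma>) \<in> borel_measurable (lborel \<Otimes>\<^sub>M tmeas)"
    unfolding split_beta' by measurable
  show "{a..b} \<times> UNIV \<in> sets (lborel \<Otimes>\<^sub>M (tmeas :: (real^'v) measure))"
    by (intro pair_measureI) auto
  have "emeasure (lborel \<Otimes>\<^sub>M (tmeas :: (real^'v) measure)) ({a..b} \<times> UNIV) = emeasure lborel {a..b} * emeasure (tmeas :: (real^'v) measure) UNIV"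
    by (rule tm.emeasure_pair_measure_Times) auto
  then show "emeasure (lborel \<Otimes>\<^sub>M (tmeas :: (real^'v) measure)) ({a..b} \<times> UNIV) < \<infinity>"
    using tm.emeasure_space_1[where 'v='v] by (simp add: emeasure_lborel_Icc_eq)
qed (auto simp: k indicator_def intro!: AE_I2 split: if_splits)

lemma fubini_time_torus:
  fixes h :: "real \<Rightarrow> real^'v \<Rightarrow> complex"
  assumes m: "(\<lambda>p. h (fst p) (snd p)) \<in> borel_measurable (borel \<Otimes>\<^sub>M borel)"
    and k: "\<And>\<tau> \<sigma>. \<tau> \<in> {a..b} \<Longrightarrow> norm (h \<tau> \<sigma>) \<le> k"
  shows "(LINT \<tau>:{a..b}|lborel. (LINT \<sigma>|tmeas. h \<tau> \<sigma>)) = (LINT \<sigma>|tmeas. (LINT \<tau>:{a..b}|lborel. h \<tau> \<sigma>))"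
proof -
  interpret LT: pair_sigma_finite lborel "tmeas :: (real^'v) measure" ..
  show ?thesis
    using LT.Fubini_integral[OF integrable_time_torus[OF assms]]
    by (simp add: set_lebesgue_integral_def)
qed

text \<open>Only norms of the matrices and a finite horizon enter, not the decay of the exponential;
  this makes the estimate uniform in \<sigma>.\<close>

lemma norm_resp_le:
  fixes v :: "real \<Rightarrow> complex^'m"
  assumes v: "v \<in> borel_measurable borel" "\<And>t. norm (v t) \<le> c" and t: "0 \<le> t" "t \<le> T"
    and A: "norm A \<le> M" and B: "norm B \<le> M"
  shows "norm (resp A B v t) \<le> T * (exp (T * M) * (M * c))"
proof -
  have "c \<ge> 0" "M \<ge> 0" using v(2)[of 0] A norm_ge_zero order_trans by blast+
  have "norm (resp A B v t) \<le> (LINT \<tau>|lborel. norm (indicator {0..t} \<tau> *\<^sub>R mexp A (t - \<tau>) (B *v v \<tau>)))"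
    unfolding resp_def set_lebesgue_integral_def by (rule integral_norm_bound)
  also have "\<dots> \<le> (LINT \<tau>|lborel. (exp (T * M) * (M * c)) * indicator {0..T} \<tau>)"
  proof (rule integral_mono)
    show "integrable lborel (\<lambda>\<tau>. norm (indicator {0..t} \<tau> *\<^sub>R mexp A (t - \<tau>) (B *v v \<tau>)))"
      using resp_integrable[OF v, of t A B] unfolding set_integrable_def by (rule integrable_norm)
    show "integrable lborel (\<lambda>\<tau>. (exp (T * M) * (M * c)) * indicator {0..T} \<tau>)"
      by (rule integrable_indicator_Icc)
    fix \<tau>
    show "norm (indicator {0..t} \<tau> *\<^sub>R mexp A (t - \<tau>) (B *v v \<tau>)) \<le> (exp (T * M) * (M * c)) * indicator {0..T} \<tau>"
    proof (cases "\<tau> \<in> {0..t}")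
      case True
      have "norm (mexp A (t - \<tau>) (B *v v \<tau>)) \<le> exp (\<bar>t - \<tau>\<bar> * norm A) * norm (B *v v \<tau>)"
        by (rule norm_mexp_le)
      also have "\<dots> \<le> exp (T * M) * (M * c)"
      proof (intro mult_mono)
        have "\<bar>t - \<tau>\<bar> * norm A \<le> T * M" using True t A by (intro mult_mono) auto
        then show "exp (\<bar>t - \<tau>\<bar> * norm A) \<le> exp (T * M)" by simp
        show "norm (B *v v \<tau>) \<le> M * c"
          using B v(2)[of \<tau>] \<open>M \<ge> 0\<close> by (intro order_trans[OF norm_matrix_vector_mult_le] mult_mono) auto
      qed auto
      finally show ?thesis using True t by simp
    qed (use \<open>c \<ge> 0\<close> \<open>M \<ge> 0\<close> in \<open>auto simp: indicator_def\<close>)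
  qed
  finally show ?thesis using t by (simp add: mult.commute)
qed

section \<open>Networks with bounded symbols\<close>

text \<open>The symbols are bounded at every point, not just almost everywhere.
  \<open>bounded_symbol_exists\<close> supplies such representatives, and exceptional sets are
  thereby kept out of the individual estimates.\<close>

locale bounded_network =
  fixes A :: "int^'v \<Rightarrow> real^'n^'n" and B :: "int^'v \<Rightarrow> real^'m^'n"
    and C :: "int^'v \<Rightarrow> real^'n^'r" and D :: "int^'v \<Rightarrow> real^'m^'r"
    and G :: "int^'v \<Rightarrow> real^'r^'m"
    and As :: "real^'v \<Rightarrow> complex^'n^'n" and Bs :: "real^'v \<Rightarrow> complex^'m^'n"
    and Cs :: "real^'v \<Rightarrow> complex^'n^'r" and Ds :: "real^'v \<Rightarrow> complex^'m^'r"
    and Gs :: "real^'v \<Rightarrow> complex^'r^'m" and M :: real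
  assumes symA: "is_symbol_of As A" and symB: "is_symbol_of Bs B"
    and symC: "is_symbol_of Cs C" and symD: "is_symbol_of Ds D"
    and symG: "is_symbol_of Gs G"
    and bA: "\<And>\<sigma>. norm (As \<sigma>) \<le> M" and bB: "\<And>\<sigma>. norm (Bs \<sigma>) \<le> M"
    and bC: "\<And>\<sigma>. norm (Cs \<sigma>) \<le> M" and bD: "\<And>\<sigma>. norm (Ds \<sigma>) \<le> M"
    and bG: "\<And>\<sigma>. norm (Gs \<sigma>) \<le> M"
begin

lemma M_nonneg: "M \<ge> 0"
  using bA[of 0] norm_ge_zero order_trans by blast

lemma symbols_measurable [measurable]:
  "As \<in> borel_measurable borel" "Bs \<in> borel_measurable borel" "Cs \<in> borel_measurable borel"
  "Ds \<in> borel_measurable borel" "Gs \<in> borel_measurable borel"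
  using symA symB symC symD symG by (simp_all add: is_symbol_of_def)

definition xhat :: "(int^'v) set \<Rightarrow> (real \<Rightarrow> int^'v \<Rightarrow> real^'m) \<Rightarrow> real \<Rightarrow> real^'v \<Rightarrow> complex^'n" where
  "xhat F u t \<sigma> = resp (As \<sigma>) (Bs \<sigma>) (\<lambda>\<tau>. uhat F u \<tau> \<sigma>) t"

definition yhat :: "(int^'v) set \<Rightarrow> (real \<Rightarrow> int^'v \<Rightarrow> real^'m) \<Rightarrow> real \<Rightarrow> real^'v \<Rightarrow> complex^'r" where
  "yhat F u t \<sigma> = Cs \<sigma> *v xhat F u t \<sigma> + Ds \<sigma> *v uhat F u t \<sigma>"

context
  fixes F c and w :: "real \<Rightarrow> int^'v \<Rightarrow> real^'m"
  assumes w: "simple_input F c w"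
begin

lemma c_nonneg: "c \<ge> 0"
proof -
  have "norm (w 0 0) \<le> c" using w by (simp add: simple_input_def)
  then show ?thesis using norm_ge_zero order_trans by blast
qed

lemma xhat_measurable [measurable]:
  assumes [measurable]: "f \<in> borel_measurable N" "g \<in> borel_measurable N"
  shows "(\<lambda>x. xhat F w (f x) (g x)) \<in> borel_measurable N"
  unfolding xhat_def
proof (rule borel_measurable_resp)
  show "(\<lambda>p. uhat F w (snd p) (g (fst p))) \<in> borel_measurable (N \<Otimes>\<^sub>M borel)"
    by (rule borel_measurable_uhat[OF w]) measurable
qed measurable

lemma yhat_measurable [measurable]:
  assumes [measurable]: "f \<in> borel_measurable N" "g \<in> borel_measurable N"
  shows "(\<lambda>x. yhat F w (f x) (g x)) \<in> borel_measurable N"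
proof -
  have [measurable]: "(\<lambda>x. uhat F w (f x) (g x)) \<in> borel_measurable N"
    "(\<lambda>x. xhat F w (f x) (g x)) \<in> borel_measurable N"
    by (rule borel_measurable_uhat[OF w] xhat_measurable; measurable)+
  show ?thesis unfolding yhat_def by measurable
qed

lemma uhat_section_measurable: "(\<lambda>\<tau>. uhat F w \<tau> \<sigma>) \<in> borel_measurable borel" "uhat F w \<tau> \<in> borel_measurable borel"
  by (rule borel_measurable_uhat[OF w]; measurable)+

lemma xhat_bound:
  obtains K where "K \<ge> 0" "\<And>t \<sigma>. t \<le> T \<Longrightarrow> norm (xhat F w t \<sigma>) \<le> K"
proof
  let ?K = "\<bar>T\<bar> * (exp (\<bar>T\<bar> * M) * (M * (real (card F) * c)))"
  show K: "?K \<ge> 0" using M_nonneg c_nonneg by simp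
  show "norm (xhat F w t \<sigma>) \<le> ?K" if "t \<le> T" for t \<sigma>
  proof (cases "t \<ge> 0")
    case True
    show ?thesis unfolding xhat_def
      by (rule norm_resp_le[OF uhat_section_measurable(1) norm_uhat_le[OF w] True _ bA bB]) (use that in simp)
  next
    case False
    \<comment> \<open>For negative t the response integral runs over an empty interval.\<close>
    then have "xhat F w t \<sigma> = 0" by (simp add: xhat_def resp_def set_lebesgue_integral_def)
    then show ?thesis using K by simp
  qed
qed

lemma yhat_bound:
  obtains K where "K \<ge> 0" "\<And>t \<sigma>. t \<le> T \<Longrightarrow> norm (yhat F w t \<sigma>) \<le> K"
proof -
  obtain K where K: "K \<ge> 0" "\<And>t \<sigma>. t \<le> T \<Longrightarrow> norm (xhat F w t \<sigma>) \<le> K" using xhat_bound by blast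
  show ?thesis
  proof
    show "0 \<le> M * K + M * (real (card F) * c)" using K M_nonneg c_nonneg by simp
    show "norm (yhat F w t \<sigma>) \<le> M * K + M * (real (card F) * c)" if "t \<le> T" for t \<sigma>
      unfolding yhat_def using K(2)[OF that, of \<sigma>] bC[of \<sigma>] bD[of \<sigma>] norm_uhat_le[OF w, of t \<sigma>] M_nonneg
      by (intro norm_triangle_mono order_trans[OF norm_matrix_vector_mult_le] mult_mono) auto
  qed
qed

text \<open>\<open>net_state\<close> integrates over time on the lattice and \<open>xhat\<close>
  integrates over time at fixed \<sigma>; Fubini identifies the two, the integrand being bounded on
  [0, t] uniformly in \<sigma>. Time integrability on the lattice side is itself read off from the
  Fourier side.\<close>

lemma fourier_rep_net_state: "fourier_rep (net_state A B w t) (xhat F w t)"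
proof -
  let ?b = "\<lambda>\<tau> \<sigma>. Bs \<sigma> *v uhat F w \<tau> \<sigma>"
  have um: "uhat F w \<tau> \<in> borel_measurable borel" for \<tau> by (rule uhat_section_measurable)
  have bm: "?b \<tau> \<in> borel_measurable borel" for \<tau> using um by measurable
  have bb: "norm (?b \<tau> \<sigma>) \<le> M * (real (card F) * c)" for \<tau> \<sigma>
    using bB[of \<sigma>] norm_uhat_le[OF w, of \<tau> \<sigma>] M_nonneg
    by (intro order_trans[OF norm_matrix_vector_mult_le] mult_mono) auto
  have brep: "fourier_rep (toep B (w \<tau>)) (?b \<tau>)" for \<tau>
    by (rule fourier_rep_toep[OF symB bB um norm_uhat_le[OF w] fourier_rep_uhat[OF w]])
  have rep: "fourier_rep (semigroup A (t - \<tau>) (toep B (w \<tau>))) (\<lambda>\<sigma>. mexp (As \<sigma>) (t - \<tau>) (?b \<tau> \<sigma>))" for \<tau>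
    by (rule fourier_rep_semigroup[OF symA bA bm bb brep])
  show ?thesis
    unfolding fourier_rep_def
  proof (intro allI)
    fix j i
    define h where "h i \<tau> \<sigma> = cis (fdot j \<sigma>) * mexp (As \<sigma>) (t - \<tau>) (?b \<tau> \<sigma>) $ i" for i \<tau> \<sigma>
    define s where "s \<tau> = semigroup A (t - \<tau>) (toep B (w \<tau>)) j" for \<tau>
    have [measurable]: "(\<lambda>p. uhat F w (fst p) (snd p)) \<in> borel_measurable (borel \<Otimes>\<^sub>M borel)"
      by (rule borel_measurable_uhat[OF w]) auto
    have hm: "(\<lambda>p. h i (fst p) (snd p)) \<in> borel_measurable (borel \<Otimes>\<^sub>M borel)" for i
      unfolding h_def by measurable
    define K where "K = exp (\<bar>t\<bar> * M) * (M * (real (card F) * c))"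
    have hK: "norm (h i \<tau> \<sigma>) \<le> K" if "\<tau> \<in> {0..t}" for \<tau> \<sigma> i
    proof -
      have "norm (h i \<tau> \<sigma>) \<le> norm (mexp (As \<sigma>) (t - \<tau>) (?b \<tau> \<sigma>))"
        by (simp add: h_def norm_mult Finite_Cartesian_Product.norm_nth_le)
      also have "\<dots> \<le> exp (\<bar>t - \<tau>\<bar> * norm (As \<sigma>)) * norm (?b \<tau> \<sigma>)" by (rule norm_mexp_le)
      also have "\<dots> \<le> K"
        unfolding K_def
      proof (intro mult_mono bb)
        have "\<bar>t - \<tau>\<bar> * norm (As \<sigma>) \<le> \<bar>t\<bar> * M" using that bA[of \<sigma>] by (intro mult_mono) auto
        then show "exp (\<bar>t - \<tau>\<bar> * norm (As \<sigma>)) \<le> exp (\<bar>t\<bar> * M)" by simp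
      qed auto
      finally show ?thesis .
    qed
    have sh: "complex_of_real (s \<tau> $ i) = (LINT \<sigma>|tmeas. h i \<tau> \<sigma>)" for \<tau> i
      using rep[of \<tau>] by (simp add: fourier_rep_def s_def h_def)
    have int: "integrable lborel (\<lambda>\<tau>. indicator {0..t} \<tau> *\<^sub>R s \<tau>)"
    proof (rule integrable_vecI)
      fix i
      interpret LT: pair_sigma_finite lborel "tmeas :: (real^'v) measure" ..
      have "integrable lborel (\<lambda>\<tau>. LINT \<sigma>|tmeas. indicator {0..t} \<tau> *\<^sub>R h i \<tau> \<sigma>)"
        using LT.integrable_fst[OF integrable_time_torus[OF hm hK]] by simp
      then have "integrable lborel (\<lambda>\<tau>. indicator {0..t} \<tau> *\<^sub>R complex_of_real (s \<tau> $ i))"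
        by (simp add: sh)
      from integrable_Re[OF this] show "integrable lborel (\<lambda>\<tau>. (indicator {0..t} \<tau> *\<^sub>R s \<tau>) $ i)"
        by simp
    qed
    have "complex_of_real (net_state A B w t j $ i) = complex_of_real (LINT \<tau>|lborel. (indicator {0..t} \<tau> *\<^sub>R s \<tau>) $ i)"
      unfolding net_state_def set_lebesgue_integral_def s_def[symmetric] integral_vec_nth[OF int] ..
    also have "\<dots> = (LINT \<tau>:{0..t}|lborel. complex_of_real (s \<tau> $ i))"
      unfolding set_lebesgue_integral_def integral_complex_of_real[symmetric] vector_scaleR_component
      by (simp add: scaleR_conv_of_real)
    also have "\<dots> = (LINT \<tau>:{0..t}|lborel. (LINT \<sigma>|tmeas. h i \<tau> \<sigma>))" by (simp add: sh)
    also have "\<dots> = (LINT \<sigma>|tmeas. (LINT \<tau>:{0..t}|lborel. h i \<tau> \<sigma>))"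
      by (rule fubini_time_torus[OF hm hK])
    also have "\<dots> = (LINT \<sigma>|tmeas. cis (fdot j \<sigma>) * xhat F w t \<sigma> $ i)"
    proof (intro Bochner_Integration.integral_cong refl)
      fix \<sigma>
      have "set_integrable lborel {0..t} (\<lambda>\<tau>. mexp (As \<sigma>) (t - \<tau>) (?b \<tau> \<sigma>))"
        by (rule resp_integrable[OF uhat_section_measurable(1) norm_uhat_le[OF w]])
      then have "xhat F w t \<sigma> $ i = (LINT \<tau>|lborel. (indicator {0..t} \<tau> *\<^sub>R mexp (As \<sigma>) (t - \<tau>) (?b \<tau> \<sigma>)) $ i)"
        unfolding xhat_def resp_def set_lebesgue_integral_def set_integrable_def by (rule integral_vec_nth)
      also have "cis (fdot j \<sigma>) * \<dots> = (LINT \<tau>|lborel. cis (fdot j \<sigma>) * (indicator {0..t} \<tau> *\<^sub>R mexp (As \<sigma>) (t - \<tau>) (?b \<tau> \<sigma>)) $ i)"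
        by (rule integral_mult_right_zero[symmetric])
      finally show "(LINT \<tau>:{0..t}|lborel. h i \<tau> \<sigma>) = cis (fdot j \<sigma>) * xhat F w t \<sigma> $ i"
        by (simp only: set_lebesgue_integral_def h_def vector_scaleR_component mult_scaleR_right)
    qed
    finally show "complex_of_real (net_state A B w t j $ i) = (LINT \<sigma>|tmeas. cis (fdot j \<sigma>) * xhat F w t \<sigma> $ i)" .
  qed
qed

lemma fourier_rep_net_output: "fourier_rep (net_output A B C D w t) (yhat F w t)"
proof -
  obtain K where K: "K \<ge> 0" "\<And>s \<sigma>. s \<le> t \<Longrightarrow> norm (xhat F w s \<sigma>) \<le> K" using xhat_bound by blast
  have um [measurable]: "uhat F w t \<in> borel_measurable borel" by (rule uhat_section_measurable)
  have xm [measurable]: "xhat F w t \<in> borel_measurable borel" by (rule xhat_measurable) auto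
  have "fourier_rep (\<lambda>j. toep C (net_state A B w t) j + toep D (w t) j) (\<lambda>\<sigma>. Cs \<sigma> *v xhat F w t \<sigma> + Ds \<sigma> *v uhat F w t \<sigma>)"
  proof (rule fourier_rep_add[of _ _ _ _ "M * K" "M * (real (card F) * c)"])
    show "fourier_rep (toep C (net_state A B w t)) (\<lambda>\<sigma>. Cs \<sigma> *v xhat F w t \<sigma>)"
      by (rule fourier_rep_toep[OF symC bC xm K(2) fourier_rep_net_state]) simp
    show "fourier_rep (toep D (w t)) (\<lambda>\<sigma>. Ds \<sigma> *v uhat F w t \<sigma>)"
      by (rule fourier_rep_toep[OF symD bD um norm_uhat_le[OF w] fourier_rep_uhat[OF w]])
    show "norm (Cs \<sigma> *v xhat F w t \<sigma>) \<le> M * K" for \<sigma>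
      using K(2)[of t \<sigma>] bC[of \<sigma>] M_nonneg by (intro order_trans[OF norm_matrix_vector_mult_le] mult_mono) auto
    show "norm (Ds \<sigma> *v uhat F w t \<sigma>) \<le> M * (real (card F) * c)" for \<sigma>
      using norm_uhat_le[OF w, of t \<sigma>] bD[of \<sigma>] M_nonneg by (intro order_trans[OF norm_matrix_vector_mult_le] mult_mono) auto
  qed measurable
  then show ?thesis by (simp add: net_output_def[abs_def] yhat_def[abs_def])
qed

lemma fourier_rep_toep_output: "fourier_rep (toep G (net_output A B C D w t)) (\<lambda>\<sigma>. Gs \<sigma> *v yhat F w t \<sigma>)"
proof -
  obtain K where K: "K \<ge> 0" "\<And>s \<sigma>. s \<le> t \<Longrightarrow> norm (yhat F w s \<sigma>) \<le> K" using yhat_bound by blast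
  show ?thesis
    by (rule fourier_rep_toep[OF symG bG _ K(2) fourier_rep_net_output]) (auto intro: yhat_measurable)
qed

text \<open>Two separate inputs u and w are kept, because the complex test inputs of the necessity
  proof produce mixed pairings. The form of the left side also records that every such pairing of
  real inputs is real after averaging over the torus.\<close>

lemma supply_pairing:
  assumes u: "simple_input F d u"
  shows "complex_of_real (LINT t:{0..T}|lborel. (\<Sum>j\<in>F. u t j \<bullet> toep G (net_output A B C D w t) j))
     = (LINT \<sigma>|tmeas. (LINT t:{0..T}|lborel. cdot (uhat F u t \<sigma>) (Gs \<sigma> *v yhat F w t \<sigma>)))"
proof -
  obtain K where K: "K \<ge> 0" "\<And>t \<sigma>. t \<le> T \<Longrightarrow> norm (yhat F w t \<sigma>) \<le> K" using yhat_bound by blast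
  have uh [measurable]: "(\<lambda>p. uhat F u (fst p) (snd p)) \<in> borel_measurable (borel \<Otimes>\<^sub>M borel)"
    by (rule borel_measurable_uhat[OF u]) auto
  have yh [measurable]: "(\<lambda>p. yhat F w (fst p) (snd p)) \<in> borel_measurable (borel \<Otimes>\<^sub>M borel)"
    by (rule yhat_measurable) auto
  have Yb: "norm (Gs \<sigma> *v yhat F w t \<sigma>) \<le> M * K" if "t \<le> T" for t \<sigma>
    using K(2)[OF that, of \<sigma>] bG[of \<sigma>] M_nonneg by (intro order_trans[OF norm_matrix_vector_mult_le] mult_mono) auto
  have pair: "complex_of_real (\<Sum>j\<in>F. u t j \<bullet> toep G (net_output A B C D w t) j)
      = (LINT \<sigma>|tmeas. cdot (uhat F u t \<sigma>) (Gs \<sigma> *v yhat F w t \<sigma>))" if t: "t \<in> {0..T}" for t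
  proof -
    have [measurable]: "yhat F w t \<in> borel_measurable borel" by (rule yhat_measurable) auto
    have ym: "(\<lambda>\<sigma>. (Gs \<sigma> *v yhat F w t \<sigma>) $ i) \<in> borel_measurable borel" for i by measurable
    have yb: "norm ((Gs \<sigma> *v yhat F w t \<sigma>) $ i) \<le> M * K" for i \<sigma>
      using t by (intro order_trans[OF Finite_Cartesian_Product.norm_nth_le Yb]) auto
    let ?s = "\<lambda>i \<sigma>. \<Sum>l\<in>F. cis (- fdot l \<sigma>) * complex_of_real (u t l $ i)"
    have "(LINT \<sigma>|tmeas. cdot (uhat F u t \<sigma>) (Gs \<sigma> *v yhat F w t \<sigma>))
       = (LINT \<sigma>|tmeas. (\<Sum>i\<in>UNIV. cnj (?s i \<sigma>) * (Gs \<sigma> *v yhat F w t \<sigma>) $ i))"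
      by (simp add: cdot_def uhat_def trig_def)
    also have "\<dots> = (\<Sum>i\<in>UNIV. LINT \<sigma>|tmeas. cnj (?s i \<sigma>) * (Gs \<sigma> *v yhat F w t \<sigma>) $ i)"
    proof (rule Bochner_Integration.integral_sum)
      fix i
      have [measurable]: "(\<lambda>\<sigma>. (Gs \<sigma> *v yhat F w t \<sigma>) $ i) \<in> borel_measurable borel" by (rule ym)
      have b: "norm (cnj (?s i \<sigma>)) \<le> (\<Sum>l\<in>F. norm (complex_of_real (u t l $ i)))" for \<sigma>
        unfolding complex_mod_cnj by (rule trig_scalar_bound)
      show "integrable tmeas (\<lambda>\<sigma>. cnj (?s i \<sigma>) * (Gs \<sigma> *v yhat F w t \<sigma>) $ i)"
      proof (rule tm_integrable)
        show "norm (cnj (?s i \<sigma>) * (Gs \<sigma> *v yhat F w t \<sigma>) $ i) \<le> (\<Sum>l\<in>F. norm (complex_of_real (u t l $ i))) * (M * K)" for \<sigma>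
          unfolding norm_mult by (intro mult_mono b yb sum_nonneg) auto
      qed measurable
    qed
    also have "\<dots> = (\<Sum>i\<in>UNIV. \<Sum>l\<in>F. cnj (complex_of_real (u t l $ i)) * (LINT \<sigma>|tmeas. cis (fdot l \<sigma>) * (Gs \<sigma> *v yhat F w t \<sigma>) $ i))"
      by (intro sum.cong refl trig_scalar_pairing[OF ym yb])
    also have "\<dots> = (\<Sum>i\<in>UNIV. \<Sum>l\<in>F. complex_of_real (u t l $ i * toep G (net_output A B C D w t) l $ i))"
      using fourier_rep_toep_output[of t] by (simp add: fourier_rep_def)
    also have "\<dots> = complex_of_real (\<Sum>j\<in>F. u t j \<bullet> toep G (net_output A B C D w t) j)"
      by (subst sum.swap) (simp add: inner_vec_def)
    finally show ?thesis ..
  qed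
  have "complex_of_real (LINT t:{0..T}|lborel. (\<Sum>j\<in>F. u t j \<bullet> toep G (net_output A B C D w t) j))
      = (LINT t:{0..T}|lborel. complex_of_real (\<Sum>j\<in>F. u t j \<bullet> toep G (net_output A B C D w t) j))"
    unfolding set_lebesgue_integral_def integral_complex_of_real[symmetric] by (simp add: scaleR_conv_of_real)
  also have "\<dots> = (LINT t:{0..T}|lborel. (LINT \<sigma>|tmeas. cdot (uhat F u t \<sigma>) (Gs \<sigma> *v yhat F w t \<sigma>)))"
    by (rule set_lebesgue_integral_cong) (auto simp: pair simp del: of_real_sum)
  also have "\<dots> = (LINT \<sigma>|tmeas. (LINT t:{0..T}|lborel. cdot (uhat F u t \<sigma>) (Gs \<sigma> *v yhat F w t \<sigma>)))"
  proof (rule fubini_time_torus)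
    show "(\<lambda>p. cdot (uhat F u (fst p) (snd p)) (Gs (snd p) *v yhat F w (fst p) (snd p))) \<in> borel_measurable (borel \<Otimes>\<^sub>M borel)"
      by measurable
    show "norm (cdot (uhat F u t \<sigma>) (Gs \<sigma> *v yhat F w t \<sigma>)) \<le> (real (card F) * d) * (M * K)" if "t \<in> {0..T}" for t \<sigma>
      using that norm_uhat_le[OF u, of t \<sigma>] Yb[of t \<sigma>] order_trans[OF norm_ge_zero norm_uhat_le[OF u, of t \<sigma>]]
      by (intro order_trans[OF norm_cdot_le] mult_mono) auto
  qed
  finally show ?thesis .
qed

lemma supply_rate_simple:
  assumes u: "simple_input F d u"
  shows "infsum (\<lambda>j. u t j \<bullet> toep G (net_output A B C D w t) j) UNIV = (\<Sum>j\<in>F. u t j \<bullet> toep G (net_output A B C D w t) j)"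
proof -
  have "infsum (\<lambda>j. u t j \<bullet> toep G (net_output A B C D w t) j) UNIV = infsum (\<lambda>j. u t j \<bullet> toep G (net_output A B C D w t) j) F"
    by (rule infsum_cong_neutral) (use u in \<open>auto simp: simple_input_def\<close>)
  then show ?thesis using u by (simp add: simple_input_def)
qed

end

end

section \<open>Trigonometric polynomials\<close>

definition trig_poly :: "(real^'v \<Rightarrow> complex) \<Rightarrow> bool" where
  "trig_poly p \<longleftrightarrow> (\<exists>F a. finite F \<and> p = (\<lambda>\<sigma>. \<Sum>l\<in>F. cis (- fdot l \<sigma>) * a l))"

lemma trig_poly_monomial: "trig_poly (\<lambda>\<sigma>. cis (- fdot l \<sigma>) * a)"
  unfolding trig_poly_def by (intro exI[of _ "{l}"] exI[of _ "\<lambda>_. a"]) simp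

lemma trig_poly_add:
  assumes "trig_poly p" "trig_poly q"
  shows "trig_poly (\<lambda>\<sigma>. p \<sigma> + q \<sigma>)"
proof -
  obtain F a where F: "finite F" "p = (\<lambda>\<sigma>. \<Sum>l\<in>F. cis (- fdot l \<sigma>) * a l)"
    using assms(1) unfolding trig_poly_def by blast
  obtain H b where H: "finite H" "q = (\<lambda>\<sigma>. \<Sum>l\<in>H. cis (- fdot l \<sigma>) * b l)"
    using assms(2) unfolding trig_poly_def by blast
  have ext: "(\<Sum>l\<in>S. cis (- fdot l \<sigma>) * e l) = (\<Sum>l\<in>F \<union> H. cis (- fdot l \<sigma>) * (if l \<in> S then e l else 0))"
    if "S \<subseteq> F \<union> H" for S e \<sigma>
    by (rule sum.mono_neutral_cong_left) (use that F H in auto)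
  have "(\<lambda>\<sigma>. p \<sigma> + q \<sigma>) = (\<lambda>\<sigma>. \<Sum>l\<in>F \<union> H. cis (- fdot l \<sigma>) * ((if l \<in> F then a l else 0) + (if l \<in> H then b l else 0)))"
    unfolding F(2) H(2) using ext[where S = F and e = a] ext[where S = H and e = b] by (simp only: Un_upper1 Un_upper2 distrib_left sum.distrib)
  then show ?thesis
    unfolding trig_poly_def
    by (intro exI[of _ "F \<union> H"] exI[of _ "\<lambda>l. (if l \<in> F then a l else 0) + (if l \<in> H then b l else 0)"])
       (simp only: F(1) H(1) finite_UnI simp_thms)
qed

lemma trig_poly_0: "trig_poly (\<lambda>\<sigma>. 0)"
  unfolding trig_poly_def by (intro exI[of _ "{}"]) simp

lemma trig_poly_sum: "(\<And>i. i \<in> I \<Longrightarrow> trig_poly (p i)) \<Longrightarrow> trig_poly (\<lambda>\<sigma>. \<Sum>i\<in>I. p i \<sigma>)"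
  by (induction I rule: infinite_finite_induct) (auto intro: trig_poly_add trig_poly_0)

lemma trig_poly_mult:
  assumes "trig_poly p" "trig_poly q"
  shows "trig_poly (\<lambda>\<sigma>. p \<sigma> * q \<sigma>)"
proof -
  obtain F a where F: "finite F" "p = (\<lambda>\<sigma>. \<Sum>l\<in>F. cis (- fdot l \<sigma>) * a l)"
    using assms(1) unfolding trig_poly_def by blast
  obtain H b where H: "finite H" "q = (\<lambda>\<sigma>. \<Sum>l\<in>H. cis (- fdot l \<sigma>) * b l)"
    using assms(2) unfolding trig_poly_def by blast
  have e: "cis (- fdot (l + k) \<sigma>) = cis (- fdot l \<sigma>) * cis (- fdot k \<sigma>)" for l k \<sigma>
    by (simp add: fdot_simps cis_mult)
  have "p \<sigma> * q \<sigma> = (\<Sum>l\<in>F. \<Sum>k\<in>H. cis (- fdot (l + k) \<sigma>) * (a l * b k))" for \<sigma>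
    unfolding F(2) H(2) sum_product
    by (intro sum.cong refl) (simp only: e mult_ac)
  then show ?thesis by (simp only: trig_poly_sum trig_poly_monomial)
qed

lemma trig_poly_const: "trig_poly (\<lambda>\<sigma>. a)"
  using trig_poly_monomial[of 0 a] by (simp add: fdot_simps)

lemma trig_poly_cos_sin:
  fixes i :: "'v::finite"
  shows "trig_poly (\<lambda>\<sigma>. complex_of_real (cos (\<sigma> $ i)))" "trig_poly (\<lambda>\<sigma>. complex_of_real (sin (\<sigma> $ i)))"
proof -
  have e: "fdot (axis i a) \<sigma> = real_of_int a * \<sigma> $ i" for a and \<sigma> :: "real^'v"
  proof -
    have "fdot (axis i a) \<sigma> = (\<Sum>k\<in>UNIV. if k = i then real_of_int a * \<sigma> $ i else 0)"
      unfolding fdot_def by (intro sum.cong) (auto simp: axis_def)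
    then show ?thesis by simp
  qed
  have c: "complex_of_real (cos (\<sigma> $ i)) = cis (- fdot (axis i 1) \<sigma>) * (1/2) + cis (- fdot (axis i (-1)) \<sigma>) * (1/2)" for \<sigma> :: "real^'v"
    by (simp add: e complex_eq_iff)
  have s: "complex_of_real (sin (\<sigma> $ i)) = cis (- fdot (axis i 1) \<sigma>) * (\<i>/2) + cis (- fdot (axis i (-1)) \<sigma>) * (-\<i>/2)" for \<sigma> :: "real^'v"
    by (simp add: e complex_eq_iff)
  show "trig_poly (\<lambda>\<sigma>. complex_of_real (cos (\<sigma> $ i)))" "trig_poly (\<lambda>\<sigma>. complex_of_real (sin (\<sigma> $ i)))"
    unfolding c s by (intro trig_poly_add trig_poly_monomial)+
qed

section \<open>Density of trigonometric polynomials by the Stone-Weierstrass theorem\<close>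

definition torus_emb :: "real^'v \<Rightarrow> complex^'v" where
  "torus_emb \<sigma> = (\<chi> i. cis (\<sigma> $ i))"

text \<open>The real coordinates of the embedded point are cosines and sines of the coordinates of
  \<sigma>, so linear functionals of it, and then all polynomials, are trigonometric
  polynomials.\<close>

lemma trig_poly_real_polynomial:
  assumes "real_polynomial_function g"
  shows "trig_poly (\<lambda>\<sigma>. complex_of_real (g (torus_emb \<sigma>)))"
  using assms
proof induction
  case (linear f)
  then have lin: "linear f" by (simp add: bounded_linear.linear)
  have "torus_emb \<sigma> = (\<Sum>i\<in>UNIV. cos (\<sigma> $ i) *\<^sub>R axis i 1 + sin (\<sigma> $ i) *\<^sub>R axis i \<i>)" for \<sigma> :: "real^'a"
  proof -
    have "axis i (cis x) = cos x *\<^sub>R axis i 1 + sin x *\<^sub>R (axis i \<i> :: complex^'a)" for i x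
      by (simp add: vec_eq_iff axis_def complex_eq_iff)
    moreover have "torus_emb \<sigma> = (\<Sum>i\<in>UNIV. axis i (cis (\<sigma> $ i)))"
      by (simp add: vec_eq_iff axis_def torus_emb_def if_distrib cong: if_cong)
    ultimately show ?thesis by simp
  qed
  then have "f (torus_emb \<sigma>) = (\<Sum>i\<in>UNIV. cos (\<sigma> $ i) * f (axis i 1) + sin (\<sigma> $ i) * f (axis i \<i>))" for \<sigma>
    by (simp add: linear_sum[OF lin] linear_add[OF lin] linear_scale[OF lin])
  then show ?case
    by (simp only: of_real_sum of_real_add of_real_mult)
       (intro trig_poly_sum trig_poly_add trig_poly_mult trig_poly_const trig_poly_cos_sin)
qed (simp_all add: trig_poly_const trig_poly_add trig_poly_mult)

text \<open>Compact replacement for the half-open torus. The embedding identifies opposite faces of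
  this box, which is why the functions approximated below vanish on the faces.\<close>

definition pi_box :: "(real^'v) set" where
  "pi_box = cbox (\<chi> i. - pi) (\<chi> i. pi)"

lemma mem_pi_box: "\<sigma> \<in> pi_box \<longleftrightarrow> (\<forall>i. \<bar>\<sigma> $ i\<bar> \<le> pi)"
  by (auto simp: pi_box_def mem_box_cart abs_le_iff) (meson minus_le_iff)+

lemma cis_inj_box:
  assumes "cis x = cis y" "\<bar>x\<bar> \<le> pi" "\<bar>y\<bar> \<le> pi"
  shows "x = y \<or> (\<bar>x\<bar> = pi \<and> \<bar>y\<bar> = pi)"
proof -
  have "sin x = sin y \<and> cos x = cos y" using assms(1) by (simp add: complex_eq_iff)
  then obtain n :: int where n: "x = y + 2 * pi * n" using sin_cos_eq_iff by (metis mult.commute mult.left_commute)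
  then have "\<bar>2 * pi * n\<bar> \<le> 2 * pi" using assms by linarith
  then have "\<bar>real_of_int n\<bar> \<le> 1" by (simp add: abs_mult)
  then have "n = 0 \<or> n = 1 \<or> n = -1" by linarith
  then show ?thesis using n assms by auto
qed

text \<open>Two points of the box with the same embedding are equal or both lie on faces, where f
  vanishes. So f factors through the embedding, and its factor \<open>g\<close> is approximated by
  polynomials on the compact image.\<close>

lemma trig_poly_uniform_approx:
  fixes f :: "real^'v \<Rightarrow> real"
  assumes f: "continuous_on UNIV f" and bd: "\<And>\<sigma> i. \<sigma> \<in> pi_box \<Longrightarrow> \<bar>\<sigma> $ i\<bar> = pi \<Longrightarrow> f \<sigma> = 0" and e: "e > 0"
  obtains p where "trig_poly p" "\<And>\<sigma>. \<sigma> \<in> pi_box \<Longrightarrow> norm (p \<sigma> - complex_of_real (f \<sigma>)) < e"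
proof -
  let ?B = "pi_box :: (real^'v) set"
  let ?K = "torus_emb ` ?B"
  have comp: "compact ?B" by (simp add: pi_box_def)
  have conte: "continuous_on S torus_emb" for S :: "(real^'v) set"
    unfolding torus_emb_def by (intro continuous_intros)
  have compK: "compact ?K" by (rule compact_continuous_image[OF conte comp])
  define g where "g z = f (SOME \<sigma>. \<sigma> \<in> ?B \<and> torus_emb \<sigma> = z)" for z
  have g: "g (torus_emb \<sigma>) = f \<sigma>" if \<sigma>: "\<sigma> \<in> ?B" for \<sigma>
  proof -
    define \<rho> where "\<rho> = (SOME \<rho>. \<rho> \<in> ?B \<and> torus_emb \<rho> = torus_emb \<sigma>)"
    have \<rho>: "\<rho> \<in> ?B" "torus_emb \<rho> = torus_emb \<sigma>"
      unfolding \<rho>_def using someI[of "\<lambda>\<rho>. \<rho> \<in> ?B \<and> torus_emb \<rho> = torus_emb \<sigma>" \<sigma>] \<sigma> by auto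
    have "f \<rho> = f \<sigma>"
    proof (cases "\<rho> = \<sigma>")
      case False
      then obtain i where i: "\<rho> $ i \<noteq> \<sigma> $ i" by (auto simp: vec_eq_iff)
      have "cis (\<rho> $ i) = cis (\<sigma> $ i)" using \<rho>(2) by (simp add: torus_emb_def vec_eq_iff)
      with i have "\<bar>\<rho> $ i\<bar> = pi \<and> \<bar>\<sigma> $ i\<bar> = pi"
        using cis_inj_box[of "\<rho> $ i" "\<sigma> $ i"] \<rho>(1) \<sigma> by (auto simp: mem_pi_box)
      then show ?thesis using bd \<rho>(1) \<sigma> by metis
    qed simp
    then show ?thesis by (simp add: g_def \<rho>_def)
  qed
  \<comment> \<open>Continuity is checked on closed sets: the preimage of a closed set under
    \<open>g\<close> is the image of a compact subset of the box, because the embedding of a compact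
    set is a closed map.\<close>
  have "continuous_on ?K g"
    unfolding continuous_on_closed_invariant
  proof (intro allI impI)
    fix S :: "real set" assume S: "closed S"
    have "closed (f -` S)" using f S by (simp add: continuous_on_closed_vimage[of UNIV f, simplified])
    then have "compact (?B \<inter> f -` S)" using comp by (rule compact_Int_closed[rotated])
    then have "closed (torus_emb ` (?B \<inter> f -` S))"
      by (intro compact_imp_closed compact_continuous_image conte)
    moreover have "torus_emb ` (?B \<inter> f -` S) \<inter> ?K = g -` S \<inter> ?K"
    proof (intro equalityI subsetI)
      fix z assume "z \<in> torus_emb ` (?B \<inter> f -` S) \<inter> ?K"
      then obtain x where "z = torus_emb x" "x \<in> ?B" "f x \<in> S" by blast
      then show "z \<in> g -` S \<inter> ?K" using g[of x] by auto
    next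
      fix z assume "z \<in> g -` S \<inter> ?K"
      then show "z \<in> torus_emb ` (?B \<inter> f -` S) \<inter> ?K" using g by auto
    qed
    ultimately show "\<exists>T. closed T \<and> T \<inter> ?K = g -` S \<inter> ?K" by blast
  qed
  from Stone_Weierstrass_real_polynomial_function[OF compK this e] obtain h where
    h: "real_polynomial_function h" "\<And>z. z \<in> ?K \<Longrightarrow> \<bar>g z - h z\<bar> < e" by blast
  show ?thesis
  proof (rule that[OF trig_poly_real_polynomial[OF h(1)]])
    fix \<sigma> assume "\<sigma> \<in> ?B"
    with h(2)[of "torus_emb \<sigma>"] g[of \<sigma>] have "\<bar>f \<sigma> - h (torus_emb \<sigma>)\<bar> < e" by auto
    then show "norm (complex_of_real (h (torus_emb \<sigma>)) - complex_of_real (f \<sigma>)) < e"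
      unfolding of_real_diff[symmetric] norm_of_real by (simp add: abs_minus_commute)
  qed
qed

section \<open>Positivity almost everywhere, tested with trigonometric polynomials\<close>

lemma AE_tmeas_interior: "AE \<sigma> in (tmeas :: (real^'v) measure). \<sigma> \<in> box (\<chi> i. - pi) (\<chi> i. pi)"
proof -
  let ?a = "\<chi> i. - pi :: real^'v" and ?b = "\<chi> i. pi :: real^'v"
  have "cbox ?a ?b - box ?a ?b \<in> null_sets lebesgue"
    using negligible_frontier_interval by (simp add: negligible_iff_null_sets)
  then have "cbox ?a ?b - box ?a ?b \<in> null_sets lborel"
    by (auto simp: null_sets_def emeasure_completion)
  then have "AE \<sigma> in lborel. \<sigma> \<notin> cbox ?a ?b - box ?a ?b" by (rule AE_not_in)
  then show ?thesis
    unfolding AE_tmeas by eventually_elim (auto simp: torus_def mem_box_cart less_imp_le)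
qed

lemma AE_tmeas_torus: "AE \<sigma> in (tmeas :: (real^'v) measure). \<sigma> \<in> torus"
  unfolding AE_tmeas by simp

lemma borel_measurable_trig_poly: "trig_poly p \<Longrightarrow> p \<in> borel_measurable borel"
  unfolding trig_poly_def by auto

text \<open>Nonnegativity against all squares of trigonometric polynomials passes, by uniform approximation,
  to squares of continuous bumps, then to indicators of compact sets.\<close>

lemma AE_nonneg_if_trig_nonneg:
  fixes q :: "real^'v \<Rightarrow> real"
  assumes qm [measurable]: "q \<in> borel_measurable borel" and k: "\<And>\<sigma>. \<bar>q \<sigma>\<bar> \<le> k"
    and pos: "\<And>p. trig_poly p \<Longrightarrow> 0 \<le> (LINT \<sigma>|tmeas. (norm (p \<sigma>))\<^sup>2 * q \<sigma>)"
  shows "AE \<sigma> in tmeas. 0 \<le> q \<sigma>"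
proof -
  have "k \<ge> 0" using k[of 0] abs_ge_zero order_trans by blast
  have cont_pos: "0 \<le> (LINT \<sigma>|tmeas. (f \<sigma>)\<^sup>2 * q \<sigma>)"
    if f: "continuous_on UNIV f" "\<And>\<sigma> i. \<sigma> \<in> pi_box \<Longrightarrow> \<bar>\<sigma> $ i\<bar> = pi \<Longrightarrow> f \<sigma> = 0"
      and b: "\<And>\<sigma>. \<bar>f \<sigma>\<bar> \<le> 1" for f
  proof -
    have "\<exists>p. trig_poly p \<and> (\<forall>\<sigma>\<in>pi_box. norm (p \<sigma> - complex_of_real (f \<sigma>)) < 1 / real (Suc n))" for n
    proof -
      obtain p where "trig_poly p" "\<And>\<sigma>. \<sigma> \<in> pi_box \<Longrightarrow> norm (p \<sigma> - complex_of_real (f \<sigma>)) < 1 / real (Suc n)"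
        by (rule trig_poly_uniform_approx[OF f, where e = "1 / real (Suc n)"]) auto
      then show ?thesis by blast
    qed
    then obtain p where p: "\<And>n. trig_poly (p n)"
      "\<And>n \<sigma>. \<sigma> \<in> pi_box \<Longrightarrow> norm (p n \<sigma> - complex_of_real (f \<sigma>)) < 1 / real (Suc n)" by metis
    have [measurable]: "f \<in> borel_measurable borel" "p n \<in> borel_measurable borel" for n
      using f(1) p(1) by (simp_all add: borel_measurable_continuous_onI borel_measurable_trig_poly)
    have inbox: "AE \<sigma> in (tmeas :: (real^'v) measure). \<sigma> \<in> pi_box"
      using AE_tmeas_torus by eventually_elim (auto simp: torus_def mem_pi_box abs_le_iff less_imp_le minus_le_iff)
    have "(\<lambda>n. LINT \<sigma>|tmeas. (norm (p n \<sigma>))\<^sup>2 * q \<sigma>) \<longlonglongrightarrow> (LINT \<sigma>|tmeas. (norm (complex_of_real (f \<sigma>)))\<^sup>2 * q \<sigma>)"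
    \<comment> \<open>The approximation error is at most 1 and so is the modulus of f; hence the
      approximants are bounded by 2.\<close>
    proof (rule integral_dominated_convergence[where w = "\<lambda>_. 2\<^sup>2 * k"])
      show "AE \<sigma> in tmeas. (\<lambda>n. (norm (p n \<sigma>))\<^sup>2 * q \<sigma>) \<longlonglongrightarrow> (norm (complex_of_real (f \<sigma>)))\<^sup>2 * q \<sigma>"
        using inbox
      proof eventually_elim
        case (elim \<sigma>)
        have lim: "(\<lambda>n. 1 / real (Suc n)) \<longlonglongrightarrow> 0" by real_asymp
        have "(\<lambda>n. p n \<sigma>) \<longlonglongrightarrow> complex_of_real (f \<sigma>)"
          by (rule LIM_zero_cancel, rule Lim_null_comparison[OF _ lim])
             (use p(2)[OF elim] in \<open>auto intro!: always_eventually less_imp_le\<close>)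
        then show ?case by (intro tendsto_intros)
      qed
      show "AE \<sigma> in tmeas. norm ((norm (p n \<sigma>))\<^sup>2 * q \<sigma>) \<le> 2\<^sup>2 * k" for n
        using inbox
      proof eventually_elim
        case (elim \<sigma>)
        have "norm (p n \<sigma>) \<le> norm (p n \<sigma> - complex_of_real (f \<sigma>)) + norm (complex_of_real (f \<sigma>))" by norm
        also have "\<dots> \<le> 1 / real (Suc n) + 1" using p(2)[OF elim, of n] b[of \<sigma>] by simp
        also have "\<dots> \<le> 2" by simp
        finally have "(norm (p n \<sigma>))\<^sup>2 \<le> 2\<^sup>2" by (intro power_mono) auto
        then show ?case unfolding norm_mult using k[of \<sigma>] by (intro mult_mono) auto
      qed
    qed auto
    then have "0 \<le> (LINT \<sigma>|tmeas. (norm (complex_of_real (f \<sigma>)))\<^sup>2 * q \<sigma>)"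
      by (rule LIMSEQ_le_const) (use pos[OF p(1)] in blast)
    then show ?thesis by simp
  qed
  have comp_pos: "0 \<le> (LINT \<sigma>|tmeas. indicator K \<sigma> * q \<sigma>)"
    if K: "compact K" "K \<subseteq> box (\<chi> i. - pi) (\<chi> i. pi)" "K \<noteq> {}" for K
  proof -
    have cl: "closed K" using K by (simp add: compact_imp_closed)
    have [measurable]: "K \<in> sets borel" using cl by simp
    obtain \<epsilon> where \<epsilon>: "\<epsilon> > 0" "(\<Union>x\<in>K. ball x \<epsilon>) \<subseteq> box (\<chi> i. - pi) (\<chi> i. pi)"
      using compact_subset_open_imp_ball_epsilon_subset[OF K(1) open_box K(2)] by blast
    \<comment> \<open>The slope \<open>1 / \<epsilon> + real n\<close> keeps \<open>f n\<close> zero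
      outside the \<epsilon>-neighbourhood of K, hence on the faces of the box, already for n = 0.
      As n grows the bumps shrink to the indicator of K.\<close>
    define f where "f n \<sigma> = max 0 (1 - (1 / \<epsilon> + real n) * infdist \<sigma> K)" for n \<sigma>
    have fc: "continuous_on UNIV (f n)" for n
      unfolding f_def by (intro continuous_intros)
    have [measurable]: "f n \<in> borel_measurable borel" for n
      using fc by (rule borel_measurable_continuous_onI)
    have f01: "0 \<le> f n \<sigma>" "f n \<sigma> \<le> 1" for n \<sigma>
      using \<epsilon> by (auto simp: f_def infdist_nonneg)
    have f0: "f n \<sigma> = 0" if \<sigma>: "\<bar>\<sigma> $ i\<bar> = pi" for n \<sigma> i
    proof (rule ccontr)
      assume "f n \<sigma> \<noteq> 0"
      then have lt: "(1 / \<epsilon> + real n) * infdist \<sigma> K < 1" by (auto simp: f_def max_def split: if_splits)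
      have "(1 / \<epsilon>) * infdist \<sigma> K \<le> (1 / \<epsilon> + real n) * infdist \<sigma> K"
        by (intro mult_right_mono) (auto simp: infdist_nonneg)
      with lt have "(1 / \<epsilon>) * infdist \<sigma> K < 1" by linarith
      then have "infdist \<sigma> K < \<epsilon>" using \<epsilon>(1) by (simp add: field_simps)
      moreover obtain x where "x \<in> K" "infdist \<sigma> K = dist \<sigma> x"
        using infdist_attains_inf[OF cl K(3)] by blast
      ultimately have "\<sigma> \<in> (\<Union>x\<in>K. ball x \<epsilon>)" by (auto simp: dist_commute)
      then have "\<sigma> \<in> box (\<chi> i. - pi) (\<chi> i. pi)" using \<epsilon>(2) by blast
      then have "- pi < \<sigma> $ i" "\<sigma> $ i < pi" by (auto simp: mem_box_cart)
      with \<sigma> show False by linarith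
    qed
    have "(\<lambda>n. LINT \<sigma>|tmeas. (f n \<sigma>)\<^sup>2 * q \<sigma>) \<longlonglongrightarrow> (LINT \<sigma>|tmeas. indicator K \<sigma> * q \<sigma>)"
    proof (rule integral_dominated_convergence[where w = "\<lambda>_. k"])
      show "AE \<sigma> in tmeas. (\<lambda>n. (f n \<sigma>)\<^sup>2 * q \<sigma>) \<longlonglongrightarrow> indicator K \<sigma> * q \<sigma>"
      proof (rule AE_I2)
        fix \<sigma>
        have "(\<lambda>n. f n \<sigma>) \<longlonglongrightarrow> indicator K \<sigma>"
        proof (cases "\<sigma> \<in> K")
          case True
          then show ?thesis by (simp add: f_def)
        next
          case False
          then have d: "infdist \<sigma> K > 0"
            using in_closed_iff_infdist_zero[OF cl K(3)] infdist_nonneg[of \<sigma> K] False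
            by (simp add: less_le)
          have "\<forall>\<^sub>F n in sequentially. 1 / infdist \<sigma> K < real n"
            by real_asymp
          then have "\<forall>\<^sub>F n in sequentially. f n \<sigma> = indicator K \<sigma>"
          proof eventually_elim
            case (elim n)
            then have "1 < real n * infdist \<sigma> K" using d by (simp add: field_simps)
            moreover have "real n * infdist \<sigma> K \<le> (1 / \<epsilon> + real n) * infdist \<sigma> K"
              using d \<epsilon> by (intro mult_right_mono) auto
            ultimately show ?case using False by (simp add: f_def)
          qed
          then show ?thesis by (rule tendsto_eventually)
        qed
        then have "(\<lambda>n. (f n \<sigma>)\<^sup>2 * q \<sigma>) \<longlonglongrightarrow> (indicator K \<sigma>)\<^sup>2 * q \<sigma>" by (intro tendsto_intros)
        then show "(\<lambda>n. (f n \<sigma>)\<^sup>2 * q \<sigma>) \<longlonglongrightarrow> indicator K \<sigma> * q \<sigma>"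
          by (cases "\<sigma> \<in> K") simp_all
      qed
      show "AE \<sigma> in tmeas. norm ((f n \<sigma>)\<^sup>2 * q \<sigma>) \<le> k" for n
      proof (rule AE_I2)
        fix \<sigma>
        have "norm ((f n \<sigma>)\<^sup>2 * q \<sigma>) \<le> 1 * k"
          unfolding norm_mult using k[of \<sigma>] f01[of n \<sigma>] by (intro mult_mono) (auto simp: power_le_one)
        then show "norm ((f n \<sigma>)\<^sup>2 * q \<sigma>) \<le> k" by simp
      qed
    qed auto
    then show ?thesis
    proof (rule LIMSEQ_le_const, intro exI[of _ 0] allI impI cont_pos[OF fc])
      show "\<bar>f n \<sigma>\<bar> \<le> 1" for n \<sigma> using f01[of n \<sigma>] by simp
    qed (use f0 in blast)
  qed
  \<comment> \<open>Intersecting with the open box keeps compact subsets away from the faces, as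
    \<open>comp_pos\<close> requires. If S had positive measure, inner regularity would give a
    compact K of positive measure on which q is negative, while the integral of q over K is
    nonnegative.\<close>
  define S where "S = box (\<chi> i. - pi) (\<chi> i. pi) \<inter> {\<sigma>. q \<sigma> < 0}"
  have [measurable]: "S \<in> sets borel" unfolding S_def by measurable
  have "emeasure tmeas S = 0"
  proof (rule ccontr)
    assume "emeasure tmeas S \<noteq> 0"
    then have "0 < emeasure tmeas S" by (simp add: zero_less_iff_neq_zero)
    also have "emeasure tmeas S = (SUP K \<in> {K. K \<subseteq> S \<and> compact K}. emeasure tmeas K)"
      by (rule inner_regular) (auto simp: tm.emeasure_space_1[simplified])
    finally obtain K where K: "K \<subseteq> S" "compact K" "0 < emeasure tmeas K"
      by (auto simp: less_SUP_iff)
    have [measurable]: "K \<in> sets borel" using K(2) by (simp add: borel_compact)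
    have "K \<noteq> {}" using K(3) by auto
    have K0: "0 \<le> (LINT \<sigma>|tmeas. indicator K \<sigma> * q \<sigma>)"
      by (rule comp_pos) (use K \<open>K \<noteq> {}\<close> in \<open>auto simp: S_def\<close>)
    have int: "integrable tmeas (\<lambda>\<sigma>. - (indicator K \<sigma> * q \<sigma>))"
      by (rule tm_integrable[of _ k]) (use k \<open>k \<ge> 0\<close> in \<open>auto simp: indicator_def\<close>)
    have nn: "AE \<sigma> in tmeas. 0 \<le> - (indicator K \<sigma> * q \<sigma>)"
      using K(1) by (intro AE_I2) (auto simp: indicator_def S_def less_imp_le)
    have "(LINT \<sigma>|tmeas. - (indicator K \<sigma> * q \<sigma>)) = 0"
      using integral_nonneg_AE[OF nn] K0 by simp
    then have "AE \<sigma> in tmeas. - (indicator K \<sigma> * q \<sigma>) = 0"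
      using integral_nonneg_eq_0_iff_AE[OF int nn] by simp
    then have "AE \<sigma> in tmeas. \<sigma> \<notin> K"
      by eventually_elim (use K(1) in \<open>auto simp: S_def indicator_def split: if_splits\<close>)
    then have "emeasure tmeas K = 0"
      by (subst (asm) AE_iff_measurable[where N = K]) auto
    with K(3) show False by simp
  qed
  then have "AE \<sigma> in tmeas. \<sigma> \<notin> S"
    by (intro AE_not_in) (auto simp: null_sets_def)
  with AE_tmeas_interior show ?thesis
    by eventually_elim (auto simp: S_def not_less)
qed

section \<open>Linearity of the response and admissibility of simple inputs\<close>

lemma set_integral_bounded:
  fixes f :: "real \<Rightarrow> 'a::{banach, second_countable_topology}"
  assumes m: "f \<in> borel_measurable borel" and k: "\<And>t. t \<in> {0..T} \<Longrightarrow> norm (f t) \<le> k" and T: "T \<ge> 0"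
  shows "set_integrable lborel {0..T} f" "norm (LINT t:{0..T}|lborel. f t) \<le> T * k"
proof -
  show int: "set_integrable lborel {0..T} f"
    unfolding set_integrable_def
    by (rule integrableI_bounded_set_indicator[where B = k]) (use m k in \<open>auto simp: emeasure_lborel_Icc_eq\<close>)
  have "norm (LINT t:{0..T}|lborel. f t) \<le> (LINT t|lborel. norm (indicator {0..T} t *\<^sub>R f t))"
    unfolding set_lebesgue_integral_def by (rule integral_norm_bound)
  also have "\<dots> \<le> (LINT t|lborel. k * indicator {0..T} t)"
    using int unfolding set_integrable_def
    by (intro integral_mono integrable_norm integrable_indicator_Icc) (use k in \<open>auto simp: indicator_def\<close>)
  finally show "norm (LINT t:{0..T}|lborel. f t) \<le> T * k" using T by (simp add: mult.commute)
qed

lemma resp_add: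
  fixes v w :: "real \<Rightarrow> complex^'m"
  assumes "v \<in> borel_measurable borel" "\<And>t. norm (v t) \<le> c" "w \<in> borel_measurable borel" "\<And>t. norm (w t) \<le> d"
  shows "resp A B (\<lambda>\<tau>. v \<tau> + w \<tau>) t = resp A B v t + resp A B w t"
  unfolding resp_def mv_simps mexp_linear_simps
  by (intro set_integral_add(2) resp_integrable[OF assms(1,2)] resp_integrable[OF assms(3,4)])

lemma resp_smult:
  fixes v :: "real \<Rightarrow> complex^'m"
  assumes "v \<in> borel_measurable borel" "\<And>t. norm (v t) \<le> c"
  shows "resp A B (\<lambda>\<tau>. a *s v \<tau>) t = a *s resp A B v t"
proof -
  have "resp A B (\<lambda>\<tau>. a *s v \<tau>) t = (LINT \<tau>|lborel. a *s (indicator {0..t} \<tau> *\<^sub>R mexp A (t - \<tau>) (B *v v \<tau>)))"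
    unfolding resp_def set_lebesgue_integral_def
    by (simp add: matrix_vector_mult_smult mexp_smult scaleR_eq_smult_complex mult.commute)
  also have "\<dots> = a *s resp A B v t"
    unfolding resp_def set_lebesgue_integral_def
    by (rule integral_bounded_linear[OF bounded_bilinear.bounded_linear_right[OF bounded_bilinear_smult_vec]])
       (use resp_integrable[OF assms, of t A B] in \<open>simp add: set_integrable_def\<close>)
  finally show ?thesis .
qed

lemma simple_input_admissible:
  assumes u: "simple_input F c u"
  shows "admissible_input u"
  unfolding admissible_input_def
proof (intro conjI allI impI)
  show "(\<lambda>t. u t k) \<in> borel_measurable lborel" for k using u by (simp add: simple_input_def)
  fix T :: real assume T: "T > 0"
  have fin: "finite F" using u by (simp add: simple_input_def)
  have "(\<integral>\<^sup>+ k. ennreal ((norm (u t k))\<^sup>2) \<partial>count_space UNIV) \<le> ennreal (real (card F) * c\<^sup>2)" for t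
  proof -
    have "(\<integral>\<^sup>+ k. ennreal ((norm (u t k))\<^sup>2) \<partial>count_space UNIV) = (\<Sum>k\<in>F. ennreal ((norm (u t k))\<^sup>2))"
      by (rule nn_integral_count_space') (use u in \<open>auto simp: simple_input_def\<close>)
    also have "\<dots> = ennreal (\<Sum>k\<in>F. (norm (u t k))\<^sup>2)" by (rule sum_ennreal) simp
    also have "\<dots> \<le> ennreal (real (card F) * c\<^sup>2)"
      by (intro ennreal_leI sum_bounded_above power_mono) (use u in \<open>auto simp: simple_input_def\<close>)
    finally show ?thesis .
  qed
  then have "(\<integral>\<^sup>+ t\<in>{0..T}. (\<integral>\<^sup>+ k. ennreal ((norm (u t k))\<^sup>2) \<partial>count_space UNIV) \<partial>lborel)
      \<le> (\<integral>\<^sup>+ t\<in>{0..T}. ennreal (real (card F) * c\<^sup>2) \<partial>lborel)"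
    by (intro nn_integral_mono mult_right_mono) auto
  also have "\<dots> = ennreal (real (card F) * c\<^sup>2) * ennreal T"
    using T by (simp add: nn_integral_cmult_indicator)
  also have "\<dots> < \<infinity>" by (simp add: ennreal_mult_less_top)
  finally show "(\<integral>\<^sup>+ t\<in>{0..T}. (\<integral>\<^sup>+ k. ennreal ((norm (u t k))\<^sup>2) \<partial>count_space UNIV) \<partial>lborel) < \<infinity>" .
qed

text \<open>Splits a pairing of complexified vectors into pairings of their two parts. Where the
  mixed pairings are real, as they are after integration, the factor \<i> removes them from the real
  part.\<close>

lemma cdot_complex_combination:
  "cdot (a + \<i> *s b) (x + \<i> *s y) = cdot a x + cdot b y + \<i> * (cdot a y - cdot b x)"
  by (simp add: bounded_bilinear.add_left[OF bounded_bilinear_cdot] bounded_bilinear.add_right[OF bounded_bilinear_cdot]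
      cdot_smult algebra_simps)

lemma closed_dense_UNIV:
  assumes "closed X" "D \<subseteq> X" "\<And>U. open U \<Longrightarrow> U \<noteq> {} \<Longrightarrow> \<exists>d\<in>D. d \<in> U"
  shows "X = UNIV"
  using assms(2) assms(3)[of "- X"] assms(1) by (auto simp: open_Compl)

section \<open>Necessity\<close>

context bounded_network
begin

text \<open>Complex work over [0, T] of the system at fixed \<sigma> driven by e; the pointwise
  counterpart of the averaged pairing in \<open>supply_pairing\<close>.\<close>

definition qform :: "real^'v \<Rightarrow> real \<Rightarrow> (real \<Rightarrow> complex^'m) \<Rightarrow> complex" where
  "qform \<sigma> T e = (LINT t:{0..T}|lborel. cdot (e t) (Gs \<sigma> *v (Cs \<sigma> *v resp (As \<sigma>) (Bs \<sigma>) e t + Ds \<sigma> *v e t)))"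

lemma integrand_bound:
  assumes e: "e \<in> borel_measurable borel" "\<And>t. norm (e t) \<le> c" and t: "t \<in> {0..T}"
  shows "norm (cdot (e t) (Gs \<sigma> *v (Cs \<sigma> *v resp (As \<sigma>) (Bs \<sigma>) e t + Ds \<sigma> *v e t)))
    \<le> c * (M * (M * (T * (exp (T * M) * (M * c))) + M * c))"
proof -
  have "c \<ge> 0" using e(2)[of 0] norm_ge_zero order_trans by blast
  have "norm (resp (As \<sigma>) (Bs \<sigma>) e t) \<le> T * (exp (T * M) * (M * c))"
    using t by (intro norm_resp_le[OF e _ _ bA bB]) auto
  then show ?thesis
    using bG[of \<sigma>] bC[of \<sigma>] bD[of \<sigma>] e(2)[of t] M_nonneg \<open>c \<ge> 0\<close>
    by (intro order_trans[OF norm_cdot_le] mult_mono order_trans[OF norm_matrix_vector_mult_le] norm_triangle_mono) auto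
qed

lemma integrand_measurable:
  assumes [measurable]: "e \<in> borel_measurable borel"
  shows "(\<lambda>p. cdot (e (snd p)) (Gs (fst p) *v (Cs (fst p) *v resp (As (fst p)) (Bs (fst p)) e (snd p) + Ds (fst p) *v e (snd p))))
    \<in> borel_measurable (borel \<Otimes>\<^sub>M borel)"
proof -
  have [measurable]: "(\<lambda>p. resp (As (fst p)) (Bs (fst p)) e (snd p)) \<in> borel_measurable (borel \<Otimes>\<^sub>M borel)"
    by (rule borel_measurable_resp) measurable
  show ?thesis by measurable
qed

lemma qform_measurable:
  assumes e: "e \<in> borel_measurable borel"
  shows "(\<lambda>\<sigma>. qform \<sigma> T e) \<in> borel_measurable borel"
proof -
  have [measurable]: "(\<lambda>p. cdot (e (snd p)) (Gs (fst p) *v (Cs (fst p) *v resp (As (fst p)) (Bs (fst p)) e (snd p) + Ds (fst p) *v e (snd p))))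
    \<in> borel_measurable (borel \<Otimes>\<^sub>M lborel)"
    using integrand_measurable[OF e] by (simp cong: measurable_cong_sets)
  show ?thesis
    unfolding qform_def set_lebesgue_integral_def
    by (intro lborel.borel_measurable_lebesgue_integral) (simp add: split_beta')
qed

lemma pairing_integrable:
  assumes u: "simple_input F d u" and w: "simple_input F c w" and T: "T \<ge> 0"
  shows "integrable tmeas (\<lambda>\<sigma>. LINT t:{0..T}|lborel. cdot (uhat F u t \<sigma>) (Gs \<sigma> *v yhat F w t \<sigma>))"
    "set_integrable lborel {0..T} (\<lambda>t. cdot (uhat F u t \<sigma>) (Gs \<sigma> *v yhat F w t \<sigma>))"
proof -
  interpret LT: pair_sigma_finite lborel "tmeas :: (real^'v) measure" ..
  obtain K where K: "K \<ge> 0" "\<And>t \<sigma>. t \<le> T \<Longrightarrow> norm (yhat F w t \<sigma>) \<le> K" using yhat_bound[OF w] by blast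
  have m: "(\<lambda>p. cdot (uhat F u (fst p) (snd p)) (Gs (snd p) *v yhat F w (fst p) (snd p))) \<in> borel_measurable (borel \<Otimes>\<^sub>M borel)"
  proof -
    have [measurable]: "(\<lambda>p. uhat F u (fst p) (snd p)) \<in> borel_measurable (borel \<Otimes>\<^sub>M borel)"
      "(\<lambda>p. yhat F w (fst p) (snd p)) \<in> borel_measurable (borel \<Otimes>\<^sub>M borel)"
      by (rule borel_measurable_uhat[OF u] yhat_measurable[OF w]; measurable)+
    show ?thesis by measurable
  qed
  have b: "norm (cdot (uhat F u t \<sigma>) (Gs \<sigma> *v yhat F w t \<sigma>)) \<le> (real (card F) * d) * (M * K)" if "t \<in> {0..T}" for t \<sigma>
    using that norm_uhat_le[OF u, of t \<sigma>] K(2)[of t \<sigma>] bG[of \<sigma>] M_nonneg order_trans[OF norm_ge_zero norm_uhat_le[OF u, of t \<sigma>]]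
    by (intro order_trans[OF norm_cdot_le] mult_mono order_trans[OF norm_matrix_vector_mult_le]) auto
  show "integrable tmeas (\<lambda>\<sigma>. LINT t:{0..T}|lborel. cdot (uhat F u t \<sigma>) (Gs \<sigma> *v yhat F w t \<sigma>))"
    using LT.integrable_snd[OF integrable_time_torus[OF m b]] unfolding set_lebesgue_integral_def .
  have "(\<lambda>t. cdot (uhat F u t \<sigma>) (Gs \<sigma> *v yhat F w t \<sigma>)) \<in> borel_measurable borel"
  proof -
    have [measurable]: "(\<lambda>t. uhat F u t \<sigma>) \<in> borel_measurable borel" "(\<lambda>t. yhat F w t \<sigma>) \<in> borel_measurable borel"
      by (rule borel_measurable_uhat[OF u] yhat_measurable[OF w]; measurable)+
    show ?thesis by measurable
  qed
  then show "set_integrable lborel {0..T} (\<lambda>t. cdot (uhat F u t \<sigma>) (Gs \<sigma> *v yhat F w t \<sigma>))"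
    by (rule set_integral_bounded(1)[OF _ b T])
qed

lemma work_simple:
  assumes u: "simple_input F d u"
  shows "work G A B C D u T = (LINT t:{0..T}|lborel. (\<Sum>j\<in>F. u t j \<bullet> toep G (net_output A B C D u t) j))"
  unfolding work_def supply_rate_def by (simp add: supply_rate_simple[OF u u])

text \<open>Passivity is tested with the real and imaginary parts of a lattice input whose spatial
  transform is p(\<sigma>) times the oscillation. By linearity of the response the work at \<sigma>
  then carries the factor |p(\<sigma>)|^2, which is the weight in the hypothesis of
  \<open>AE_nonneg_if_trig_nonneg\<close>.\<close>

lemma passive_imp_qform_nonneg:
  assumes pas: "passive_net G A B C D" and T: "T > 0"
  shows "AE \<sigma> in tmeas. 0 \<le> Re (qform \<sigma> T (\<lambda>t. cis (\<omega> * t) *s \<eta>))"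
proof -
  define e where "e t = cis (\<omega> * t) *s \<eta>" for t
  have em [measurable]: "e \<in> borel_measurable borel" unfolding e_def[abs_def] by measurable
  have eb: "norm (e t) \<le> norm \<eta>" for t by (simp add: e_def norm_smult_vec)
  define k where "k = T * (norm \<eta> * (M * (M * (T * (exp (T * M) * (M * norm \<eta>))) + M * norm \<eta>)))"
  have qb: "norm (qform \<sigma> T e) \<le> k" for \<sigma>
    unfolding qform_def k_def
  proof (rule set_integral_bounded(2)[OF _ integrand_bound[OF em eb]])
    have [measurable]: "resp (As \<sigma>) (Bs \<sigma>) e \<in> borel_measurable borel"
      by (rule borel_measurable_resp) measurable
    show "(\<lambda>t. cdot (e t) (Gs \<sigma> *v (Cs \<sigma> *v resp (As \<sigma>) (Bs \<sigma>) e t + Ds \<sigma> *v e t))) \<in> borel_measurable borel"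
      by measurable
  qed (use T in auto)
  have qm: "(\<lambda>\<sigma>. qform \<sigma> T e) \<in> borel_measurable borel" by (rule qform_measurable[OF em])
  have "AE \<sigma> in tmeas. 0 \<le> Re (qform \<sigma> T e)"
  proof (rule AE_nonneg_if_trig_nonneg)
    show "(\<lambda>\<sigma>. Re (qform \<sigma> T e)) \<in> borel_measurable borel" using qm by measurable
    show "\<bar>Re (qform \<sigma> T e)\<bar> \<le> k" for \<sigma> using abs_Re_le_cmod qb order_trans by blast
    fix p :: "real^'v \<Rightarrow> complex" assume "trig_poly p"
    then obtain F a where F: "finite F" and p: "p = (\<lambda>\<sigma>. \<Sum>l\<in>F. cis (- fdot l \<sigma>) * a l)"
      unfolding trig_poly_def by blast
    define z where "z t l = (if l \<in> F then (cis (\<omega> * t) * a l) *s \<eta> else 0)" for t l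
    define c where "c = (\<Sum>l\<in>F. norm (a l)) * norm \<eta>"
    have zb: "norm (z t l) \<le> c" for t l
    proof (cases "l \<in> F")
      case True
      then have "norm (z t l) = norm (a l) * norm \<eta>" by (simp add: z_def norm_smult_vec norm_mult)
      also have "\<dots> \<le> c" unfolding c_def using True F by (intro mult_right_mono member_le_sum) auto
      finally show ?thesis .
    qed (simp add: z_def c_def sum_nonneg)
    \<comment> \<open>Real and imaginary parts are taken of the lattice coefficients, not of the
      transform: \<open>uhat F u1\<close> is in general not real. Only the combination in
      \<open>vc\<close> recovers the complex test input.\<close>
    define u1 where "u1 t l = (\<chi> b. Re (z t l $ b))" for t l
    define u2 where "u2 t l = (\<chi> b. Im (z t l $ b))" for t l
    have zm: "(\<lambda>t. z t l) \<in> borel_measurable borel" for l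
      unfolding z_def by (cases "l \<in> F") simp_all
    have simp1: "simple_input F c u1"
    proof -
      have "(\<lambda>z :: complex^'m. (\<chi> b. Re (z $ b)) :: real^'m) \<in> borel_measurable borel"
        by (intro borel_measurable_continuous_onI continuous_intros)
      from measurable_compose[OF zm this] have m: "(\<lambda>t. u1 t l) \<in> borel_measurable borel" for l
        unfolding u1_def .
      have "norm (u1 t l) \<le> norm (z t l)" for t l
        unfolding norm_vec_def by (intro L2_set_mono) (auto simp: u1_def abs_Re_le_cmod)
      then have "norm (u1 t l) \<le> c" for t l using zb order_trans by blast
      with m F show ?thesis by (auto simp: simple_input_def u1_def z_def vec_eq_iff)
    qed
    have simp2: "simple_input F c u2"
    proof -
      have "(\<lambda>z :: complex^'m. (\<chi> b. Im (z $ b)) :: real^'m) \<in> borel_measurable borel"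
        by (intro borel_measurable_continuous_onI continuous_intros)
      from measurable_compose[OF zm this] have m: "(\<lambda>t. u2 t l) \<in> borel_measurable borel" for l
        unfolding u2_def .
      have "norm (u2 t l) \<le> norm (z t l)" for t l
        unfolding norm_vec_def by (intro L2_set_mono) (auto simp: u2_def abs_Im_le_cmod)
      then have "norm (u2 t l) \<le> c" for t l using zb order_trans by blast
      with m F show ?thesis by (auto simp: simple_input_def u2_def z_def vec_eq_iff)
    qed
    note sm = borel_measurable_uhat[OF simp1] borel_measurable_uhat[OF simp2]
    have vc: "uhat F u1 t \<sigma> + \<i> *s uhat F u2 t \<sigma> = p \<sigma> *s e t" for t \<sigma>
    proof -
      have "cvec (u1 t l) + \<i> *s cvec (u2 t l) = z t l" for l
        by (simp add: vec_eq_iff u1_def u2_def complex_eq_iff)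
      moreover have "uhat F u1 t \<sigma> + \<i> *s uhat F u2 t \<sigma>
          = (\<Sum>l\<in>F. cis (- fdot l \<sigma>) *s (cvec (u1 t l) + \<i> *s cvec (u2 t l)))"
        unfolding uhat_def trig_def bounded_bilinear.sum_right[OF bounded_bilinear_smult_vec] sum.distrib[symmetric]
        by (intro sum.cong refl) (simp add: vec_eq_iff algebra_simps)
      ultimately have "uhat F u1 t \<sigma> + \<i> *s uhat F u2 t \<sigma> = (\<Sum>l\<in>F. cis (- fdot l \<sigma>) *s z t l)"
        by simp
      also have "\<dots> = p \<sigma> *s e t"
        by (simp add: p z_def e_def vec_eq_iff sum_distrib_left sum_distrib_right mult_ac)
      finally show ?thesis .
    qed
    have yc: "yhat F u1 t \<sigma> + \<i> *s yhat F u2 t \<sigma> = p \<sigma> *s (Cs \<sigma> *v resp (As \<sigma>) (Bs \<sigma>) e t + Ds \<sigma> *v e t)" for t \<sigma>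
    proof -
      have m: "(\<lambda>\<tau>. uhat F u1 \<tau> \<sigma>) \<in> borel_measurable borel" "(\<lambda>\<tau>. uhat F u2 \<tau> \<sigma>) \<in> borel_measurable borel"
        by (rule sm; measurable)+
      have m2: "(\<lambda>\<tau>. \<i> *s uhat F u2 \<tau> \<sigma>) \<in> borel_measurable borel" using m(2) by measurable
      have m3: "norm (\<i> *s uhat F u2 \<tau> \<sigma>) \<le> real (card F) * c" for \<tau>
        by (simp add: norm_smult_vec norm_uhat_le[OF simp2])
      have "xhat F u1 t \<sigma> + \<i> *s xhat F u2 t \<sigma> = resp (As \<sigma>) (Bs \<sigma>) (\<lambda>\<tau>. uhat F u1 \<tau> \<sigma> + \<i> *s uhat F u2 \<tau> \<sigma>) t"
        unfolding xhat_def resp_smult[OF m(2) norm_uhat_le[OF simp2], symmetric]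
        by (rule resp_add[symmetric, OF m(1) norm_uhat_le[OF simp1] m2 m3])
      also have "\<dots> = p \<sigma> *s resp (As \<sigma>) (Bs \<sigma>) e t"
        unfolding vc by (rule resp_smult[OF em eb])
      finally have x: "xhat F u1 t \<sigma> + \<i> *s xhat F u2 t \<sigma> = p \<sigma> *s resp (As \<sigma>) (Bs \<sigma>) e t" .
      have "yhat F u1 t \<sigma> + \<i> *s yhat F u2 t \<sigma>
         = Cs \<sigma> *v (xhat F u1 t \<sigma> + \<i> *s xhat F u2 t \<sigma>) + Ds \<sigma> *v (uhat F u1 t \<sigma> + \<i> *s uhat F u2 t \<sigma>)"
        by (simp add: yhat_def mv_simps matrix_vector_mult_smult vector_add_ldistrib)
      then show ?thesis unfolding x vc by (simp add: matrix_vector_mult_smult vector_add_ldistrib)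
    qed
    define X where "X u w \<sigma> = (LINT t:{0..T}|lborel. cdot (uhat F u t \<sigma>) (Gs \<sigma> *v yhat F w t \<sigma>))" for u w \<sigma>
    have Xi: "integrable tmeas (X u w)" if "simple_input F c u" "simple_input F c w" for u w
      unfolding X_def using T by (intro pairing_integrable(1)[OF that]) simp
    have Xr: "\<exists>r. (LINT \<sigma>|tmeas. X u w \<sigma>) = complex_of_real r" if "simple_input F c u" "simple_input F c w" for u w
      unfolding X_def using supply_pairing[OF that(2,1), of T] by metis
    have Xw: "0 \<le> Re (LINT \<sigma>|tmeas. X u u \<sigma>)" if u: "simple_input F c u" for u
    proof -
      have "0 \<le> work G A B C D u T"
        using pas T simple_input_admissible[OF u] unfolding passive_net_def by blast
      moreover have "(LINT \<sigma>|tmeas. X u u \<sigma>) = complex_of_real (work G A B C D u T)"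
        unfolding X_def work_simple[OF u] by (rule supply_pairing[OF u u, symmetric])
      ultimately show ?thesis by simp
    qed
    have pt: "complex_of_real ((norm (p \<sigma>))\<^sup>2) * qform \<sigma> T e = X u1 u1 \<sigma> + X u2 u2 \<sigma> + \<i> * (X u1 u2 \<sigma> - X u2 u1 \<sigma>)" for \<sigma>
    proof -
      have si: "set_integrable lborel {0..T} (\<lambda>t. cdot (uhat F u t \<sigma>) (Gs \<sigma> *v yhat F w t \<sigma>))"
        if "simple_input F c u" "simple_input F c w" for u w
        using T by (intro pairing_integrable(2)[OF that]) simp
      have "complex_of_real ((norm (p \<sigma>))\<^sup>2) * qform \<sigma> T e
         = (LINT t:{0..T}|lborel. complex_of_real ((norm (p \<sigma>))\<^sup>2) * cdot (e t) (Gs \<sigma> *v (Cs \<sigma> *v resp (As \<sigma>) (Bs \<sigma>) e t + Ds \<sigma> *v e t)))"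
        unfolding qform_def by simp
      also have "\<dots> = (LINT t:{0..T}|lborel. cdot (uhat F u1 t \<sigma>) (Gs \<sigma> *v yhat F u1 t \<sigma>) + cdot (uhat F u2 t \<sigma>) (Gs \<sigma> *v yhat F u2 t \<sigma>)
           + \<i> * (cdot (uhat F u1 t \<sigma>) (Gs \<sigma> *v yhat F u2 t \<sigma>) - cdot (uhat F u2 t \<sigma>) (Gs \<sigma> *v yhat F u1 t \<sigma>)))"
      proof (rule set_lebesgue_integral_cong; (intro allI impI)?)
        fix t
        have "complex_of_real ((norm (p \<sigma>))\<^sup>2) * cdot (e t) (Gs \<sigma> *v (Cs \<sigma> *v resp (As \<sigma>) (Bs \<sigma>) e t + Ds \<sigma> *v e t))
           = cdot (p \<sigma> *s e t) (Gs \<sigma> *v (p \<sigma> *s (Cs \<sigma> *v resp (As \<sigma>) (Bs \<sigma>) e t + Ds \<sigma> *v e t)))"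
          by (simp only: matrix_vector_mult_smult cdot_smult complex_norm_square mult_ac)
        also have "\<dots> = cdot (uhat F u1 t \<sigma> + \<i> *s uhat F u2 t \<sigma>) (Gs \<sigma> *v yhat F u1 t \<sigma> + \<i> *s (Gs \<sigma> *v yhat F u2 t \<sigma>))"
          unfolding vc[symmetric] yc[symmetric] mv_simps matrix_vector_mult_smult ..
        finally show "complex_of_real ((norm (p \<sigma>))\<^sup>2) * cdot (e t) (Gs \<sigma> *v (Cs \<sigma> *v resp (As \<sigma>) (Bs \<sigma>) e t + Ds \<sigma> *v e t))
           = cdot (uhat F u1 t \<sigma>) (Gs \<sigma> *v yhat F u1 t \<sigma>) + cdot (uhat F u2 t \<sigma>) (Gs \<sigma> *v yhat F u2 t \<sigma>)
           + \<i> * (cdot (uhat F u1 t \<sigma>) (Gs \<sigma> *v yhat F u2 t \<sigma>) - cdot (uhat F u2 t \<sigma>) (Gs \<sigma> *v yhat F u1 t \<sigma>))"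
          by (simp only: cdot_complex_combination)
      qed simp
      also have "\<dots> = X u1 u1 \<sigma> + X u2 u2 \<sigma> + \<i> * (X u1 u2 \<sigma> - X u2 u1 \<sigma>)"
        unfolding X_def
        by (simp add: si simp1 simp2 set_integral_add set_integral_diff)
      finally show ?thesis .
    qed
    \<comment> \<open>Both mixed integrals are real by \<open>supply_pairing\<close>, so \<i> times
      their difference has no real part.\<close>
    have I12: "Re (\<i> * ((LINT \<sigma>|tmeas. X u1 u2 \<sigma>) - (LINT \<sigma>|tmeas. X u2 u1 \<sigma>))) = 0"
      using Xr[OF simp1 simp2] Xr[OF simp2 simp1] by auto
    have intp: "integrable tmeas (\<lambda>\<sigma>. complex_of_real ((norm (p \<sigma>))\<^sup>2) * qform \<sigma> T e)"
      unfolding pt using Xi simp1 simp2 by simp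
    have "(LINT \<sigma>|tmeas. (norm (p \<sigma>))\<^sup>2 * Re (qform \<sigma> T e)) = (LINT \<sigma>|tmeas. Re (complex_of_real ((norm (p \<sigma>))\<^sup>2) * qform \<sigma> T e))"
      by simp
    also have "\<dots> = Re (LINT \<sigma>|tmeas. complex_of_real ((norm (p \<sigma>))\<^sup>2) * qform \<sigma> T e)"
      by (rule integral_Re[OF intp])
    also have "(LINT \<sigma>|tmeas. complex_of_real ((norm (p \<sigma>))\<^sup>2) * qform \<sigma> T e)
       = (LINT \<sigma>|tmeas. X u1 u1 \<sigma>) + (LINT \<sigma>|tmeas. X u2 u2 \<sigma>) + \<i> * ((LINT \<sigma>|tmeas. X u1 u2 \<sigma>) - (LINT \<sigma>|tmeas. X u2 u1 \<sigma>))"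
      unfolding pt using Xi simp1 simp2 by simp
    finally show "0 \<le> (LINT \<sigma>|tmeas. (norm (p \<sigma>))\<^sup>2 * Re (qform \<sigma> T e))"
      using Xw[OF simp1] Xw[OF simp2] I12 by simp
  qed
  then show ?thesis unfolding e_def .
qed

text \<open>The null set in \<open>passive_imp_qform_nonneg\<close> depends on the horizon, on
  \<omega> and on \<eta>. Integer horizons and countable dense sets of \<omega> and \<eta> share one
  null set. Off it the long-time limit gives positivity for the dense parameters, and continuity in
  \<omega>, then in \<eta>, gives the rest.\<close>

lemma passive_imp_transfer_nonneg_AE:
  assumes pas: "passive_net G A B C D"
  shows "AE \<sigma> in tmeas. hurwitz (As \<sigma>) \<longrightarrow>
     (\<forall>\<omega> \<eta>. 0 \<le> Re (cdot \<eta> (Gs \<sigma> *v (Cs \<sigma> *v resolv (As \<sigma>) \<omega> (Bs \<sigma> *v \<eta>) + Ds \<sigma> *v \<eta>))))"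
proof -
  obtain D1 :: "real set" where D1: "countable D1" "\<And>U. open U \<Longrightarrow> U \<noteq> {} \<Longrightarrow> \<exists>d\<in>D1. d \<in> U"
    by (rule countable_dense_setE) blast
  obtain D2 :: "(complex^'m) set" where D2: "countable D2" "\<And>U. open U \<Longrightarrow> U \<noteq> {} \<Longrightarrow> \<exists>d\<in>D2. d \<in> U"
    by (rule countable_dense_setE) blast
  have "AE \<sigma> in tmeas. \<forall>\<omega>\<in>D1. \<forall>\<eta>\<in>D2. \<forall>n\<in>{0<..}. 0 \<le> Re (qform \<sigma> (real n) (\<lambda>t. cis (\<omega> * t) *s \<eta>))"
    by (intro AE_ball_countable[THEN iffD2] ballI D1(1) D2(1) passive_imp_qform_nonneg[OF pas]) auto
  then show ?thesis
  proof eventually_elim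
    case (elim \<sigma>)
    show ?case
    proof (intro impI allI)
      assume hw: "hurwitz (As \<sigma>)"
      define f where "f \<omega> \<eta> = Re (cdot \<eta> (Gs \<sigma> *v (Cs \<sigma> *v resolv (As \<sigma>) \<omega> (Bs \<sigma> *v \<eta>) + Ds \<sigma> *v \<eta>)))" for \<omega> \<eta>
      have f1: "0 \<le> f \<omega> \<eta>" if "\<omega> \<in> D1" "\<eta> \<in> D2" for \<omega> \<eta>
        unfolding f_def
        by (rule passive_imp_transfer_nonneg[OF hw]) (use elim that in \<open>auto simp: qform_def\<close>)
      have f2: "0 \<le> f \<omega> \<eta>" if "\<eta> \<in> D2" for \<omega> \<eta>
      proof -
        have "{\<omega>. 0 \<le> f \<omega> \<eta>} = UNIV"
        proof (rule closed_dense_UNIV[OF _ _ D1(2)])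
          have "continuous_on UNIV (\<lambda>\<omega>. f \<omega> \<eta>)"
            unfolding f_def
            by (intro continuous_intros bounded_bilinear.continuous_on[OF bounded_bilinear_cdot]
                bounded_bilinear.continuous_on[OF bounded_bilinear_matrix_vector_mult] resolv_continuous[OF hw])
          then show "closed {\<omega>. 0 \<le> f \<omega> \<eta>}" by (intro closed_Collect_le continuous_intros)
        qed (use f1 that in auto)
        then show ?thesis by blast
      qed
      fix \<omega> \<eta>
      have "{\<eta>. 0 \<le> f \<omega> \<eta>} = UNIV"
      proof (rule closed_dense_UNIV[OF _ _ D2(2)])
        have "continuous_on UNIV (\<lambda>\<eta>. f \<omega> \<eta>)"
          unfolding f_def resolv_def
          by (intro continuous_intros bounded_bilinear.continuous_on[OF bounded_bilinear_cdot]
              bounded_bilinear.continuous_on[OF bounded_bilinear_matrix_vector_mult])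
        then show "closed {\<eta>. 0 \<le> f \<omega> \<eta>}" by (intro closed_Collect_le continuous_intros)
      qed (use f2 in auto)
      then show "0 \<le> Re (cdot \<eta> (Gs \<sigma> *v (Cs \<sigma> *v resolv (As \<sigma>) \<omega> (Bs \<sigma> *v \<eta>) + Ds \<sigma> *v \<eta>)))"
        unfolding f_def by blast
    qed
  qed
qed

end

section \<open>Square-summable families\<close>

text \<open>Square summability and a bound on the norm in one predicate over finite partial sums.
  The number c is any upper bound, which lets estimates compose without computing norms.\<close>

definition l2_le :: "('i \<Rightarrow> 'a::real_normed_vector) \<Rightarrow> real \<Rightarrow> bool" where
  "l2_le x c \<longleftrightarrow> (\<forall>F. finite F \<longrightarrow> L2_set (\<lambda>j. norm (x j)) F \<le> c)"

lemma l2_leD: "l2_le x c \<Longrightarrow> finite F \<Longrightarrow> L2_set (\<lambda>j. norm (x j)) F \<le> c"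
  by (simp add: l2_le_def)

lemma l2_le_nonneg: "l2_le x c \<Longrightarrow> 0 \<le> c"
  using l2_leD[of x c "{}"] by simp

lemma l2_le_nth: "l2_le x c \<Longrightarrow> norm (x j) \<le> c"
  using l2_leD[of x c "{j}"] by simp

lemma l2_le_mono: "l2_le x c \<Longrightarrow> c \<le> d \<Longrightarrow> l2_le x d"
  unfolding l2_le_def by (meson order_trans)

lemma l2_le_zero: "0 \<le> c \<Longrightarrow> l2_le (\<lambda>j. 0) c"
  by (simp add: l2_le_def L2_set_def)

lemma l2_le_add:
  assumes "l2_le x c" "l2_le y d" shows "l2_le (\<lambda>j. x j + y j) (c + d)"
  unfolding l2_le_def
proof (intro allI impI)
  fix F :: "'a set" assume F: "finite F"
  have "L2_set (\<lambda>j. norm (x j + y j)) F \<le> L2_set (\<lambda>j. norm (x j) + norm (y j)) F"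
    by (intro L2_set_mono norm_triangle_ineq) auto
  also have "\<dots> \<le> L2_set (\<lambda>j. norm (x j)) F + L2_set (\<lambda>j. norm (y j)) F"
    by (rule L2_set_triangle_ineq)
  also have "\<dots> \<le> c + d" using l2_leD[OF assms(1) F] l2_leD[OF assms(2) F] by simp
  finally show "L2_set (\<lambda>j. norm (x j + y j)) F \<le> c + d" .
qed

lemma l2_le_scaleR: "l2_le x c \<Longrightarrow> l2_le (\<lambda>j. r *\<^sub>R x j) (\<bar>r\<bar> * c)"
  unfolding l2_le_def by (auto simp: L2_set_right_distrib[symmetric] intro: mult_left_mono)

lemma l2_le_sum: "(\<And>i. i < n \<Longrightarrow> l2_le (x i) (c i)) \<Longrightarrow> l2_le (\<lambda>j. \<Sum>i<n. x i j) (\<Sum>i<n. c i)" for n :: nat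
  by (induction n) (auto intro: l2_le_add l2_le_zero)

text \<open>The norm is lower semicontinuous under pointwise limits, since each finite partial norm
  is continuous. This passes bounds from truncated to infinite Toeplitz sums and from partial
  exponential sums to the semigroup.\<close>

lemma l2_le_limit:
  assumes "H \<noteq> bot" "\<And>j. ((\<lambda>n. X n j) \<longlongrightarrow> x j) H" "\<forall>\<^sub>F n in H. l2_le (X n) c"
  shows "l2_le x c"
  unfolding l2_le_def
proof (intro allI impI)
  fix F :: "'b set" assume F: "finite F"
  have "((\<lambda>n. L2_set (\<lambda>j. norm (X n j)) F) \<longlongrightarrow> L2_set (\<lambda>j. norm (x j)) F) H"
    unfolding L2_set_def by (intro tendsto_intros assms)
  then show "L2_set (\<lambda>j. norm (x j)) F \<le> c"
    by (rule tendsto_upperbound[OF _ _ assms(1)])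
       (use assms(3) in eventually_elim, use l2_leD[OF _ F] in blast)
qed

lemma L2_set_power2: "(L2_set f F)\<^sup>2 = (\<Sum>j\<in>F. (f j)\<^sup>2)"
  by (simp add: L2_set_def sum_nonneg)

lemma l2_le_iff_sum: "l2_le x c \<longleftrightarrow> 0 \<le> c \<and> (\<forall>F. finite F \<longrightarrow> (\<Sum>j\<in>F. (norm (x j))\<^sup>2) \<le> c\<^sup>2)"
proof
  assume x: "l2_le x c"
  then have "(L2_set (\<lambda>j. norm (x j)) F)\<^sup>2 \<le> c\<^sup>2" if "finite F" for F
    using l2_leD[OF x that] by (intro power_mono L2_set_nonneg)
  then show "0 \<le> c \<and> (\<forall>F. finite F \<longrightarrow> (\<Sum>j\<in>F. (norm (x j))\<^sup>2) \<le> c\<^sup>2)"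
    using l2_le_nonneg[OF x] by (simp add: L2_set_power2)
next
  assume c: "0 \<le> c \<and> (\<forall>F. finite F \<longrightarrow> (\<Sum>j\<in>F. (norm (x j))\<^sup>2) \<le> c\<^sup>2)"
  show "l2_le x c"
    unfolding l2_le_def
  proof (intro allI impI)
    fix F :: "'a set" assume "finite F"
    then have "(L2_set (\<lambda>j. norm (x j)) F)\<^sup>2 \<le> c\<^sup>2" using c by (simp add: L2_set_power2)
    with c show "L2_set (\<lambda>j. norm (x j)) F \<le> c" using power2_le_imp_le by blast
  qed
qed

lemma l2_product_sum_le:
  fixes x :: "'i \<Rightarrow> 'a::real_normed_vector" and y :: "'i \<Rightarrow> 'b::real_normed_vector"
  assumes "l2_le x c" "l2_le y d" "finite F"
  shows "(\<Sum>j\<in>F. norm (x j) * norm (y j)) \<le> c * d"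
proof -
  have "(\<Sum>j\<in>F. norm (x j) * norm (y j)) \<le> L2_set (\<lambda>j. norm (x j)) F * L2_set (\<lambda>j. norm (y j)) F"
    using L2_set_mult_ineq[of "\<lambda>j. norm (x j)" "\<lambda>j. norm (y j)" F] by simp
  also have "\<dots> \<le> c * d"
    using l2_leD[OF assms(1,3)] l2_leD[OF assms(2,3)] l2_le_nonneg[OF assms(1)]
    by (intro mult_mono) (auto simp: L2_set_nonneg)
  finally show ?thesis .
qed

lemma l2_product_summable:
  assumes "l2_le x c" "l2_le y d"
  shows "(\<lambda>j. norm (x j) * norm (y j)) summable_on UNIV" "infsum (\<lambda>j. norm (x j) * norm (y j)) UNIV \<le> c * d"
proof -
  show s: "(\<lambda>j. norm (x j) * norm (y j)) summable_on UNIV"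
    by (rule nonneg_bdd_above_summable_on) (auto intro!: bdd_aboveI[of _ "c * d"] l2_product_sum_le assms)
  show "infsum (\<lambda>j. norm (x j) * norm (y j)) UNIV \<le> c * d"
    by (rule infsum_le_finite_sums[OF s]) (rule l2_product_sum_le[OF assms])
qed

lemma l2_inner:
  fixes x y :: "'i \<Rightarrow> 'a::real_inner"
  assumes "l2_le x c" "l2_le y d"
  shows "(\<lambda>j. x j \<bullet> y j) summable_on UNIV" "\<bar>infsum (\<lambda>j. x j \<bullet> y j) UNIV\<bar> \<le> c * d"
proof -
  have a: "(\<lambda>j. norm (x j \<bullet> y j)) summable_on UNIV"
    by (rule Infinite_Sum.abs_summable_on_comparison_test'[OF l2_product_summable(1)[OF assms]])
       (simp add: Cauchy_Schwarz_ineq2)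
  then show "(\<lambda>j. x j \<bullet> y j) summable_on UNIV" by (rule abs_summable_summable)
  have "\<bar>infsum (\<lambda>j. x j \<bullet> y j) UNIV\<bar> \<le> infsum (\<lambda>j. norm (x j \<bullet> y j)) UNIV"
    using norm_infsum_bound[OF a] by simp
  also have "\<dots> \<le> infsum (\<lambda>j. norm (x j) * norm (y j)) UNIV"
    by (rule infsum_mono[OF a l2_product_summable(1)[OF assms]]) (simp add: Cauchy_Schwarz_ineq2)
  also have "\<dots> \<le> c * d" by (rule l2_product_summable(2)[OF assms])
  finally show "\<bar>infsum (\<lambda>j. x j \<bullet> y j) UNIV\<bar> \<le> c * d" .
qed

lemma l2_le_reflect: "l2_le K d \<Longrightarrow> l2_le (\<lambda>k. K (j - k)) d" for K :: "'i::ab_group_add \<Rightarrow> _"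
  unfolding l2_le_def
proof (intro allI impI)
  fix F :: "'i set" assume K: "\<forall>F. finite F \<longrightarrow> L2_set (\<lambda>j. norm (K j)) F \<le> d" and F: "finite F"
  have "L2_set (\<lambda>k. norm (K (j - k))) F = L2_set (\<lambda>k. norm (K k)) ((\<lambda>k. j - k) ` F)"
    by (simp add: L2_set_def sum.reindex inj_on_def)
  with K F show "L2_set (\<lambda>k. norm (K (j - k))) F \<le> d" by simp
qed

lemma toep_summable:
  fixes K :: "int^'v \<Rightarrow> real^'b^'a"
  assumes "l2_le K d" "l2_le x c"
  shows "(\<lambda>k. K (j - k) *v x k) summable_on UNIV"
  by (rule abs_summable_summable,
      rule Infinite_Sum.abs_summable_on_comparison_test'[OF l2_product_summable(1)[OF l2_le_reflect[OF assms(1)] assms(2)]])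
     (rule norm_matrix_vector_mult_le)

lemma toep_diff:
  fixes K :: "int^'v \<Rightarrow> real^'b^'a"
  assumes K: "l2_le K d" and x: "l2_le x c" and y: "l2_le y e"
  shows "toep K (\<lambda>k. x k - y k) j = toep K x j - toep K y j"
proof -
  have "infsum (\<lambda>k. K (j - k) *v x k - K (j - k) *v y k) UNIV = toep K x j - toep K y j"
    unfolding toep_def
    using infsum_add[OF toep_summable[OF K x, of j] summable_on_uminus[THEN iffD2, OF toep_summable[OF K y, of j]]]
    by (simp add: infsum_uminus)
  then show ?thesis by (simp add: toep_def mv_simps)
qed

text \<open>The operator norm is bounded by the supremum of the symbol. For finitely supported x
  this is Bessel for the image and Parseval for x. In general the truncations converge pointwise, by
  Cauchy-Schwarz against the square-summable K, and the bound passes to the limit.\<close>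

lemma toep_l2_le:
  fixes K :: "int^'v \<Rightarrow> real^'b^'a"
  assumes sym: "is_symbol_of Ks K" and M: "\<And>\<sigma>. norm (Ks \<sigma>) \<le> M" and K: "l2_le K d" and x: "l2_le x c"
  shows "l2_le (toep K x) (M * c)"
proof -
  have [measurable]: "Ks \<in> borel_measurable borel" using sym by (simp add: is_symbol_of_def)
  have "M \<ge> 0" using M[of 0] norm_ge_zero order_trans by blast
  have "c \<ge> 0" by (rule l2_le_nonneg[OF x])
  have fin: "l2_le (toep K (\<lambda>k. if k \<in> F then x k else 0)) (M * c)" if F: "finite F" for F
    unfolding l2_le_iff_sum
  proof (intro conjI allI impI)
    show "0 \<le> M * c" using \<open>M \<ge> 0\<close> \<open>c \<ge> 0\<close> by simp
    fix J :: "(int^'v) set" assume J: "finite J"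
    define xF where "xF k = (if k \<in> F then x k else 0)" for k
    define f where "f = trig F (\<lambda>l. cvec (xF l))"
    have fm [measurable]: "f \<in> borel_measurable borel" unfolding f_def trig_def by measurable
    define e where "e = (\<Sum>l\<in>F. norm (cvec (xF l)))"
    have fb: "norm (f \<sigma>) \<le> e" for \<sigma> unfolding f_def e_def by (rule norm_trig_le)
    have e0: "0 \<le> e" by (simp add: e_def sum_nonneg)
    have rep: "fourier_rep xF f" unfolding f_def by (rule fourier_rep_trig[OF F]) (simp add: xF_def)
    have Kb: "norm (Ks \<sigma> *v f \<sigma>) \<le> M * norm (f \<sigma>)" for \<sigma>
      using M[of \<sigma>] by (intro order_trans[OF norm_matrix_vector_mult_le] mult_right_mono) auto
    have Kb2: "norm (Ks \<sigma> *v f \<sigma>) \<le> M * e" for \<sigma>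
      using Kb[of \<sigma>] mult_left_mono[OF fb[of \<sigma>] \<open>M \<ge> 0\<close>] by linarith
    have "(\<Sum>j\<in>J. (norm (toep K xF j))\<^sup>2) \<le> (LINT \<sigma>|tmeas. (norm (Ks \<sigma> *v f \<sigma>))\<^sup>2)"
      by (rule bessel[OF J fourier_rep_toep[OF sym M fm fb rep] _ Kb2]) measurable
    also have "\<dots> \<le> (LINT \<sigma>|tmeas. M\<^sup>2 * (norm (f \<sigma>))\<^sup>2)"
    proof (rule integral_mono)
      show "integrable tmeas (\<lambda>\<sigma>. (norm (Ks \<sigma> *v f \<sigma>))\<^sup>2)"
        by (rule tm_integrable[of _ "(M * e)\<^sup>2"]) (auto intro!: power_mono Kb2)
      show "integrable tmeas (\<lambda>\<sigma>. M\<^sup>2 * (norm (f \<sigma>))\<^sup>2)"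
        by (rule integrable_mult_right, rule tm_integrable[of _ "e\<^sup>2"]) (auto intro!: power_mono fb)
      show "(norm (Ks \<sigma> *v f \<sigma>))\<^sup>2 \<le> M\<^sup>2 * (norm (f \<sigma>))\<^sup>2" for \<sigma>
        unfolding power_mult_distrib[symmetric] by (intro power_mono Kb) simp
    qed
    also have "\<dots> = M\<^sup>2 * (\<Sum>l\<in>F. (norm (cvec (xF l)))\<^sup>2)"
      unfolding f_def by (simp add: trig_parseval[OF F])
    also have "\<dots> \<le> M\<^sup>2 * c\<^sup>2"
    proof (rule mult_left_mono)
      have "(\<Sum>l\<in>F. (norm (cvec (xF l)))\<^sup>2) = (\<Sum>l\<in>F. (norm (x l))\<^sup>2)"
        by (intro sum.cong) (auto simp: xF_def)
      also have "\<dots> \<le> c\<^sup>2" using x F unfolding l2_le_iff_sum by blast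
      finally show "(\<Sum>l\<in>F. (norm (cvec (xF l)))\<^sup>2) \<le> c\<^sup>2" .
    qed simp
    finally show "(\<Sum>j\<in>J. (norm (toep K (\<lambda>k. if k \<in> F then x k else 0) j))\<^sup>2) \<le> (M * c)\<^sup>2"
      by (simp add: xF_def[abs_def] power_mult_distrib)
  qed
  show ?thesis
  proof (rule l2_le_limit[of "finite_subsets_at_top UNIV"])
    show "((\<lambda>F. toep K (\<lambda>k. if k \<in> F then x k else 0) j) \<longlongrightarrow> toep K x j) (finite_subsets_at_top UNIV)" for j
    proof -
      have "((\<lambda>F. \<Sum>k\<in>F. K (j - k) *v x k) \<longlongrightarrow> toep K x j) (finite_subsets_at_top UNIV)"
        unfolding toep_def by (rule infsum_tendsto[OF toep_summable[OF K x]])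
      moreover have "\<forall>\<^sub>F F in finite_subsets_at_top UNIV. (\<Sum>k\<in>F. K (j - k) *v x k) = toep K (\<lambda>k. if k \<in> F then x k else 0) j"
      proof (rule eventually_finite_subsets_at_top_weakI)
        fix F :: "(int^'v) set" assume elim: "finite F"
        have "toep K (\<lambda>k. if k \<in> F then x k else 0) j = infsum (\<lambda>k. K (j - k) *v x k) F"
          unfolding toep_def by (rule infsum_cong_neutral) auto
        then show "(\<Sum>k\<in>F. K (j - k) *v x k) = toep K (\<lambda>k. if k \<in> F then x k else 0) j" using elim by simp
      qed
      ultimately show ?thesis by (rule Lim_transform_eventually)
    qed
    show "\<forall>\<^sub>F F in finite_subsets_at_top UNIV. l2_le (toep K (\<lambda>k. if k \<in> F then x k else 0)) (M * c)"
      by (rule eventually_finite_subsets_at_top_weakI) (rule fin)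
  qed simp
qed

section \<open>The semigroup on square-summable sequences\<close>

context
  fixes A :: "int^'v \<Rightarrow> real^'n^'n" and As M d
  assumes sym: "is_symbol_of As A" and M: "\<And>\<sigma>. norm (As \<sigma>) \<le> M" and A: "l2_le A d"
begin

lemma toep_funpow_l2_le: "l2_le x c \<Longrightarrow> l2_le ((toep A ^^ p) x) (M ^ p * c)"
proof (induction p)
  case (Suc p)
  from toep_l2_le[OF sym M A Suc.IH[OF Suc.prems]] show ?case by (simp add: mult.assoc)
qed simp

lemma toep_funpow_diff:
  assumes "l2_le x c" "l2_le y e"
  shows "(toep A ^^ p) (\<lambda>k. x k - y k) = (\<lambda>k. (toep A ^^ p) x k - (toep A ^^ p) y k)"
proof (induction p)
  case (Suc p)
  show ?case
    by (simp add: Suc) (rule ext, rule toep_diff[OF A toep_funpow_l2_le[OF assms(1)] toep_funpow_l2_le[OF assms(2)]])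
qed simp

lemma semigroup_summable:
  assumes "l2_le x c"
  shows "summable (\<lambda>p. (s ^ p / fact p) *\<^sub>R ((toep A ^^ p) x j))"
proof (rule summable_comparison_test'[OF summable_mexp_bound[of s M c]])
  fix p :: nat
  have "norm ((s ^ p / fact p) *\<^sub>R ((toep A ^^ p) x j)) = (\<bar>s\<bar> ^ p / fact p) * norm ((toep A ^^ p) x j)"
    by (simp add: power_abs)
  also have "\<dots> \<le> (\<bar>s\<bar> ^ p / fact p) * (M ^ p * c)"
    by (intro mult_left_mono l2_le_nth[OF toep_funpow_l2_le[OF assms]]) auto
  finally show "norm ((s ^ p / fact p) *\<^sub>R ((toep A ^^ p) x j)) \<le> (inverse (fact p) * (\<bar>s\<bar> * M) ^ p) * c"
    by (simp add: power_mult_distrib field_simps)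
qed

lemma semigroup_diff:
  assumes "l2_le x c" "l2_le y e"
  shows "semigroup A s (\<lambda>k. x k - y k) j = semigroup A s x j - semigroup A s y j"
  unfolding semigroup_def toep_funpow_diff[OF assms] scaleR_diff_right
  by (rule suminf_diff[OF semigroup_summable[OF assms(1)] semigroup_summable[OF assms(2)], symmetric])

lemma semigroup_l2_le:
  assumes x: "l2_le x c"
  shows "l2_le (semigroup A s x) (exp (\<bar>s\<bar> * M) * c)"
proof (rule l2_le_limit)
  have "c \<ge> 0" by (rule l2_le_nonneg[OF x])
  have "M \<ge> 0" using M[of 0] norm_ge_zero order_trans by blast
  show "(\<lambda>n. \<Sum>p<n. (s ^ p / fact p) *\<^sub>R ((toep A ^^ p) x j)) \<longlonglongrightarrow> semigroup A s x j" for j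
    unfolding semigroup_def by (rule summable_LIMSEQ[OF semigroup_summable[OF x]])
  show "\<forall>\<^sub>F n in sequentially. l2_le (\<lambda>j. \<Sum>p<n. (s ^ p / fact p) *\<^sub>R ((toep A ^^ p) x j)) (exp (\<bar>s\<bar> * M) * c)"
  proof (rule always_eventually, rule allI)
    fix n
    have "l2_le (\<lambda>j. \<Sum>p<n. (s ^ p / fact p) *\<^sub>R ((toep A ^^ p) x j)) (\<Sum>p<n. \<bar>s ^ p / fact p\<bar> * (M ^ p * c))"
      by (intro l2_le_sum l2_le_scaleR toep_funpow_l2_le x)
    moreover have "(\<Sum>p<n. \<bar>s ^ p / fact p\<bar> * (M ^ p * c)) \<le> exp (\<bar>s\<bar> * M) * c"
    proof -
      have "(\<Sum>p<n. \<bar>s ^ p / fact p\<bar> * (M ^ p * c)) = (\<Sum>p<n. (inverse (fact p) * (\<bar>s\<bar> * M) ^ p) * c)"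
        by (intro sum.cong) (auto simp: power_abs power_mult_distrib field_simps)
      also have "\<dots> \<le> (\<Sum>p. (inverse (fact p) * (\<bar>s\<bar> * M) ^ p) * c)"
        using \<open>c \<ge> 0\<close> \<open>M \<ge> 0\<close> by (intro sum_le_suminf summable_mexp_bound) auto
      also have "\<dots> = exp (\<bar>s\<bar> * M) * c"
        by (simp add: exp_def suminf_mult2[OF summable_exp, symmetric])
      finally show ?thesis .
    qed
    ultimately show "l2_le (\<lambda>j. \<Sum>p<n. (s ^ p / fact p) *\<^sub>R ((toep A ^^ p) x j)) (exp (\<bar>s\<bar> * M) * c)"
      by (rule l2_le_mono)
  qed
qed simp

end

text \<open>Minkowski inequality for integrals. The finite partial norm L of the integral is tested
  against the integral itself: the square of L is an integral of inner products, each at most L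
  V(\<tau>), and one factor L cancels.\<close>

lemma l2_le_integral:
  fixes z :: "'t \<Rightarrow> 'i \<Rightarrow> 'a::euclidean_space"
  assumes z: "\<And>j. integrable N (\<lambda>\<tau>. z \<tau> j)" and V: "integrable N V"
    and le: "AE \<tau> in N. l2_le (z \<tau>) (V \<tau>)"
  shows "l2_le (\<lambda>j. LINT \<tau>|N. z \<tau> j) (LINT \<tau>|N. V \<tau>)"
  unfolding l2_le_def
proof (intro allI impI)
  fix F :: "'i set" assume F: "finite F"
  define w where "w j = (LINT \<tau>|N. z \<tau> j)" for j
  define L where "L = L2_set (\<lambda>j. norm (w j)) F"
  have L0: "L \<ge> 0" by (simp add: L_def L2_set_nonneg)
  have iw: "integrable N (\<lambda>\<tau>. \<Sum>j\<in>F. w j \<bullet> z \<tau> j)"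
    by (intro Bochner_Integration.integrable_sum integrable_inner_right z)
  have "L\<^sup>2 = (\<Sum>j\<in>F. w j \<bullet> w j)"
    by (simp add: L_def L2_set_power2 power2_norm_eq_inner)
  also have "\<dots> = (\<Sum>j\<in>F. LINT \<tau>|N. w j \<bullet> z \<tau> j)"
    using z by (simp add: w_def)
  also have "\<dots> = (LINT \<tau>|N. (\<Sum>j\<in>F. w j \<bullet> z \<tau> j))"
    by (rule Bochner_Integration.integral_sum[symmetric]) (intro integrable_inner_right z)
  also have "\<dots> \<le> (LINT \<tau>|N. L * V \<tau>)"
  proof (rule integral_mono_AE[OF iw])
    show "integrable N (\<lambda>\<tau>. L * V \<tau>)" using V by simp
    show "AE \<tau> in N. (\<Sum>j\<in>F. w j \<bullet> z \<tau> j) \<le> L * V \<tau>"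
      using le
    proof eventually_elim
      case (elim \<tau>)
      have "(\<Sum>j\<in>F. w j \<bullet> z \<tau> j) \<le> (\<Sum>j\<in>F. norm (w j) * norm (z \<tau> j))"
        by (intro sum_mono norm_cauchy_schwarz)
      also have "\<dots> \<le> L * L2_set (\<lambda>j. norm (z \<tau> j)) F"
        using L2_set_mult_ineq[of "\<lambda>j. norm (w j)" "\<lambda>j. norm (z \<tau> j)" F] by (simp add: L_def)
      also have "\<dots> \<le> L * V \<tau>" by (intro mult_left_mono l2_leD[OF elim F] L0)
      finally show ?case .
    qed
  qed
  also have "\<dots> = L * (LINT \<tau>|N. V \<tau>)" by simp
  finally have *: "L * L \<le> L * (LINT \<tau>|N. V \<tau>)" by (simp add: power2_eq_square)
  have "0 \<le> (LINT \<tau>|N. V \<tau>)"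
    by (rule integral_nonneg_AE) (use le in eventually_elim, auto dest: l2_le_nonneg)
  with * L0 have "L \<le> (LINT \<tau>|N. V \<tau>)"
    by (cases "L = 0") (auto simp: mult_le_cancel_left)
  then show "L2_set (\<lambda>j. norm (LINT \<tau>|N. z \<tau> j)) F \<le> (LINT \<tau>|N. V \<tau>)"
    by (simp add: L_def w_def)
qed

section \<open>Measurability of sums over the lattice\<close>

definition exhaust :: "nat \<Rightarrow> 'i::countable set" where
  "exhaust N = {l. to_nat l < N}"

lemma finite_exhaust [simp]: "finite (exhaust N)"
  unfolding exhaust_def by (rule finite_imageD[of to_nat]) (auto intro: finite_subset[of _ "{..<N}"] inj_on_subset[OF inj_to_nat])

lemma finite_subset_exhaust: "finite F \<Longrightarrow> \<exists>N. F \<subseteq> exhaust N"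
  by (rule exI[of _ "Suc (Max (to_nat ` F))"]) (auto simp: exhaust_def less_Suc_eq_le)

lemma exhaust_mono: "N \<le> N' \<Longrightarrow> exhaust N \<subseteq> exhaust N'"
  by (auto simp: exhaust_def)

lemma filterlim_exhaust: "filterlim exhaust (finite_subsets_at_top UNIV) sequentially"
  unfolding filterlim_iff eventually_finite_subsets_at_top
proof (intro allI impI)
  fix P :: "'a set \<Rightarrow> bool"
  assume "\<exists>X. finite X \<and> X \<subseteq> UNIV \<and> (\<forall>Y. finite Y \<and> X \<subseteq> Y \<and> Y \<subseteq> UNIV \<longrightarrow> P Y)"
  then obtain X where X: "finite X" "\<And>Y. finite Y \<Longrightarrow> X \<subseteq> Y \<Longrightarrow> P Y" by auto
  obtain N where N: "X \<subseteq> exhaust N" using finite_subset_exhaust[OF X(1)] by blast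
  have "P (exhaust n)" if "n \<ge> N" for n
    by (rule X(2)[OF finite_exhaust order_trans[OF N exhaust_mono[OF that]]])
  then show "\<forall>\<^sub>F n in sequentially. P (exhaust n)" by (auto simp: eventually_sequentially)
qed

text \<open>In finite dimension unconditional summability is absolute, and absolute summability is
  boundedness of the partial sums along one exhausting sequence. With a natural number as bound,
  summability becomes a condition built from countable operations, hence measurable in a
  parameter.\<close>

lemma summable_on_iff_exhaust_bounded:
  fixes f :: "'i::countable \<Rightarrow> 'b::euclidean_space"
  shows "f summable_on UNIV \<longleftrightarrow> (\<exists>B::nat. \<forall>N. (\<Sum>k\<in>exhaust N. norm (f k)) \<le> real B)"
proof
  assume f: "f summable_on UNIV"
  have "(\<lambda>k. norm (f k)) summable_on UNIV"
  proof (rule Infinite_Sum.abs_summable_on_comparison_test'[where g = "\<lambda>k. \<Sum>b\<in>Basis. norm (f k \<bullet> b)"])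
    show "(\<lambda>k. \<Sum>b\<in>Basis. norm (f k \<bullet> b)) summable_on UNIV"
    proof -
      have sum: "(\<lambda>k. \<Sum>b\<in>S. g b k) summable_on UNIV" if "\<And>b. (g b :: 'i \<Rightarrow> real) summable_on UNIV" for S :: "'b set" and g
        by (induction S rule: infinite_finite_induct) (auto intro: summable_on_add that)
      have "(\<lambda>k. f k \<bullet> b) summable_on UNIV" for b
        by (rule summable_on_bounded_linear[OF bounded_linear_inner_left f])
      then have "(\<lambda>k. norm (f k \<bullet> b)) summable_on UNIV" for b
        by (rule summable_on_iff_abs_summable_on_real[THEN iffD1])
      then show ?thesis by (rule sum)
    qed
  qed (simp add: norm_le_l1)
  then have le: "(\<Sum>k\<in>F. norm (f k)) \<le> infsum (\<lambda>k. norm (f k)) UNIV" if "finite F" for F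
    by (rule finite_sum_le_infsum[OF _ that]) (use \<open>(\<lambda>k. norm (f k)) summable_on UNIV\<close> in auto)
  obtain B :: nat where "infsum (\<lambda>k. norm (f k)) UNIV \<le> real B" using real_arch_simple by blast
  then show "\<exists>B::nat. \<forall>N. (\<Sum>k\<in>exhaust N. norm (f k)) \<le> real B"
    by (intro exI[of _ B] allI order_trans[OF le]) auto
next
  assume "\<exists>B::nat. \<forall>N. (\<Sum>k\<in>exhaust N. norm (f k)) \<le> real B"
  then obtain B :: nat where B: "\<And>N. (\<Sum>k\<in>exhaust N. norm (f k)) \<le> real B" by blast
  have "(\<lambda>k. norm (f k)) summable_on UNIV"
  proof (rule nonneg_bdd_above_summable_on, simp, rule bdd_aboveI[of _ "real B"])
    fix y assume "y \<in> sum (\<lambda>k. norm (f k)) ` {F. F \<subseteq> UNIV \<and> finite F}"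
    then obtain F where F: "finite F" "y = (\<Sum>k\<in>F. norm (f k))" by auto
    obtain N where "F \<subseteq> exhaust N" using finite_subset_exhaust[OF F(1)] by blast
    then have "y \<le> (\<Sum>k\<in>exhaust N. norm (f k))" unfolding F(2) by (intro sum_mono2) auto
    with B[of N] show "y \<le> real B" by linarith
  qed
  then show "f summable_on UNIV" by (rule abs_summable_summable)
qed

text \<open>On the measurable set of summability the value is a sequential limit along
  \<open>exhaust\<close>; elsewhere \<open>infsum\<close> is 0 by convention.\<close>

lemma borel_measurable_infsum:
  fixes f :: "'i::countable \<Rightarrow> 'x \<Rightarrow> 'b::euclidean_space"
  assumes [measurable]: "\<And>k. f k \<in> borel_measurable N"
  shows "(\<lambda>x. infsum (\<lambda>k. f k x) UNIV) \<in> borel_measurable N"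
proof -
  have "infsum (\<lambda>k. f k x) UNIV = (if \<exists>B::nat. \<forall>N. (\<Sum>k\<in>exhaust N. norm (f k x)) \<le> real B
      then lim (\<lambda>N. \<Sum>k\<in>exhaust N. f k x) else 0)" for x
  proof (cases "(\<lambda>k. f k x) summable_on UNIV")
    case True
    have "(\<lambda>N. \<Sum>k\<in>exhaust N. f k x) \<longlonglongrightarrow> infsum (\<lambda>k. f k x) UNIV"
      by (rule filterlim_compose[OF infsum_tendsto[OF True] filterlim_exhaust])
    then show ?thesis using True unfolding summable_on_iff_exhaust_bounded by (simp add: limI)
  next
    case False
    then show ?thesis
      using infsum_not_exists[OF False] unfolding summable_on_iff_exhaust_bounded by (simp only: if_False)
  qed
  then show ?thesis by simp
qed

lemma borel_measurable_matrix_vector_mult_real [measurable]: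
  fixes K :: "real^'b^'a"
  assumes "f \<in> borel_measurable N" shows "(\<lambda>x. K *v f x) \<in> borel_measurable N"
  by (rule measurable_compose[OF assms], rule borel_measurable_continuous_onI)
     (intro bounded_bilinear.continuous_on[OF bounded_bilinear_matrix_vector_mult] continuous_intros)

lemma borel_measurable_toep:
  fixes K :: "int^'v \<Rightarrow> real^'b^'a"
  assumes [measurable]: "\<And>k. (\<lambda>x. f x k) \<in> borel_measurable N"
  shows "(\<lambda>x. toep K (f x) j) \<in> borel_measurable N"
  unfolding toep_def by (rule borel_measurable_infsum) measurable

lemma borel_measurable_semigroup:
  fixes A :: "int^'v \<Rightarrow> real^'n^'n"
  assumes [measurable]: "s \<in> borel_measurable N" and f: "\<And>k. (\<lambda>x. f x k) \<in> borel_measurable N"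
  shows "(\<lambda>x. semigroup A (s x) (f x) j) \<in> borel_measurable N"
proof -
  have [measurable]: "(\<lambda>x. (toep A ^^ p) (f x) j) \<in> borel_measurable N" for p j
    by (induction p arbitrary: j) (auto intro: f borel_measurable_toep)
  show ?thesis unfolding semigroup_def by measurable
qed

lemma borel_measurable_net_state:
  fixes A :: "int^'v \<Rightarrow> real^'n^'n" and B :: "int^'v \<Rightarrow> real^'m^'n"
  assumes u: "\<And>k. (\<lambda>t. u t k) \<in> borel_measurable borel"
  shows "(\<lambda>t. net_state A B u t j) \<in> borel_measurable borel"
proof -
  have [measurable]: "(\<lambda>p. semigroup A (fst p - snd p) (toep B (u (snd p))) j) \<in> borel_measurable (borel \<Otimes>\<^sub>M lborel)"
  proof (rule borel_measurable_semigroup)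
    show "(\<lambda>p. toep B (u (snd p)) k) \<in> borel_measurable (borel \<Otimes>\<^sub>M lborel)" for k
    proof (rule borel_measurable_toep)
      show "(\<lambda>p. u (snd p) l) \<in> borel_measurable (borel \<Otimes>\<^sub>M lborel)" for l
        using measurable_compose[OF measurable_snd, of "\<lambda>t. u t l" lborel borel borel] u[of l] by simp
    qed
  qed measurable
  show ?thesis
    unfolding net_state_def set_lebesgue_integral_def
    by (intro lborel.borel_measurable_lebesgue_integral)
       (simp add: split_beta' indicator_def cong: if_cong)
qed

lemma borel_measurable_supply_rate:
  assumes u: "\<And>k. (\<lambda>t. u t k) \<in> borel_measurable borel"
  shows "supply_rate G A B C D u \<in> borel_measurable borel"
proof -
  have [measurable]: "(\<lambda>t. net_output A B C D u t j) \<in> borel_measurable borel" for j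
    unfolding net_output_def
    by (intro borel_measurable_add borel_measurable_toep borel_measurable_net_state u)
  have m: "(\<lambda>t. toep G (net_output A B C D u t) j) \<in> borel_measurable borel" for j
    by (intro borel_measurable_toep) measurable
  have "(\<lambda>t. infsum (\<lambda>j. u t j \<bullet> toep G (net_output A B C D u t) j) UNIV) \<in> borel_measurable borel"
    by (intro borel_measurable_infsum borel_measurable_inner u m)
  then show ?thesis by (simp add: supply_rate_def[abs_def])
qed

section \<open>Spatial norms as functions of time, and truncation\<close>

definition l2_sq :: "('i \<Rightarrow> 'a::real_normed_vector) \<Rightarrow> ennreal" where
  "l2_sq x = (\<integral>\<^sup>+ k. ennreal ((norm (x k))\<^sup>2) \<partial>count_space UNIV)"

text \<open>\<open>enn2real\<close> sends infinity to 0, so the value is meaningful only where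
  \<open>l2_sq x < \<infinity>\<close>. Estimates carry this condition, which holds at almost every
  time of a finite interval for admissible inputs.\<close>

definition l2_norm :: "('i \<Rightarrow> 'a::real_normed_vector) \<Rightarrow> real" where
  "l2_norm x = sqrt (enn2real (l2_sq x))"

lemma l2_norm_nonneg [simp]: "0 \<le> l2_norm x"
  by (simp add: l2_norm_def)

lemma ennreal_l2_norm: "l2_sq x < \<infinity> \<Longrightarrow> ennreal ((l2_norm x)\<^sup>2) = l2_sq x"
  by (simp add: l2_norm_def)

lemma l2_le_l2_norm:
  assumes "l2_sq x < \<infinity>" shows "l2_le x (l2_norm x)"
  unfolding l2_le_iff_sum
proof (intro conjI allI impI)
  fix F :: "'a set" assume F: "finite F"
  have "ennreal (\<Sum>j\<in>F. (norm (x j))\<^sup>2) = (\<Sum>j\<in>F. ennreal ((norm (x j))\<^sup>2) * indicator F j)"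
    by (subst sum_ennreal[symmetric]) auto
  also have "\<dots> = (\<integral>\<^sup>+ k. ennreal ((norm (x k))\<^sup>2) * indicator F k \<partial>count_space UNIV)"
    by (rule nn_integral_count_space'[symmetric, OF F]) auto
  also have "\<dots> \<le> l2_sq x"
    unfolding l2_sq_def by (intro nn_integral_mono) (auto simp: indicator_def)
  finally have "ennreal (\<Sum>j\<in>F. (norm (x j))\<^sup>2) \<le> ennreal ((l2_norm x)\<^sup>2)"
    by (simp only: ennreal_l2_norm[OF assms])
  then show "(\<Sum>j\<in>F. (norm (x j))\<^sup>2) \<le> (l2_norm x)\<^sup>2" by (simp add: ennreal_le_iff)
qed simp

lemma l2_sq_mono: "(\<And>k. norm (x k) \<le> norm (y k)) \<Longrightarrow> l2_sq x \<le> l2_sq y"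
  unfolding l2_sq_def by (intro nn_integral_mono ennreal_leI power_mono) auto

lemma l2_norm_mono:
  assumes "\<And>k. norm (x k) \<le> norm (y k)" "l2_sq y < \<infinity>" shows "l2_norm x \<le> l2_norm y"
  unfolding l2_norm_def
  by (intro real_sqrt_le_mono enn2real_mono l2_sq_mono assms) (use assms in \<open>simp add: less_top\<close>)

lemma borel_measurable_l2_sq:
  fixes f :: "'x \<Rightarrow> 'i::countable \<Rightarrow> 'a::euclidean_space"
  assumes [measurable]: "\<And>k. (\<lambda>t. f t k) \<in> borel_measurable N"
  shows "(\<lambda>t. l2_sq (f t)) \<in> borel_measurable N" "(\<lambda>t. l2_norm (f t)) \<in> borel_measurable N"
proof -
  interpret sigma_finite_measure "count_space (UNIV :: 'i set)" by (rule sigma_finite_measure_count_space)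
  have "(\<lambda>p. (\<lambda>k t. ennreal ((norm (f t k))\<^sup>2)) (snd p) (fst p)) \<in> borel_measurable (N \<Otimes>\<^sub>M count_space UNIV)"
    by (rule measurable_compose_countable[where f = "\<lambda>k p. ennreal ((norm (f (fst p) k))\<^sup>2)"]) measurable
  then show "(\<lambda>t. l2_sq (f t)) \<in> borel_measurable N"
    unfolding l2_sq_def by (intro borel_measurable_nn_integral) (simp add: split_beta')
  then show "(\<lambda>t. l2_norm (f t)) \<in> borel_measurable N"
    unfolding l2_norm_def by measurable
qed

text \<open>Cuts in space and in amplitude at once, so that the result is a
  \<open>simple_input\<close>. Each value is either kept or dropped; hence the truncation and the
  remainder are both dominated by u.\<close>

definition truncate :: "nat \<Rightarrow> (real \<Rightarrow> 'i::countable \<Rightarrow> 'a::real_normed_vector) \<Rightarrow> real \<Rightarrow> 'i \<Rightarrow> 'a" where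
  "truncate N u t k = (if k \<in> exhaust N \<and> norm (u t k) \<le> real N then u t k else 0)"

lemma simple_input_truncate:
  fixes u :: "real \<Rightarrow> int^'v \<Rightarrow> real^'m"
  assumes [measurable]: "\<And>k. (\<lambda>t. u t k) \<in> borel_measurable borel"
  shows "simple_input (exhaust N) (real N) (truncate N u)"
  unfolding simple_input_def truncate_def by auto

lemma truncate_norm_le: "norm (truncate N u t k) \<le> norm (u t k)" "norm (u t k - truncate N u t k) \<le> norm (u t k)"
  by (auto simp: truncate_def)

text \<open>Dominated convergence for the counting measure on the lattice: at each site the
  truncation is exact from some N on.\<close>

lemma l2_norm_truncate_limit:
  fixes u :: "real \<Rightarrow> int^'v \<Rightarrow> real^'m"
  assumes fin: "l2_sq (u t) < \<infinity>"
  shows "(\<lambda>N. l2_norm (\<lambda>k. u t k - truncate N u t k)) \<longlonglongrightarrow> 0"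
proof -
  define X where "X N = l2_sq (\<lambda>k. u t k - truncate N u t k)" for N
  have Xfin: "X N < \<infinity>" for N
    unfolding X_def by (rule order_le_less_trans[OF l2_sq_mono fin]) (rule truncate_norm_le)
  have "X \<longlonglongrightarrow> (\<integral>\<^sup>+ k. 0 \<partial>count_space (UNIV :: (int^'v) set))"
    unfolding X_def l2_sq_def
  proof (rule nn_integral_dominated_convergence[where w = "\<lambda>k. ennreal ((norm (u t k))\<^sup>2)"])
    show "AE k in count_space UNIV. ennreal ((norm (u t k - truncate N u t k))\<^sup>2) \<le> ennreal ((norm (u t k))\<^sup>2)" for N
      by (intro AE_I2 ennreal_leI power_mono truncate_norm_le) auto
    show "(\<integral>\<^sup>+ k. ennreal ((norm (u t k))\<^sup>2) \<partial>count_space UNIV) < \<infinity>" using fin by (simp add: l2_sq_def)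
    show "AE k in count_space UNIV. (\<lambda>N. ennreal ((norm (u t k - truncate N u t k))\<^sup>2)) \<longlonglongrightarrow> 0"
    proof (rule AE_I2)
      fix k
      obtain n :: nat where n: "norm (u t k) \<le> real n" using real_arch_simple by blast
      have "\<forall>\<^sub>F N in sequentially. ennreal ((norm (u t k - truncate N u t k))\<^sup>2) = 0"
        \<comment> \<open>\<open>exhaust\<close> uses a strict inequality on indices, hence the
          \<open>Suc\<close>; n is the amplitude that N must reach.\<close>
        using eventually_ge_at_top[of "max (Suc (to_nat k)) n"]
      proof eventually_elim
        case (elim N)
        then have "k \<in> exhaust N" "norm (u t k) \<le> real N" using n by (auto simp: exhaust_def)
        then show ?case by (simp add: truncate_def)
      qed
      then show "(\<lambda>N. ennreal ((norm (u t k - truncate N u t k))\<^sup>2)) \<longlonglongrightarrow> 0" by (rule tendsto_eventually)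
    qed
  qed auto
  then have "X \<longlonglongrightarrow> ennreal 0" by simp
  moreover have "(\<lambda>N. ennreal (enn2real (X N))) = X"
    using Xfin by (simp add: fun_eq_iff)
  ultimately have "(\<lambda>N. ennreal (enn2real (X N))) \<longlonglongrightarrow> ennreal 0"
    by (simp only:)
  from tendsto_ennrealD[OF this] have "(\<lambda>N. enn2real (X N)) \<longlonglongrightarrow> 0" by simp
  then have "(\<lambda>N. sqrt (enn2real (X N))) \<longlonglongrightarrow> sqrt 0" by (rule tendsto_real_sqrt)
  then show ?thesis by (simp add: l2_norm_def X_def)
qed

text \<open>In time only the first power of the spatial norm is integrable, which is what the
  convolution integral of the state requires. Square integrability in time enters separately, when
  the supply rate is dominated.\<close>

definition L2_input :: "real \<Rightarrow> (real \<Rightarrow> int^'v \<Rightarrow> real^'m) \<Rightarrow> bool" where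
  "L2_input T v \<longleftrightarrow> (\<forall>k. (\<lambda>t. v t k) \<in> borel_measurable borel) \<and>
     (AE t in lborel. t \<in> {0..T} \<longrightarrow> l2_sq (v t) < \<infinity>) \<and> set_integrable lborel {0..T} (\<lambda>t. l2_norm (v t))"

lemma L2_input_dominated:
  assumes v: "L2_input T v" and m: "\<And>k. (\<lambda>t. w t k) \<in> borel_measurable borel"
    and le: "\<And>t k. norm (w t k) \<le> norm (v t k)"
  shows "L2_input T w"
proof -
  have vf: "AE t in lborel. t \<in> {0..T} \<longrightarrow> l2_sq (v t) < \<infinity>" using v by (simp add: L2_input_def)
  have sq: "l2_sq (w t) \<le> l2_sq (v t)" for t by (rule l2_sq_mono) (rule le)
  from vf have fin: "AE t in lborel. t \<in> {0..T} \<longrightarrow> l2_sq (w t) < \<infinity>"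
    by eventually_elim (auto intro: order_le_less_trans[OF sq])
  have "integrable lborel (\<lambda>t. indicator {0..T} t *\<^sub>R l2_norm (w t))"
  proof (rule Bochner_Integration.integrable_bound)
    show "integrable lborel (\<lambda>t. indicator {0..T} t *\<^sub>R l2_norm (v t))"
      using v by (simp add: L2_input_def set_integrable_def)
    show "AE t in lborel. norm (indicator {0..T} t *\<^sub>R l2_norm (w t)) \<le> norm (indicator {0..T} t *\<^sub>R l2_norm (v t))"
      using vf by eventually_elim (auto simp: indicator_def intro!: l2_norm_mono le)
    have [measurable]: "(\<lambda>t. l2_norm (w t)) \<in> borel_measurable borel" by (rule borel_measurable_l2_sq(2)[OF m])
    show "(\<lambda>t. indicator {0..T} t *\<^sub>R l2_norm (w t)) \<in> borel_measurable lborel" by measurable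
  qed
  with m fin show ?thesis by (simp add: L2_input_def set_integrable_def)
qed

lemma admissible_L2_input:
  fixes u :: "real \<Rightarrow> int^'v \<Rightarrow> real^'m"
  assumes u: "admissible_input u" and T: "T > 0"
  shows "L2_input T u" "set_integrable lborel {0..T} (\<lambda>t. (l2_norm (u t))\<^sup>2)"
proof -
  have m: "(\<lambda>t. u t k) \<in> borel_measurable borel" for k using u by (simp add: admissible_input_def)
  have [measurable]: "(\<lambda>t. l2_sq (u t)) \<in> borel_measurable borel" "(\<lambda>t. l2_norm (u t)) \<in> borel_measurable borel"
    by (rule borel_measurable_l2_sq[OF m])+
  have fin: "(\<integral>\<^sup>+ t\<in>{0..T}. l2_sq (u t) \<partial>lborel) < \<infinity>"
    using u T unfolding admissible_input_def l2_sq_def by blast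
  have "AE t in lborel. l2_sq (u t) * indicator {0..T} t \<noteq> \<infinity>"
    by (rule nn_integral_PInf_AE) (use fin in auto)
  then have AE: "AE t in lborel. t \<in> {0..T} \<longrightarrow> l2_sq (u t) < \<infinity>"
    by eventually_elim (auto simp: less_top)
  show sq: "set_integrable lborel {0..T} (\<lambda>t. (l2_norm (u t))\<^sup>2)"
    unfolding set_integrable_def
  proof (rule integrableI_bounded)
    have "(\<integral>\<^sup>+ t. ennreal (norm (indicator {0..T} t *\<^sub>R (l2_norm (u t))\<^sup>2)) \<partial>lborel) = (\<integral>\<^sup>+ t\<in>{0..T}. l2_sq (u t) \<partial>lborel)"
      by (rule nn_integral_cong_AE) (use AE in eventually_elim, auto simp: indicator_def ennreal_l2_norm)
    with fin show "(\<integral>\<^sup>+ t. ennreal (norm (indicator {0..T} t *\<^sub>R (l2_norm (u t))\<^sup>2)) \<partial>lborel) < \<infinity>" by simp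
  qed measurable
  have "integrable lborel (\<lambda>t. indicator {0..T} t *\<^sub>R l2_norm (u t))"
  proof (rule Bochner_Integration.integrable_bound)
    show "integrable lborel (\<lambda>t. 1 * indicator {0..T} t + indicator {0..T} t *\<^sub>R (l2_norm (u t))\<^sup>2)"
      using sq unfolding set_integrable_def
      by (intro Bochner_Integration.integrable_add integrable_indicator_Icc)
    \<comment> \<open>Consequence of the nonnegativity of the square of x - 1/2. The constant 1 is
      integrable because the time interval is finite.\<close>
    have "x \<le> 1 + x\<^sup>2" for x :: real using sum_power2_ge_zero[of "x - 1/2" 0] by (simp add: power2_eq_square algebra_simps)
    then show "AE t in lborel. norm (indicator {0..T} t *\<^sub>R l2_norm (u t)) \<le> norm (1 * indicator {0..T} t + indicator {0..T} t *\<^sub>R (l2_norm (u t))\<^sup>2)"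
      by (intro AE_I2) (auto simp: indicator_def)
  qed measurable
  with m AE show "L2_input T u" by (simp add: L2_input_def set_integrable_def)
qed

section \<open>Truncation of inputs\<close>

locale l2_network = bounded_network A B C D G As Bs Cs Ds Gs M
  for A :: "int^'v \<Rightarrow> real^'n^'n" and B :: "int^'v \<Rightarrow> real^'m^'n"
    and C :: "int^'v \<Rightarrow> real^'n^'r" and D :: "int^'v \<Rightarrow> real^'m^'r"
    and G :: "int^'v \<Rightarrow> real^'r^'m"
    and As Bs Cs Ds Gs and M :: real +
  fixes d :: real
  assumes lA: "l2_le A d" and lB: "l2_le B d" and lC: "l2_le C d" and lD: "l2_le D d" and lG: "l2_le G d"
begin

text \<open>Norm bound for exp(sA)B on square-summable sequences, valid for |s| \<le> T; the second
  factor M comes from B.\<close>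

definition kst :: "real \<Rightarrow> real" where "kst T = exp (T * M) * M"

text \<open>Not divided by T: the time integral of the spatial norm over [0, T].\<close>

definition avg :: "real \<Rightarrow> (real \<Rightarrow> int^'v \<Rightarrow> real^'m) \<Rightarrow> real" where
  "avg T v = (LINT \<tau>:{0..T}|lborel. l2_norm (v \<tau>))"

lemma kst_nonneg [simp]: "0 \<le> kst T"
  using M_nonneg by (simp add: kst_def)

lemma semigroup_toep_l2_le:
  assumes v: "l2_sq (w :: int^'v \<Rightarrow> real^'m) < \<infinity>" and s: "\<bar>s\<bar> \<le> T"
  shows "l2_le (semigroup A s (toep B w)) (kst T * l2_norm w)"
proof (rule l2_le_mono)
  show "l2_le (semigroup A s (toep B w)) (exp (\<bar>s\<bar> * M) * (M * l2_norm w))"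
    by (rule semigroup_l2_le[OF symA bA lA toep_l2_le[OF symB bB lB l2_le_l2_norm[OF v]]])
  have "\<bar>s\<bar> * M \<le> T * M" using s M_nonneg by (intro mult_right_mono)
  then have "exp (\<bar>s\<bar> * M) * (M * l2_norm w) \<le> exp (T * M) * (M * l2_norm w)"
    using M_nonneg by (intro mult_right_mono) auto
  then show "exp (\<bar>s\<bar> * M) * (M * l2_norm w) \<le> kst T * l2_norm w" by (simp add: kst_def mult.assoc)
qed

lemma net_state_measurable_integrand:
  assumes v: "\<And>k. (\<lambda>t. v t k) \<in> borel_measurable borel"
  shows "(\<lambda>\<tau>. semigroup A (t - \<tau>) (toep B (v \<tau>)) j) \<in> borel_measurable borel"
  by (rule borel_measurable_semigroup) (auto intro!: borel_measurable_toep v)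

lemma net_state_integrable:
  assumes v: "L2_input T v" and t: "t \<le> T"
  shows "integrable lborel (\<lambda>\<tau>. indicator {0..t} \<tau> *\<^sub>R semigroup A (t - \<tau>) (toep B (v \<tau>)) j)"
proof (rule Bochner_Integration.integrable_bound)
  have vm: "(\<lambda>t. v t k) \<in> borel_measurable borel" for k using v by (simp add: L2_input_def)
  note [measurable] = net_state_measurable_integrand[of v, OF vm]
  show "(\<lambda>\<tau>. indicator {0..t} \<tau> *\<^sub>R semigroup A (t - \<tau>) (toep B (v \<tau>)) j) \<in> borel_measurable lborel"
    by measurable
  show "integrable lborel (\<lambda>\<tau>. kst T * (indicator {0..T} \<tau> *\<^sub>R l2_norm (v \<tau>)))"
    using v by (simp add: L2_input_def set_integrable_def)
  have "AE \<tau> in lborel. \<tau> \<in> {0..T} \<longrightarrow> l2_sq (v \<tau>) < \<infinity>" using v by (simp add: L2_input_def)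
  then show "AE \<tau> in lborel. norm (indicator {0..t} \<tau> *\<^sub>R semigroup A (t - \<tau>) (toep B (v \<tau>)) j)
      \<le> norm (kst T * (indicator {0..T} \<tau> *\<^sub>R l2_norm (v \<tau>)))"
  proof eventually_elim
    case (elim \<tau>)
    show ?case
    proof (cases "\<tau> \<in> {0..t}")
      case True
      then have "norm (semigroup A (t - \<tau>) (toep B (v \<tau>)) j) \<le> kst T * l2_norm (v \<tau>)"
        using elim t by (intro l2_le_nth[OF semigroup_toep_l2_le]) auto
      then show ?thesis using True t by (simp add: abs_mult)
    qed simp
  qed
qed

lemma net_state_l2_le:
  assumes v: "L2_input T v" and t: "t \<le> T"
  shows "l2_le (net_state A B v t) (kst T * avg T v)"
proof -
  have vi: "integrable lborel (\<lambda>\<tau>. indicator {0..T} \<tau> *\<^sub>R l2_norm (v \<tau>))"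
    using v by (simp add: L2_input_def set_integrable_def)
  have "l2_le (\<lambda>j. LINT \<tau>|lborel. indicator {0..t} \<tau> *\<^sub>R semigroup A (t - \<tau>) (toep B (v \<tau>)) j)
     (LINT \<tau>|lborel. kst T * (indicator {0..T} \<tau> *\<^sub>R l2_norm (v \<tau>)))"
  proof (rule l2_le_integral[OF net_state_integrable[OF v t]])
    show "integrable lborel (\<lambda>\<tau>. kst T * (indicator {0..T} \<tau> *\<^sub>R l2_norm (v \<tau>)))" using vi by simp
    have "AE \<tau> in lborel. \<tau> \<in> {0..T} \<longrightarrow> l2_sq (v \<tau>) < \<infinity>" using v by (simp add: L2_input_def)
    then show "AE \<tau> in lborel. l2_le (\<lambda>j. indicator {0..t} \<tau> *\<^sub>R semigroup A (t - \<tau>) (toep B (v \<tau>)) j)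
        (kst T * (indicator {0..T} \<tau> *\<^sub>R l2_norm (v \<tau>)))"
    proof eventually_elim
      case (elim \<tau>)
      show ?case
      proof (cases "\<tau> \<in> {0..t}")
        case True
        then have "l2_le (semigroup A (t - \<tau>) (toep B (v \<tau>))) (kst T * l2_norm (v \<tau>))"
          using elim t by (intro semigroup_toep_l2_le) auto
        then show ?thesis using True t by simp
      qed (simp add: l2_le_zero)
    qed
  qed
  then show ?thesis
    by (simp add: net_state_def[abs_def] set_lebesgue_integral_def avg_def)
qed

text \<open>Linearity of the integrand is available only at times where both inputs are square
  summable in space, which is almost every time.\<close>

lemma net_state_diff:
  assumes v: "L2_input T v" and w: "L2_input T w" and t: "t \<le> T"
  shows "net_state A B (\<lambda>t k. v t k - w t k) t j = net_state A B v t j - net_state A B w t j"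
proof -
  have vm: "(\<lambda>t. v t k) \<in> borel_measurable borel" "(\<lambda>t. w t k) \<in> borel_measurable borel" for k
    using v w by (simp_all add: L2_input_def)
  have dm: "(\<lambda>t. v t k - w t k) \<in> borel_measurable borel" for k using vm by measurable
  note iv = net_state_integrable[OF v t, of j] and iw = net_state_integrable[OF w t, of j]
  have "net_state A B (\<lambda>t k. v t k - w t k) t j
     = (LINT \<tau>|lborel. indicator {0..t} \<tau> *\<^sub>R semigroup A (t - \<tau>) (toep B (v \<tau>)) j - indicator {0..t} \<tau> *\<^sub>R semigroup A (t - \<tau>) (toep B (w \<tau>)) j)"
    unfolding net_state_def set_lebesgue_integral_def
  proof (rule integral_cong_AE)
    note [measurable] = net_state_measurable_integrand[of "\<lambda>t k. v t k - w t k", OF dm]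
      net_state_measurable_integrand[of v, OF vm(1)] net_state_measurable_integrand[of w, OF vm(2)]
    show "(\<lambda>\<tau>. indicator {0..t} \<tau> *\<^sub>R semigroup A (t - \<tau>) (toep B (\<lambda>k. v \<tau> k - w \<tau> k)) j) \<in> borel_measurable lborel"
      "(\<lambda>\<tau>. indicator {0..t} \<tau> *\<^sub>R semigroup A (t - \<tau>) (toep B (v \<tau>)) j - indicator {0..t} \<tau> *\<^sub>R semigroup A (t - \<tau>) (toep B (w \<tau>)) j) \<in> borel_measurable lborel"
      by measurable
    have "AE \<tau> in lborel. \<tau> \<in> {0..T} \<longrightarrow> l2_sq (v \<tau>) < \<infinity>" "AE \<tau> in lborel. \<tau> \<in> {0..T} \<longrightarrow> l2_sq (w \<tau>) < \<infinity>"
      using v w by (simp_all add: L2_input_def)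
    then show "AE \<tau> in lborel. indicator {0..t} \<tau> *\<^sub>R semigroup A (t - \<tau>) (toep B (\<lambda>k. v \<tau> k - w \<tau> k)) j
       = indicator {0..t} \<tau> *\<^sub>R semigroup A (t - \<tau>) (toep B (v \<tau>)) j - indicator {0..t} \<tau> *\<^sub>R semigroup A (t - \<tau>) (toep B (w \<tau>)) j"
    proof eventually_elim
      case (elim \<tau>)
      show ?case
      proof (cases "\<tau> \<in> {0..t}")
        case True
        then have l: "l2_le (v \<tau>) (l2_norm (v \<tau>))" "l2_le (w \<tau>) (l2_norm (w \<tau>))"
          using elim t by (auto intro!: l2_le_l2_norm)
        have "toep B (\<lambda>k. v \<tau> k - w \<tau> k) = (\<lambda>k. toep B (v \<tau>) k - toep B (w \<tau>) k)"
          by (rule ext) (rule toep_diff[OF lB l])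
        then show ?thesis
          using semigroup_diff[OF symA bA lA toep_l2_le[OF symB bB lB l(1)] toep_l2_le[OF symB bB lB l(2)]]
          by (simp add: scaleR_diff_right)
      qed simp
    qed
  qed
  then show ?thesis
    by (simp add: net_state_def set_lebesgue_integral_def Bochner_Integration.integral_diff[OF iv iw])
qed

lemma net_output_l2_le:
  assumes v: "L2_input T v" and t: "t \<le> T" and fin: "l2_sq (v t) < \<infinity>"
  shows "l2_le (net_output A B C D v t) (M * (kst T * avg T v) + M * l2_norm (v t))"
  unfolding net_output_def[abs_def]
  by (intro l2_le_add toep_l2_le[OF symC bC lC net_state_l2_le[OF v t]] toep_l2_le[OF symD bD lD l2_le_l2_norm[OF fin]])

lemma net_output_diff:
  assumes v: "L2_input T v" and w: "L2_input T w" and t: "t \<le> T"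
    and fin: "l2_sq (v t) < \<infinity>" "l2_sq (w t) < \<infinity>"
  shows "net_output A B C D (\<lambda>t k. v t k - w t k) t j = net_output A B C D v t j - net_output A B C D w t j"
proof -
  have "net_state A B (\<lambda>t k. v t k - w t k) t = (\<lambda>k. net_state A B v t k - net_state A B w t k)"
    by (rule ext) (rule net_state_diff[OF v w t])
  then show ?thesis
    using toep_diff[OF lC net_state_l2_le[OF v t] net_state_l2_le[OF w t]]
      toep_diff[OF lD l2_le_l2_norm[OF fin(1)] l2_le_l2_norm[OF fin(2)]]
    by (simp add: net_output_def)
qed

text \<open>Bound for the spatial norm of the weighted output G y at time t, where a is the
  time-integrated norm of the input and b its norm at time t. The first summand accounts for the
  state, the second for the feedthrough.\<close>

definition sbound :: "real \<Rightarrow> real \<Rightarrow> real \<Rightarrow> real" where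
  "sbound T a b = M * (M * (kst T * a) + M * b)"

lemma supply_rate_abs_le:
  assumes v: "L2_input T v" and t: "t \<le> T" and fin: "l2_sq (v t) < \<infinity>"
  shows "\<bar>supply_rate G A B C D v t\<bar> \<le> l2_norm (v t) * sbound T (avg T v) (l2_norm (v t))"
  unfolding supply_rate_def sbound_def
  by (rule l2_inner(2)[OF l2_le_l2_norm[OF fin] toep_l2_le[OF symG bG lG net_output_l2_le[OF v t fin]]])

text \<open>The supply rate is a bilinear form on the diagonal. With e = v - w, the difference is
  the pairing of e with the weighted output of v plus the pairing of w with the weighted output of
  e, and both are small with e.\<close>

lemma supply_rate_diff_le:
  assumes v: "L2_input T v" and w: "L2_input T w" and vw: "L2_input T (\<lambda>t k. v t k - w t k)" and t: "t \<le> T"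
    and fin: "l2_sq (v t) < \<infinity>" "l2_sq (w t) < \<infinity>" "l2_sq (\<lambda>k. v t k - w t k) < \<infinity>"
  shows "\<bar>supply_rate G A B C D v t - supply_rate G A B C D w t\<bar>
    \<le> l2_norm (\<lambda>k. v t k - w t k) * sbound T (avg T v) (l2_norm (v t))
      + l2_norm (w t) * sbound T (avg T (\<lambda>t k. v t k - w t k)) (l2_norm (\<lambda>k. v t k - w t k))"
proof -
  let ?e = "\<lambda>t k. v t k - w t k"
  let ?Gv = "toep G (net_output A B C D v t)" and ?Gw = "toep G (net_output A B C D w t)"
  note lv = net_output_l2_le[OF v t fin(1)] and lw = net_output_l2_le[OF w t fin(2)]
  note gv = toep_l2_le[OF symG bG lG lv] and gw = toep_l2_le[OF symG bG lG lw]
  have "net_output A B C D ?e t = (\<lambda>j. net_output A B C D v t j - net_output A B C D w t j)"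
    by (rule ext) (rule net_output_diff[OF v w t fin(1,2)])
  then have Ge: "toep G (net_output A B C D ?e t) j = ?Gv j - ?Gw j" for j
    using toep_diff[OF lG lv lw] by simp
  note ge = toep_l2_le[OF symG bG lG net_output_l2_le[OF vw t fin(3)]]
  note a = l2_inner[OF l2_le_l2_norm[OF fin(3)] gv]
  note b = l2_inner[OF l2_le_l2_norm[OF fin(2)] ge]
  note sv = l2_inner(1)[OF l2_le_l2_norm[OF fin(1)] gv] and sw = l2_inner(1)[OF l2_le_l2_norm[OF fin(2)] gw]
  have "infsum (\<lambda>j. v t j \<bullet> ?Gv j) UNIV = infsum (\<lambda>j. (?e t j \<bullet> ?Gv j + w t j \<bullet> toep G (net_output A B C D ?e t) j) + w t j \<bullet> ?Gw j) UNIV"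
    by (simp add: Ge inner_diff_left inner_diff_right)
  also have "\<dots> = infsum (\<lambda>j. ?e t j \<bullet> ?Gv j) UNIV + infsum (\<lambda>j. w t j \<bullet> toep G (net_output A B C D ?e t) j) UNIV + infsum (\<lambda>j. w t j \<bullet> ?Gw j) UNIV"
    using infsum_add[OF summable_on_add[OF a(1) b(1)] sw] infsum_add[OF a(1) b(1)] by simp
  finally have "supply_rate G A B C D v t - supply_rate G A B C D w t
     = infsum (\<lambda>j. ?e t j \<bullet> ?Gv j) UNIV + infsum (\<lambda>j. w t j \<bullet> toep G (net_output A B C D ?e t) j) UNIV"
    by (simp add: supply_rate_def)
  then show ?thesis using a(2) b(2) unfolding sbound_def by linarith
qed

text \<open>Dominated convergence in time. The majorant is quadratic in the spatial norm of u; its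
  integrability is where the square integrability demanded by \<open>admissible_input\<close>
  enters.\<close>

lemma work_truncate_limit:
  assumes u: "admissible_input u" and T: "T > 0"
  shows "(\<lambda>N. work G A B C D (truncate N u) T) \<longlonglongrightarrow> work G A B C D u T"
proof -
  have um: "(\<lambda>t. u t k) \<in> borel_measurable borel" for k using u by (simp add: admissible_input_def)
  have tm: "(\<lambda>t. truncate N u t k) \<in> borel_measurable borel" for N k
    using simple_input_truncate[of u, OF um] by (simp add: simple_input_def)
  have em: "(\<lambda>t. u t k - truncate N u t k) \<in> borel_measurable borel" for N k
    using um tm by measurable
  note uL = admissible_L2_input(1)[OF u T] and usq = admissible_L2_input(2)[OF u T]
  have tL: "L2_input T (truncate N u)" for N
    by (rule L2_input_dominated[OF uL tm truncate_norm_le(1)])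
  have eL: "L2_input T (\<lambda>t k. u t k - truncate N u t k)" for N
    by (rule L2_input_dominated[OF uL em truncate_norm_le(2)])
  have fin: "AE t in lborel. t \<in> {0..T} \<longrightarrow> l2_sq (u t) < \<infinity>" using uL by (simp add: L2_input_def)
  have tfin: "l2_sq (truncate N u t) < \<infinity>" "l2_sq (\<lambda>k. u t k - truncate N u t k) < \<infinity>" if "l2_sq (u t) < \<infinity>" for t N
    by (rule order_le_less_trans[OF l2_sq_mono that], rule truncate_norm_le)+
  have tle: "l2_norm (truncate N u t) \<le> l2_norm (u t)" "l2_norm (\<lambda>k. u t k - truncate N u t k) \<le> l2_norm (u t)"
    if "l2_sq (u t) < \<infinity>" for t N
    by (intro l2_norm_mono truncate_norm_le that)+
  have ui: "integrable lborel (\<lambda>t. indicator {0..T} t *\<^sub>R l2_norm (u t))"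
    using uL by (simp add: L2_input_def set_integrable_def)
  \<comment> \<open>Convergence of the supply rate at one time involves the whole past of the
    remainder, since its state is controlled by the time-integrated norm.\<close>
  have avg0: "(\<lambda>N. avg T (\<lambda>t k. u t k - truncate N u t k)) \<longlonglongrightarrow> 0"
  proof -
    have "(\<lambda>N. LINT t|lborel. indicator {0..T} t *\<^sub>R l2_norm (\<lambda>k. u t k - truncate N u t k)) \<longlonglongrightarrow> (LINT t|(lborel :: real measure). (0::real))"
    proof (rule integral_dominated_convergence[OF _ _ ui])
      have [measurable]: "(\<lambda>t. l2_norm (\<lambda>k. u t k - truncate N u t k)) \<in> borel_measurable borel" for N
        by (rule borel_measurable_l2_sq(2)[OF em])
      show "(\<lambda>t. indicator {0..T} t *\<^sub>R l2_norm (\<lambda>k. u t k - truncate N u t k)) \<in> borel_measurable lborel" for N by measurable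
      show "AE t in lborel. (\<lambda>N. indicator {0..T} t *\<^sub>R l2_norm (\<lambda>k. u t k - truncate N u t k)) \<longlonglongrightarrow> 0"
        using fin
      proof eventually_elim
        case (elim t)
        then show ?case
          using l2_norm_truncate_limit[of u t] by (cases "t \<in> {0..T}") auto
      qed
      show "AE t in lborel. norm (indicator {0..T} t *\<^sub>R l2_norm (\<lambda>k. u t k - truncate N u t k)) \<le> indicator {0..T} t *\<^sub>R l2_norm (u t)" for N
        using fin by eventually_elim (auto simp: indicator_def intro!: tle)
    qed simp
    then show ?thesis by (simp add: avg_def set_lebesgue_integral_def)
  qed
  have avgle: "avg T (truncate N u) \<le> avg T u" for N
    unfolding avg_def set_lebesgue_integral_def
  proof (rule integral_mono_AE[OF _ ui])
    show "integrable lborel (\<lambda>t. indicator {0..T} t *\<^sub>R l2_norm (truncate N u t))"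
      using tL by (simp add: L2_input_def set_integrable_def)
    show "AE t in lborel. indicator {0..T} t *\<^sub>R l2_norm (truncate N u t) \<le> indicator {0..T} t *\<^sub>R l2_norm (u t)"
      using fin by eventually_elim (auto simp: indicator_def intro!: tle)
  qed
  have avgnn: "0 \<le> avg T v" for v
    unfolding avg_def set_lebesgue_integral_def by (rule Bochner_Integration.integral_nonneg) simp
  show ?thesis
    unfolding work_def set_lebesgue_integral_def
  proof (rule integral_dominated_convergence[where w = "\<lambda>t. indicator {0..T} t *\<^sub>R (l2_norm (u t) * sbound T (avg T u) (l2_norm (u t)))"])
    have [measurable]: "supply_rate G A B C D u \<in> borel_measurable borel" "supply_rate G A B C D (truncate N u) \<in> borel_measurable borel" for N
      by (intro borel_measurable_supply_rate um tm)+
    show "(\<lambda>t. indicator {0..T} t *\<^sub>R supply_rate G A B C D u t) \<in> borel_measurable lborel"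
      "(\<lambda>t. indicator {0..T} t *\<^sub>R supply_rate G A B C D (truncate N u) t) \<in> borel_measurable lborel" for N
      by measurable
    have eq: "indicator {0..T} t *\<^sub>R (l2_norm (u t) * sbound T (avg T u) (l2_norm (u t)))
       = (M * (M * (kst T * avg T u))) * (indicator {0..T} t *\<^sub>R l2_norm (u t)) + (M * M) * (indicator {0..T} t *\<^sub>R (l2_norm (u t))\<^sup>2)" for t
      by (simp add: sbound_def power2_eq_square algebra_simps)
    show "integrable lborel (\<lambda>t. indicator {0..T} t *\<^sub>R (l2_norm (u t) * sbound T (avg T u) (l2_norm (u t))))"
      unfolding eq using ui usq unfolding set_integrable_def
      by (intro Bochner_Integration.integrable_add integrable_mult_right)
    show "AE t in lborel. norm (indicator {0..T} t *\<^sub>R supply_rate G A B C D (truncate N u) t)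
        \<le> indicator {0..T} t *\<^sub>R (l2_norm (u t) * sbound T (avg T u) (l2_norm (u t)))" for N
      using fin
    proof eventually_elim
      case (elim t)
      show ?case
      proof (cases "t \<in> {0..T}")
        case True
        then have f: "l2_sq (u t) < \<infinity>" using elim by blast
        have "\<bar>supply_rate G A B C D (truncate N u) t\<bar> \<le> l2_norm (truncate N u t) * sbound T (avg T (truncate N u)) (l2_norm (truncate N u t))"
          using True by (intro supply_rate_abs_le[OF tL] tfin f) auto
        also have "\<dots> \<le> l2_norm (u t) * sbound T (avg T u) (l2_norm (u t))"
          unfolding sbound_def using tle(1)[OF f, of N] avgle[of N] M_nonneg avgnn
          by (intro mult_mono add_mono mult_left_mono) (auto intro!: mult_nonneg_nonneg add_nonneg_nonneg)
        finally show ?thesis using True by simp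
      qed simp
    qed
    show "AE t in lborel. (\<lambda>N. indicator {0..T} t *\<^sub>R supply_rate G A B C D (truncate N u) t)
        \<longlonglongrightarrow> indicator {0..T} t *\<^sub>R supply_rate G A B C D u t"
      using fin
    proof eventually_elim
      case (elim t)
      show ?case
      proof (cases "t \<in> {0..T}")
        case True
        then have f: "l2_sq (u t) < \<infinity>" using elim by blast
        let ?e = "\<lambda>N t k. u t k - truncate N u t k"
        have e0: "(\<lambda>N. l2_norm (?e N t)) \<longlonglongrightarrow> 0" by (rule l2_norm_truncate_limit[of u t, OF f])
        have b: "\<bar>supply_rate G A B C D u t - supply_rate G A B C D (truncate N u) t\<bar>
           \<le> l2_norm (?e N t) * sbound T (avg T u) (l2_norm (u t)) + l2_norm (u t) * sbound T (avg T (?e N)) (l2_norm (?e N t))" for N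
        proof -
          have "\<bar>supply_rate G A B C D u t - supply_rate G A B C D (truncate N u) t\<bar>
           \<le> l2_norm (?e N t) * sbound T (avg T u) (l2_norm (u t)) + l2_norm (truncate N u t) * sbound T (avg T (?e N)) (l2_norm (?e N t))"
            by (rule supply_rate_diff_le[OF uL tL eL _ f tfin[OF f]]) (use True in simp)
          also have "\<dots> \<le> l2_norm (?e N t) * sbound T (avg T u) (l2_norm (u t)) + l2_norm (u t) * sbound T (avg T (?e N)) (l2_norm (?e N t))"
            using tle(1)[OF f, of N] avgnn[of "?e N"] M_nonneg unfolding sbound_def
            by (intro add_left_mono mult_right_mono) (auto intro!: mult_nonneg_nonneg add_nonneg_nonneg)
          finally show ?thesis .
        qed
        have "(\<lambda>N. l2_norm (?e N t) * sbound T (avg T u) (l2_norm (u t)) + l2_norm (u t) * sbound T (avg T (?e N)) (l2_norm (?e N t)))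
           \<longlonglongrightarrow> 0 * sbound T (avg T u) (l2_norm (u t)) + l2_norm (u t) * sbound T 0 0"
          unfolding sbound_def by (intro tendsto_intros e0 avg0)
        then have lim: "(\<lambda>N. l2_norm (?e N t) * sbound T (avg T u) (l2_norm (u t)) + l2_norm (u t) * sbound T (avg T (?e N)) (l2_norm (?e N t))) \<longlonglongrightarrow> 0"
          by (simp add: sbound_def)
        have "(\<lambda>N. supply_rate G A B C D (truncate N u) t) \<longlonglongrightarrow> supply_rate G A B C D u t"
          by (rule LIM_zero_cancel, rule Lim_null_comparison[OF _ lim])
             (use b in \<open>auto intro!: always_eventually simp: abs_minus_commute\<close>)
        then show ?thesis using True by simp
      qed simp
    qed
  qed
qed

end

section \<open>Sufficiency and the equivalence\<close>

text \<open>Each entry is bounded by the operator norm, and the entries are summed crudely; only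
  boundedness has to be transferred to the Frobenius norm.\<close>

lemma norm_matrix_le_onorm:
  fixes K :: "complex^'b^'a"
  shows "norm K \<le> real CARD('a) * (real CARD('b) * onorm (\<lambda>v. K *v v))"
proof -
  have bl: "bounded_linear (\<lambda>v. K *v v)"
    by (rule bounded_bilinear.bounded_linear_right[OF bounded_bilinear_matrix_vector_mult])
  have entry: "norm (K $ i $ j) \<le> onorm (\<lambda>v. K *v v)" for i j
  proof -
    have "K $ i $ j = (K *v axis j 1) $ i"
      by (simp add: matrix_vector_mult_nth axis_def if_distrib cong: if_cong)
    then have "norm (K $ i $ j) \<le> norm (K *v axis j 1)"
      by (simp add: Finite_Cartesian_Product.norm_nth_le)
    also have "\<dots> \<le> onorm (\<lambda>v. K *v v) * norm (axis j 1 :: complex^'b)" by (rule onorm[OF bl])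
    also have "norm (axis j 1 :: complex^'b) = 1" by simp
    finally show ?thesis by simp
  qed
  have "norm K \<le> (\<Sum>i\<in>UNIV. norm (K $ i))"
    unfolding norm_vec_def[of K] by (rule L2_set_le_sum) simp
  also have "\<dots> \<le> (\<Sum>i\<in>(UNIV :: 'a set). real CARD('b) * onorm (\<lambda>v. K *v v))"
  proof (rule sum_mono)
    fix i
    have "norm (K $ i) \<le> (\<Sum>j\<in>UNIV. norm (K $ i $ j))"
      unfolding norm_vec_def[of "K $ i"] by (rule L2_set_le_sum) simp
    also have "\<dots> \<le> (\<Sum>j\<in>(UNIV :: 'b set). onorm (\<lambda>v. K *v v))" by (intro sum_mono entry)
    finally show "norm (K $ i) \<le> real CARD('b) * onorm (\<lambda>v. K *v v)" by simp
  qed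
  finally show ?thesis by simp
qed

text \<open>The symbol is replaced by 0 wherever it exceeds the bound. On the torus this happens on
  a null set only, so the defining quadratic mean limit is unaffected; outside the torus, where
  nothing is assumed, it enforces the bound.\<close>

lemma bounded_symbol_exists:
  fixes K :: "int^'v \<Rightarrow> real^'b^'a"
  assumes sym: "is_symbol_of Ks K" and b: "ess_bounded_symbol Ks"
  obtains Ks' M where "is_symbol_of Ks' K" "\<And>\<sigma>. norm (Ks' \<sigma>) \<le> M" "AE \<sigma> in tmeas. Ks' \<sigma> = Ks \<sigma>"
proof -
  have [measurable]: "Ks \<in> borel_measurable borel" using sym by (simp add: is_symbol_of_def)
  obtain M0 where M0: "AE \<sigma> in lborel. \<sigma> \<in> torus \<longrightarrow> onorm (\<lambda>v. Ks \<sigma> *v v) \<le> M0"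
    using b unfolding ess_bounded_symbol_def by blast
  \<comment> \<open>The maximum with 0 keeps M a valid bound at the points where the symbol is
    replaced by 0.\<close>
  define M where "M = max 0 (real CARD('a) * (real CARD('b) * M0))"
  define Ks' where "Ks' \<sigma> = (if norm (Ks \<sigma>) \<le> M then Ks \<sigma> else 0)" for \<sigma>
  have eq: "AE \<sigma> in lborel. \<sigma> \<in> torus \<longrightarrow> Ks' \<sigma> = Ks \<sigma>"
    using M0
  proof eventually_elim
    case (elim \<sigma>)
    show ?case
    proof
      assume "\<sigma> \<in> torus"
      with elim have o: "onorm (\<lambda>v. Ks \<sigma> *v v) \<le> M0" by blast
      have "norm (Ks \<sigma>) \<le> real CARD('a) * (real CARD('b) * onorm (\<lambda>v. Ks \<sigma> *v v))" by (rule norm_matrix_le_onorm)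
      also have "\<dots> \<le> real CARD('a) * (real CARD('b) * M0)" by (intro mult_left_mono o) auto
      finally have "norm (Ks \<sigma>) \<le> M" by (simp add: M_def)
      then show "Ks' \<sigma> = Ks \<sigma>" by (simp add: Ks'_def)
    qed
  qed
  have [measurable]: "Ks' \<in> borel_measurable borel" unfolding Ks'_def[abs_def] by measurable
  have "(\<integral>\<^sup>+ \<sigma>\<in>torus. ennreal ((norm (Ks' \<sigma> - (\<Sum>l\<in>F. fourier_term K l \<sigma>)))^2) \<partial>lborel)
      = (\<integral>\<^sup>+ \<sigma>\<in>torus. ennreal ((norm (Ks \<sigma> - (\<Sum>l\<in>F. fourier_term K l \<sigma>)))^2) \<partial>lborel)" for F
    by (rule nn_integral_cong_AE) (use eq in eventually_elim, auto simp: indicator_def)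
  then have "is_symbol_of Ks' K"
    using sym by (simp add: is_symbol_of_def)
  moreover have "norm (Ks' \<sigma>) \<le> M" for \<sigma> by (simp add: Ks'_def M_def)
  moreover have "AE \<sigma> in tmeas. Ks' \<sigma> = Ks \<sigma>" unfolding AE_tmeas by (rule eq)
  ultimately show ?thesis using that by blast
qed

lemma l2_le_of_summable:
  fixes K :: "'i \<Rightarrow> 'a::real_normed_vector" and g :: "'i \<Rightarrow> real"
  assumes g: "g summable_on UNIV" and le: "\<And>l. (norm (K l))\<^sup>2 \<le> g l"
  shows "l2_le K (sqrt (infsum g UNIV))"
proof -
  have nn: "0 \<le> g l" for l using le[of l] by (meson order_trans zero_le_power2)
  have "0 \<le> infsum g UNIV" by (rule infsum_nonneg) (rule nn)
  moreover have "(\<Sum>j\<in>F. (norm (K j))\<^sup>2) \<le> infsum g UNIV" if "finite F" for F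
  proof -
    have "(\<Sum>j\<in>F. (norm (K j))\<^sup>2) \<le> (\<Sum>j\<in>F. g j)" by (rule sum_mono) (rule le)
    also have "\<dots> \<le> infsum g UNIV" by (rule finite_sum_le_infsum[OF g that]) (auto intro: nn)
    finally show ?thesis .
  qed
  ultimately show ?thesis unfolding l2_le_iff_sum by simp
qed

section \<open>Almost every temporal frequency versus every temporal frequency\<close>

lemma continuous_AE_nonneg:
  fixes f :: "real \<Rightarrow> real"
  assumes f: "continuous_on UNIV f" and ae: "AE \<omega> in lborel. 0 \<le> f \<omega>"
  shows "0 \<le> f \<omega>"
proof (rule ccontr)
  assume "\<not> 0 \<le> f \<omega>"
  then have "f \<omega> < 0" by simp
  then have ne: "{\<omega>. f \<omega> < 0} \<noteq> {}" by blast
  have op: "open {\<omega>. f \<omega> < 0}" using f by (intro open_Collect_less continuous_intros)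
  have "{\<omega>. f \<omega> < 0} \<in> null_sets lborel"
    using ae by (subst (asm) AE_iff_null) (use op in \<open>auto simp: not_le\<close>)
  then have "negligible {\<omega>. f \<omega> < 0}"
    by (auto simp: negligible_iff_null_sets null_sets_completionI)
  with open_not_negligible[OF op ne] show False by blast
qed

text \<open>Fubini for null sets. P itself is not known to be measurable, so sections are taken of a
  measurable null set containing the exceptions. Almost every section is null, and
  \<open>cont\<close> upgrades almost every \<omega> to every \<omega>.\<close>

lemma AE_lborel_prod_iff:
  fixes P :: "real \<Rightarrow> 'b::euclidean_space \<Rightarrow> bool"
  assumes cont: "\<And>\<sigma>. (AE \<omega> in lborel. P \<omega> \<sigma>) \<Longrightarrow> \<forall>\<omega>. P \<omega> \<sigma>"
  shows "(AE p in (lborel :: (real \<times> 'b) measure). P (fst p) (snd p)) \<longleftrightarrow> (AE \<sigma> in lborel. \<forall>\<omega>. P \<omega> \<sigma>)"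
proof
  assume "AE p in (lborel :: (real \<times> 'b) measure). P (fst p) (snd p)"
  then have "AE p in (lborel :: real measure) \<Otimes>\<^sub>M (lborel :: 'b measure). P (fst p) (snd p)"
    unfolding lborel_prod .
  then obtain N where N: "{p \<in> space ((lborel :: real measure) \<Otimes>\<^sub>M (lborel :: 'b measure)). \<not> P (fst p) (snd p)} \<subseteq> N"
    "emeasure (lborel \<Otimes>\<^sub>M lborel) N = 0" "N \<in> sets (lborel \<Otimes>\<^sub>M lborel)" by (rule AE_E)
  have "(\<integral>\<^sup>+\<sigma>. emeasure lborel ((\<lambda>\<omega>. (\<omega>, \<sigma>)) -` N) \<partial>lborel) = 0"
    using lborel_pair.emeasure_pair_measure_alt2[OF N(3)] N(2) by simp
  moreover have "(\<lambda>\<sigma>. emeasure lborel ((\<lambda>\<omega>. (\<omega>, \<sigma>)) -` N)) \<in> borel_measurable (lborel :: 'b measure)"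
    by (rule lborel_pair.measurable_emeasure_Pair2[OF N(3)])
  ultimately have "AE \<sigma> in lborel. emeasure lborel ((\<lambda>\<omega>. (\<omega>, \<sigma>)) -` N) = 0"
    by (simp add: nn_integral_0_iff_AE)
  then show "AE \<sigma> in lborel. \<forall>\<omega>. P \<omega> \<sigma>"
  proof eventually_elim
    case (elim \<sigma>)
    have "(\<lambda>\<omega>. (\<omega>, \<sigma>)) -` N \<in> sets lborel" using sets_Pair2[OF N(3), of \<sigma>] by simp
    with elim have "AE \<omega> in lborel. \<omega> \<notin> (\<lambda>\<omega>. (\<omega>, \<sigma>)) -` N"
      by (intro AE_not_in) (auto simp: null_sets_def)
    then have "AE \<omega> in lborel. P \<omega> \<sigma>"
      by eventually_elim (use N(1) in \<open>force simp: space_pair_measure\<close>)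
    then show ?case by (rule cont)
  qed
next
  assume "AE \<sigma> in lborel. \<forall>\<omega>. P \<omega> \<sigma>"
  then obtain N where N: "{\<sigma> \<in> space lborel. \<not> (\<forall>\<omega>. P \<omega> \<sigma>)} \<subseteq> N" "emeasure lborel N = 0" "N \<in> sets lborel"
    by (rule AE_E)
  have "emeasure (lborel \<Otimes>\<^sub>M lborel) ((UNIV :: real set) \<times> N) = emeasure lborel (UNIV :: real set) * emeasure lborel N"
    by (rule lborel.emeasure_pair_measure_Times) (use N in auto)
  then have "(UNIV :: real set) \<times> N \<in> null_sets (lborel \<Otimes>\<^sub>M lborel)"
    using N(2,3) by (auto simp: null_sets_def intro!: pair_measureI)
  then have "AE p in (lborel :: real measure) \<Otimes>\<^sub>M (lborel :: 'b measure). P (fst p) (snd p)"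
    by (rule AE_I') (use N(1) in auto)
  then show "AE p in (lborel :: (real \<times> 'b) measure). P (fst p) (snd p)" unfolding lborel_prod .
qed

lemma transfer_mult_vec:
  "transfer As Bs Cs Ds (\<i> * complex_of_real \<omega>) \<sigma> *v v = Cs \<sigma> *v resolv (As \<sigma>) \<omega> (Bs \<sigma> *v v) + Ds \<sigma> *v v"
  unfolding transfer_def resolv_def mv_simps matrix_vector_mul_assoc[symmetric] ..

text \<open>At a Hurwitz point the resolvent, and with it the quadratic form at each fixed vector,
  is continuous in \<omega>.\<close>

lemma psd_Emat_continuous:
  assumes hw: "hurwitz (As \<sigma>)" and ae: "AE \<omega> in lborel. psd (Emat Gs As Bs Cs Ds \<omega> \<sigma>)"
  shows "psd (Emat Gs As Bs Cs Ds \<omega> \<sigma>)"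
  unfolding psd_Emat_iff transfer_mult_vec
proof (intro allI)
  fix v
  show "0 \<le> Re (cdot v (Gs \<sigma> *v (Cs \<sigma> *v resolv (As \<sigma>) \<omega> (Bs \<sigma> *v v) + Ds \<sigma> *v v)))"
  proof (rule continuous_AE_nonneg[where f = "\<lambda>\<omega>. Re (cdot v (Gs \<sigma> *v (Cs \<sigma> *v resolv (As \<sigma>) \<omega> (Bs \<sigma> *v v) + Ds \<sigma> *v v)))"])
    show "continuous_on UNIV (\<lambda>\<omega>. Re (cdot v (Gs \<sigma> *v (Cs \<sigma> *v resolv (As \<sigma>) \<omega> (Bs \<sigma> *v v) + Ds \<sigma> *v v))))"
      by (intro continuous_intros bounded_bilinear.continuous_on[OF bounded_bilinear_cdot]
          bounded_bilinear.continuous_on[OF bounded_bilinear_matrix_vector_mult] resolv_continuous[OF hw])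
    show "AE \<omega> in lborel. 0 \<le> Re (cdot v (Gs \<sigma> *v (Cs \<sigma> *v resolv (As \<sigma>) \<omega> (Bs \<sigma> *v v) + Ds \<sigma> *v v)))"
      using ae unfolding psd_Emat_iff transfer_mult_vec by eventually_elim blast
  qed
qed

context l2_network
begin

lemma transfer_nonneg_AE_imp_passive:
  assumes pos: "AE \<sigma> in tmeas. hurwitz (As \<sigma>) \<and>
     (\<forall>\<omega> \<eta>. 0 \<le> Re (cdot \<eta> (Gs \<sigma> *v (Cs \<sigma> *v resolv (As \<sigma>) \<omega> (Bs \<sigma> *v \<eta>) + Ds \<sigma> *v \<eta>))))"
  shows "passive_net G A B C D"
  unfolding passive_net_def
proof (intro allI impI)
  fix u :: "real \<Rightarrow> int^'v \<Rightarrow> real^'m" and T :: real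
  assume u: "admissible_input u" and T: "T > 0"
  have um: "(\<lambda>t. u t k) \<in> borel_measurable borel" for k using u by (simp add: admissible_input_def)
  have "0 \<le> work G A B C D (truncate N u) T" for N
  proof -
    define F where "F = (exhaust N :: (int^'v) set)"
    have w: "simple_input F (real N) (truncate N u)" unfolding F_def by (rule simple_input_truncate[of u, OF um])
    let ?X = "\<lambda>\<sigma>. LINT t:{0..T}|lborel. cdot (uhat F (truncate N u) t \<sigma>) (Gs \<sigma> *v yhat F (truncate N u) t \<sigma>)"
    have int: "integrable tmeas ?X" using T by (intro pairing_integrable(1)[OF w w]) simp
    have "complex_of_real (work G A B C D (truncate N u) T) = (LINT \<sigma>|tmeas. ?X \<sigma>)"
      unfolding work_simple[OF w] by (rule supply_pairing[OF w w])
    then have "work G A B C D (truncate N u) T = (LINT \<sigma>|tmeas. Re (?X \<sigma>))"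
      unfolding integral_Re[OF int] by (metis Re_complex_of_real)
    also have "\<dots> \<ge> 0"
    proof (rule integral_nonneg_AE)
      show "AE \<sigma> in tmeas. 0 \<le> Re (?X \<sigma>)"
        using pos
      proof eventually_elim
        case (elim \<sigma>)
        show ?case
          unfolding yhat_def xhat_def
          by (rule transfer_nonneg_imp_passive[OF _ _ uhat_section_measurable(1)[OF w] norm_uhat_le[OF w]])
             (use elim in auto)
      qed
    qed
    finally show ?thesis .
  qed
  then show "0 \<le> work G A B C D u T"
    by (intro LIMSEQ_le_const[OF work_truncate_limit[OF u T]]) blast
qed

end

theorem theorem2:
  fixes A :: "int^'v \<Rightarrow> real^'n^'n" and B :: "int^'v \<Rightarrow> real^'m^'n"
    and C :: "int^'v \<Rightarrow> real^'n^'r" and D :: "int^'v \<Rightarrow> real^'m^'r"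
    and G :: "int^'v \<Rightarrow> real^'r^'m"
    and As :: "real^'v \<Rightarrow> complex^'n^'n" and Bs :: "real^'v \<Rightarrow> complex^'m^'n"
    and Cs :: "real^'v \<Rightarrow> complex^'n^'r" and Ds :: "real^'v \<Rightarrow> complex^'m^'r"
    and Gs :: "real^'v \<Rightarrow> complex^'r^'m"
  assumes sq_sum: "(\<lambda>l. (norm (A l))^2 + (norm (B l))^2 + (norm (C l))^2 + (norm (D l))^2) summable_on UNIV"
    and sq_sum_G: "(\<lambda>l. (norm (G l))^2) summable_on UNIV"
    and symA: "is_symbol_of As A" and symB: "is_symbol_of Bs B"
    and symC: "is_symbol_of Cs C" and symD: "is_symbol_of Ds D"
    and symG: "is_symbol_of Gs G"
    and bA: "ess_bounded_symbol As" and bB: "ess_bounded_symbol Bs"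
    and bC: "ess_bounded_symbol Cs" and bD: "ess_bounded_symbol Ds"
    and bG: "ess_bounded_symbol Gs"
    and hurw: "\<forall>\<sigma>\<in>torus. hurwitz (As \<sigma>)"
  shows "passive_net G A B C D \<longleftrightarrow>
    (AE p in lborel. snd p \<in> torus \<longrightarrow> psd (Emat Gs As Bs Cs Ds (fst p) (snd p)))"
proof -
  obtain As' MA where A': "is_symbol_of As' A" "\<And>\<sigma>. norm (As' \<sigma>) \<le> MA" "AE \<sigma> in tmeas. As' \<sigma> = As \<sigma>"
    using bounded_symbol_exists[OF symA bA] by blast
  obtain Bs' MB where B': "is_symbol_of Bs' B" "\<And>\<sigma>. norm (Bs' \<sigma>) \<le> MB" "AE \<sigma> in tmeas. Bs' \<sigma> = Bs \<sigma>"
    using bounded_symbol_exists[OF symB bB] by blast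
  obtain Cs' MC where C': "is_symbol_of Cs' C" "\<And>\<sigma>. norm (Cs' \<sigma>) \<le> MC" "AE \<sigma> in tmeas. Cs' \<sigma> = Cs \<sigma>"
    using bounded_symbol_exists[OF symC bC] by blast
  obtain Ds' MD where D': "is_symbol_of Ds' D" "\<And>\<sigma>. norm (Ds' \<sigma>) \<le> MD" "AE \<sigma> in tmeas. Ds' \<sigma> = Ds \<sigma>"
    using bounded_symbol_exists[OF symD bD] by blast
  obtain Gs' MG where G': "is_symbol_of Gs' G" "\<And>\<sigma>. norm (Gs' \<sigma>) \<le> MG" "AE \<sigma> in tmeas. Gs' \<sigma> = Gs \<sigma>"
    using bounded_symbol_exists[OF symG bG] by blast
  define M where "M = max MA (max MB (max MC (max MD MG)))"
  let ?g = "\<lambda>l. (norm (A l))\<^sup>2 + (norm (B l))\<^sup>2 + (norm (C l))\<^sup>2 + (norm (D l))\<^sup>2"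
  define d where "d = max (sqrt (infsum ?g UNIV)) (sqrt (\<Sum>\<^sub>\<infinity>l. (norm (G l))\<^sup>2))"
  have "l2_le A (sqrt (infsum ?g UNIV))" "l2_le B (sqrt (infsum ?g UNIV))"
    "l2_le C (sqrt (infsum ?g UNIV))" "l2_le D (sqrt (infsum ?g UNIV))"
    by (rule l2_le_of_summable[OF sq_sum], simp)+
  moreover have "l2_le G (sqrt (\<Sum>\<^sub>\<infinity>l. (norm (G l))\<^sup>2))"
    by (rule l2_le_of_summable[OF sq_sum_G]) simp
  ultimately interpret l2_network A B C D G As' Bs' Cs' Ds' Gs' M d
    using A'(1) B'(1) C'(1) D'(1) G'(1)
    by unfold_locales
       (auto simp: M_def d_def le_max_iff_disj A'(2) B'(2) C'(2) D'(2) G'(2) elim!: l2_le_mono)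
  have hw: "AE \<sigma> in tmeas. hurwitz (As \<sigma>)"
    using AE_tmeas_torus by eventually_elim (use hurw in blast)
  \<comment> \<open>Off the torus the condition is vacuous; on it the Hurwitz property holds at
    every point, so the continuity hypothesis of \<open>AE_lborel_prod_iff\<close> is met for all
    \<sigma>.\<close>
  have "(AE p in lborel. snd p \<in> torus \<longrightarrow> psd (Emat Gs As Bs Cs Ds (fst p) (snd p))) \<longleftrightarrow>
      (AE \<sigma> in lborel. \<forall>\<omega>. \<sigma> \<in> torus \<longrightarrow> psd (Emat Gs As Bs Cs Ds \<omega> \<sigma>))"
    by (rule AE_lborel_prod_iff) (use hurw in \<open>auto intro: psd_Emat_continuous\<close>)
  also have "\<dots> \<longleftrightarrow> (AE \<sigma> in tmeas. \<forall>\<omega>. psd (Emat Gs As Bs Cs Ds \<omega> \<sigma>))"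
    unfolding AE_tmeas by (rule AE_cong) blast
  also have "\<dots> \<longleftrightarrow> (AE \<sigma> in tmeas. hurwitz (As' \<sigma>) \<and>
     (\<forall>\<omega> \<eta>. 0 \<le> Re (cdot \<eta> (Gs' \<sigma> *v (Cs' \<sigma> *v resolv (As' \<sigma>) \<omega> (Bs' \<sigma> *v \<eta>) + Ds' \<sigma> *v \<eta>)))))"
    (is "_ \<longleftrightarrow> (AE \<sigma> in tmeas. hurwitz (As' \<sigma>) \<and> ?P \<sigma>)")
  proof -
    \<comment> \<open>Off a null set the bounded representatives coincide with the given symbols, so
      there the two positivity conditions are literally the same and the Hurwitz property carries
      over.\<close>
    have "AE \<sigma> in tmeas. (\<forall>\<omega>. psd (Emat Gs As Bs Cs Ds \<omega> \<sigma>)) \<longleftrightarrow> hurwitz (As' \<sigma>) \<and> ?P \<sigma>"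
      using hw A'(3) B'(3) C'(3) D'(3) G'(3)
      by eventually_elim (simp add: psd_Emat_iff transfer_mult_vec)
    then show ?thesis by (rule eventually_subst)
  qed
  also have "\<dots> \<longleftrightarrow> passive_net G A B C D"
  proof
    assume "passive_net G A B C D"
    from passive_imp_transfer_nonneg_AE[OF this] hw A'(3)
    show "AE \<sigma> in tmeas. hurwitz (As' \<sigma>) \<and> ?P \<sigma>" by eventually_elim simp
  qed (rule transfer_nonneg_AE_imp_passive)
  finally show ?thesis ..
qed

end
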